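(* Let $G$ be a Lie group acting smoothly and transitively on a connected manifold $M$, and let $S$ be a quadratic geodesic orbit spray on $M$ (with respect to $G$). Then $S$ is invariant projectively Finsler metrizable (there exists a $G$-invariant Finsler metric on $M$ whose geodesics are projectively equivalent to the geodesics of $S$) if and only if $S$ is invariant Riemann metrizable (there exists a $G$-invariant Riemannian metric on $M$ whose geodesics coincide with the geodesics of $S$).
   Context: Spray: let $M$ be a smooth finite-dimensional manifold, $J=dx^i\otimes\frac{\partial}{\partial y^i}$ the vertical endomorphism of $TTM$ and $C=y^i\frac{\partial}{\partial y^i}$ the Liouville vector field, in induced coordinates $(x^i,y^i)$ on $TM$. A spray is a smooth vector field $S$ on $TM\setminus\{0\}$ with $JS=C$ and $[C,S]=S$; locally $S=y^i\frac{\partial}{\partial x^i}+f^i(x,y)\frac{\partial}{\partial y^i}$ with $f^i$ positively homogeneous of degree $2$ in $y$. It is called quadratic if the $f^i(x,y)$ are quadratic (polynomial) in $y$. Geodesics of $S$ are the curves $\gamma$ with $\ddot x^i=f^i(x,\dot x)$. Metrics: a Finsler metric on $M$ is given by an energy function $E:TM\to\mathbb R$, smooth on $TM\setminus\{0\}$, positively homogeneous of degree $2$ in $y$, with $\big(\frac{\partial^2E}{\partial y^i\partial y^j}\big)$ positive definite on $TM\setminus\{0\}$ (no reversibility is assumed). It is a Riemannian metric if $E$ is quadratic in $y$. Its geodesics are the solutions of the Euler-Lagrange equations of $E$ (equivalently, the geodesics of the spray determined by $E$). Two families of curves are projectively equivalent if they coincide up to orientation preserving reparameterization of the curves. Homogeneous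 setting: the action is written $\lambda_g m=g\cdot m$; fix an origin $o\in M$ with stabiliser $H$, so $M\cong G/H$. Sprays, metrics and functions are called invariant if they are invariant under the action of $G$ (for a function $L$ on $TM$: $L\circ(\lambda_g)_*=L$ for all $g\in G$; a metric is invariant if its energy function is). A geodesic $\gamma$ emanating from $o$ is homogeneous if there is $X_\gamma\in\mathfrak g$ (the Lie algebra of $G$) with $\gamma(t)=\exp(tX_\gamma)\cdot o$. A spray is a geodesic orbit spray (g.o. spray) if it is $G$-invariant and every geodesic emanating from $o$ is homogeneous. *)

theory Defs
  imports "HOL-Analysis.Analysis" "HOL-Algebra.Group_Action"
begin

section \<open>Smooth maps between open subsets of normed spaces\<close>

primrec Ck_on :: "nat \<Rightarrow> 'a::real_normed_vector set \<Rightarrow> ('a \<Rightarrow> 'b::real_normed_vector) \<Rightarrow> bool" where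
  "Ck_on 0 U f \<longleftrightarrow> continuous_on U f"
| "Ck_on (Suc k) U f \<longleftrightarrow> (\<forall>x\<in>U. f differentiable (at x)) \<and>
     (\<forall>w. Ck_on k U (\<lambda>x. frechet_derivative f (at x) w))"

text \<open>Used for open \<open>U\<close> in finite-dimensional spaces only; there it is the usual notion.\<close>

definition smooth_on :: "'a::real_normed_vector set \<Rightarrow> ('a \<Rightarrow> 'b::real_normed_vector) \<Rightarrow> bool" where
  "smooth_on U f \<longleftrightarrow> (\<forall>k. Ck_on k U f)"


section \<open>Manifolds given by an atlas\<close>

text \<open>A chart is a pair of its domain and its coordinate map; the values of the coordinate map
  outside the domain are irrelevant. The atlas need not be maximal. Tangent vectors below are
  indexed by the charts of the given atlas; a compatible atlas yields canonically isomorphic ones.\<close>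

type_synonym ('m, 'e) chart = "'m set \<times> ('m \<Rightarrow> 'e)"
type_synonym ('m, 'e) atlas = "('m, 'e) chart set"

definition chart_inv :: "('m, 'e) chart \<Rightarrow> 'e \<Rightarrow> 'm" where
  "chart_inv c = inv_into (fst c) (snd c)"

definition chart_range :: "('m, 'e) chart \<Rightarrow> 'e set" where
  "chart_range c = snd c ` fst c"

definition mcarrier :: "('m, 'e) atlas \<Rightarrow> 'm set" where
  "mcarrier A = (\<Union>c\<in>A. fst c)"

definition mtopology :: "('m, 'e::real_normed_vector) atlas \<Rightarrow> 'm topology" where
  "mtopology A = topology (\<lambda>W. W \<subseteq> mcarrier A \<and> (\<forall>c\<in>A. open (snd c ` (W \<inter> fst c))))"

definition smooth_atlas :: "('m, 'e::real_normed_vector) atlas \<Rightarrow> bool" where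
  "smooth_atlas A \<longleftrightarrow>
     (\<forall>c\<in>A. inj_on (snd c) (fst c) \<and> open (chart_range c)) \<and>
     (\<forall>c\<in>A. \<forall>d\<in>A. open (snd c ` (fst c \<inter> fst d)) \<and>
        smooth_on (snd c ` (fst c \<inter> fst d)) (snd d \<circ> chart_inv c))"

definition smooth_manifold :: "('m, 'e::euclidean_space) atlas \<Rightarrow> bool" where
  "smooth_manifold A \<longleftrightarrow> smooth_atlas A \<and>
     Hausdorff_space (mtopology A) \<and> second_countable (mtopology A)"

lemma openin_mtopology:
  assumes "smooth_atlas A"
  shows "openin (mtopology A) W \<longleftrightarrow>
    W \<subseteq> mcarrier A \<and> (\<forall>c\<in>A. open (snd c ` (W \<inter> fst c)))"
proof -
  let ?L = "\<lambda>W. W \<subseteq> mcarrier A \<and> (\<forall>c\<in>A. open (snd c ` (W \<inter> fst c)))"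
  have "istopology ?L"
    unfolding istopology_def
  proof (intro conjI allI impI)
    fix S T assume S: "?L S" and T: "?L T"
    show "S \<inter> T \<subseteq> mcarrier A" using S by blast
    show "\<forall>c\<in>A. open (snd c ` (S \<inter> T \<inter> fst c))"
    proof
      fix c assume c: "c \<in> A"
      then have "inj_on (snd c) (fst c)" using assms by (simp add: smooth_atlas_def)
      then have "snd c ` ((S \<inter> fst c) \<inter> (T \<inter> fst c)) =
          snd c ` (S \<inter> fst c) \<inter> snd c ` (T \<inter> fst c)"
        by (rule inj_on_image_Int) auto
      moreover have "(S \<inter> fst c) \<inter> (T \<inter> fst c) = S \<inter> T \<inter> fst c" by blast
      ultimately show "open (snd c ` (S \<inter> T \<inter> fst c))" using S T c by (metis open_Int)
    qed
  next
    fix K assume K: "\<forall>S\<in>K. ?L S"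
    show "\<Union>K \<subseteq> mcarrier A" using K by blast
    show "\<forall>c\<in>A. open (snd c ` (\<Union>K \<inter> fst c))"
    proof
      fix c assume c: "c \<in> A"
      have "snd c ` (\<Union>K \<inter> fst c) = (\<Union>S\<in>K. snd c ` (S \<inter> fst c))" by blast
      then show "open (snd c ` (\<Union>K \<inter> fst c))" using K c by (metis (no_types, lifting) open_UN)
    qed
  qed
  then show ?thesis unfolding mtopology_def by (simp add: topology_inverse')
qed

definition euclidean_atlas :: "('e, 'e) atlas" where
  "euclidean_atlas = {(UNIV, id)}"

definition product_atlas :: "('m, 'e) atlas \<Rightarrow> ('n, 'f) atlas \<Rightarrow> ('m \<times> 'n, 'e \<times> 'f) atlas" where
  "product_atlas A B = (\<lambda>(c, d). (fst c \<times> fst d, map_prod (snd c) (snd d))) ` (A \<times> B)"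

definition smooth_map_on ::
  "('m, 'e::real_normed_vector) atlas \<Rightarrow> 'm set \<Rightarrow> ('n, 'f::real_normed_vector) atlas
    \<Rightarrow> ('m \<Rightarrow> 'n) \<Rightarrow> bool" where
  "smooth_map_on A W B f \<longleftrightarrow>
     openin (mtopology A) W \<and>
     continuous_map (subtopology (mtopology A) W) (mtopology B) f \<and>
     (\<forall>c\<in>A. \<forall>d\<in>B. smooth_on (snd c ` (W \<inter> fst c \<inter> f -` fst d)) (snd d \<circ> f \<circ> chart_inv c))"


section \<open>Tangent bundle\<close>

text \<open>A tangent vector at \<open>p\<close> is the family of its components in the charts around \<open>p\<close>, related
  by the derivatives of the coordinate changes. Components with respect to anything else
  are set to \<open>0\<close>, so that equality of tangent vectors is equality in HOL.\<close>

type_synonym ('m, 'e) tangent = "'m \<times> (('m, 'e) chart \<Rightarrow> 'e)"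

definition tangent_bundle :: "('m, 'e::real_normed_vector) atlas \<Rightarrow> ('m, 'e) tangent set" where
  "tangent_bundle A = {(p, v). p \<in> mcarrier A \<and>
     (\<forall>c\<in>A. \<forall>d\<in>A. p \<in> fst c \<inter> fst d \<longrightarrow>
        v d = frechet_derivative (snd d \<circ> chart_inv c) (at (snd c p)) (v c)) \<and>
     (\<forall>c. \<not> (c \<in> A \<and> p \<in> fst c) \<longrightarrow> v c = 0)}"

definition slit_tangent_bundle :: "('m, 'e::real_normed_vector) atlas \<Rightarrow> ('m, 'e) tangent set" where
  "slit_tangent_bundle A = {(p, v) \<in> tangent_bundle A. v \<noteq> (\<lambda>_. 0)}"

definition tangent_space :: "('m, 'e::real_normed_vector) atlas \<Rightarrow> 'm \<Rightarrow> ('m, 'e) tangent set" where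
  "tangent_space A p = {u \<in> tangent_bundle A. fst u = p}"

definition tangent_scale :: "real \<Rightarrow> ('m, 'e::real_normed_vector) tangent \<Rightarrow> ('m, 'e) tangent" where
  "tangent_scale r u = (fst u, \<lambda>c. r *\<^sub>R snd u c)"

text \<open>The induced coordinates \<open>(x, y)\<close>.\<close>

definition tangent_chart ::
  "('m, 'e::real_normed_vector) atlas \<Rightarrow> ('m, 'e) chart \<Rightarrow> (('m, 'e) tangent, 'e \<times> 'e) chart" where
  "tangent_chart A c = ({u \<in> tangent_bundle A. fst u \<in> fst c}, \<lambda>u. (snd c (fst u), snd u c))"

definition tangent_atlas ::
  "('m, 'e::real_normed_vector) atlas \<Rightarrow> (('m, 'e) tangent, 'e \<times> 'e) atlas" where
  "tangent_atlas A = tangent_chart A ` A"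

text \<open>The value does not depend on the chart \<open>c\<close> around the foot point that is chosen.\<close>

definition tangent_map ::
  "('m, 'e::real_normed_vector) atlas \<Rightarrow> ('n, 'f::real_normed_vector) atlas \<Rightarrow> ('m \<Rightarrow> 'n)
    \<Rightarrow> ('m, 'e) tangent \<Rightarrow> ('n, 'f) tangent" where
  "tangent_map A B f u = (f (fst u), \<lambda>d.
     if d \<in> B \<and> f (fst u) \<in> fst d
     then let c = (SOME c. c \<in> A \<and> fst u \<in> fst c)
          in frechet_derivative (snd d \<circ> f \<circ> chart_inv c) (at (snd c (fst u))) (snd u c)
     else 0)"

definition velocity ::
  "('m, 'e::real_normed_vector) atlas \<Rightarrow> (real \<Rightarrow> 'm) \<Rightarrow> real \<Rightarrow> ('m, 'e) tangent" where
  "velocity A \<gamma> t = (\<gamma> t, \<lambda>c.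
     if c \<in> A \<and> \<gamma> t \<in> fst c then vector_derivative (snd c \<circ> \<gamma>) (at t) else 0)"

definition smooth_curve ::
  "('m, 'e::real_normed_vector) atlas \<Rightarrow> real set \<Rightarrow> (real \<Rightarrow> 'm) \<Rightarrow> bool" where
  "smooth_curve A I \<gamma> \<longleftrightarrow> is_interval I \<and> open I \<and> I \<noteq> {} \<and> smooth_map_on euclidean_atlas I A \<gamma>"

definition regular_curve ::
  "('m, 'e::real_normed_vector) atlas \<Rightarrow> real set \<Rightarrow> (real \<Rightarrow> 'm) \<Rightarrow> bool" where
  "regular_curve A I \<gamma> \<longleftrightarrow> smooth_curve A I \<gamma> \<and> (\<forall>t\<in>I. velocity A \<gamma> t \<in> slit_tangent_bundle A)"


section \<open>Vector fields\<close>

definition smooth_vector_field ::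
  "('m, 'e::real_normed_vector) atlas \<Rightarrow> 'm set \<Rightarrow> ('m \<Rightarrow> ('m, 'e) tangent) \<Rightarrow> bool" where
  "smooth_vector_field A W X \<longleftrightarrow>
     smooth_map_on A W (tangent_atlas A) X \<and> (\<forall>p\<in>W. fst (X p) = p)"

definition vf_rep ::
  "('m, 'e) chart \<Rightarrow> ('m \<Rightarrow> ('m, 'e) tangent) \<Rightarrow> 'e \<Rightarrow> 'e" where
  "vf_rep c X z = snd (X (chart_inv c z)) c"

definition lie_bracket ::
  "('m, 'e::real_normed_vector) atlas \<Rightarrow> ('m \<Rightarrow> ('m, 'e) tangent) \<Rightarrow> ('m \<Rightarrow> ('m, 'e) tangent)
    \<Rightarrow> 'm \<Rightarrow> ('m, 'e) tangent" where
  "lie_bracket A X Y p = (p, \<lambda>c.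
     if c \<in> A \<and> p \<in> fst c
     then frechet_derivative (vf_rep c Y) (at (snd c p)) (vf_rep c X (snd c p))
        - frechet_derivative (vf_rep c X) (at (snd c p)) (vf_rep c Y (snd c p))
     else 0)"

text \<open>The atlas \<open>tangent_atlas A\<close> consists of induced charts only, so \<open>J = dx\<^sup>i \<otimes> \<partial>/\<partial>y\<^sup>i\<close>
  sends the components \<open>(\<xi>, \<eta>)\<close> to \<open>(0, \<xi>)\<close> in every chart of \<open>tangent_atlas A\<close>.\<close>

definition vertical_endomorphism ::
  "(('m, 'e::real_normed_vector) tangent, 'e \<times> 'e) tangent
    \<Rightarrow> (('m, 'e) tangent, 'e \<times> 'e) tangent" where
  "vertical_endomorphism Z = (fst Z, \<lambda>d. (0, fst (snd Z d)))"

definition liouville_field ::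
  "('m, 'e::real_normed_vector) atlas \<Rightarrow> ('m, 'e) tangent
    \<Rightarrow> (('m, 'e) tangent, 'e \<times> 'e) tangent" where
  "liouville_field A u = (u, \<lambda>d.
     if d \<in> tangent_atlas A \<and> u \<in> fst d then (0, snd (snd d u)) else 0)"


section \<open>Sprays\<close>

definition spray ::
  "('m, 'e::real_normed_vector) atlas
    \<Rightarrow> (('m, 'e) tangent \<Rightarrow> (('m, 'e) tangent, 'e \<times> 'e) tangent) \<Rightarrow> bool" where
  "spray A S \<longleftrightarrow>
     smooth_vector_field (tangent_atlas A) (slit_tangent_bundle A) S \<and>
     (\<forall>u \<in> slit_tangent_bundle A.
        vertical_endomorphism (S u) = liouville_field A u \<and>
        lie_bracket (tangent_atlas A) (liouville_field A) S u = S u)"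

definition quadratic_on :: "'e::real_vector set \<Rightarrow> ('e \<Rightarrow> 'f::real_vector) \<Rightarrow> bool" where
  "quadratic_on D q \<longleftrightarrow> (\<exists>B. bilinear B \<and> (\<forall>y\<in>D. q y = B y y))"

text \<open>In induced coordinates a spray is \<open>(x, y) \<mapsto> (y, f (x, y))\<close>; the second component of
  its local representation is \<open>f\<close>.\<close>

definition quadratic_spray ::
  "('m, 'e::real_normed_vector) atlas
    \<Rightarrow> (('m, 'e) tangent \<Rightarrow> (('m, 'e) tangent, 'e \<times> 'e) tangent) \<Rightarrow> bool" where
  "quadratic_spray A S \<longleftrightarrow> spray A S \<and>
     (\<forall>c\<in>A. \<forall>x\<in>chart_range c.
        quadratic_on (- {0}) (\<lambda>y. snd (vf_rep (tangent_chart A c) S (x, y))))"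

text \<open>A spray lives on the slit tangent bundle, so geodesics have nowhere vanishing velocity.
  Since \<open>S\<close> is evaluated at the velocity, the equation says that the velocity curve is an
  integral curve of \<open>S\<close>, i.e. \<open>x'' = f (x, x')\<close> in charts.\<close>

definition spray_geodesic ::
  "('m, 'e::real_normed_vector) atlas
    \<Rightarrow> (('m, 'e) tangent \<Rightarrow> (('m, 'e) tangent, 'e \<times> 'e) tangent)
    \<Rightarrow> real set \<Rightarrow> (real \<Rightarrow> 'm) \<Rightarrow> bool" where
  "spray_geodesic A S I \<gamma> \<longleftrightarrow> regular_curve A I \<gamma> \<and>
     (\<forall>t\<in>I. velocity (tangent_atlas A) (velocity A \<gamma>) t = S (velocity A \<gamma> t))"


section \<open>Finsler and Riemannian metrics\<close>

definition energy_rep ::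
  "('m, 'e::real_normed_vector) atlas \<Rightarrow> ('m, 'e) chart \<Rightarrow> (('m, 'e) tangent \<Rightarrow> real)
    \<Rightarrow> 'e \<Rightarrow> 'e \<Rightarrow> real" where
  "energy_rep A c E x y = E (chart_inv (tangent_chart A c) (x, y))"

definition vertical_hessian ::
  "('e::real_normed_vector \<Rightarrow> 'e \<Rightarrow> real) \<Rightarrow> 'e \<Rightarrow> 'e \<Rightarrow> 'e \<Rightarrow> 'e \<Rightarrow> real" where
  "vertical_hessian L x y v w =
     frechet_derivative (\<lambda>y. frechet_derivative (L x) (at y) v) (at y) w"

definition finsler_metric ::
  "('m, 'e::real_normed_vector) atlas \<Rightarrow> (('m, 'e) tangent \<Rightarrow> real) \<Rightarrow> bool" where
  "finsler_metric A E \<longleftrightarrow>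
     smooth_map_on (tangent_atlas A) (slit_tangent_bundle A) euclidean_atlas E \<and>
     (\<forall>u \<in> tangent_bundle A. \<forall>r>0. E (tangent_scale r u) = r\<^sup>2 * E u) \<and>
     (\<forall>c\<in>A. \<forall>x\<in>chart_range c. \<forall>y. y \<noteq> 0 \<longrightarrow>
        (\<forall>w. w \<noteq> 0 \<longrightarrow> vertical_hessian (energy_rep A c E) x y w w > 0))"

definition riemannian_metric ::
  "('m, 'e::real_normed_vector) atlas \<Rightarrow> (('m, 'e) tangent \<Rightarrow> real) \<Rightarrow> bool" where
  "riemannian_metric A E \<longleftrightarrow> finsler_metric A E \<and>
     (\<forall>c\<in>A. \<forall>x\<in>chart_range c. quadratic_on UNIV (energy_rep A c E x))"

text \<open>The Euler-Lagrange equations \<open>d/dt (\<partial>E/\<partial>y\<^sup>i) = \<partial>E/\<partial>x\<^sup>i\<close> along \<open>(x, x')\<close>, tested against an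
  arbitrary direction \<open>w\<close> of the coordinate space.\<close>

definition euler_lagrange_at ::
  "('m, 'e::real_normed_vector) atlas \<Rightarrow> (('m, 'e) tangent \<Rightarrow> real) \<Rightarrow> (real \<Rightarrow> 'm)
    \<Rightarrow> ('m, 'e) chart \<Rightarrow> real \<Rightarrow> bool" where
  "euler_lagrange_at A E \<gamma> c t \<longleftrightarrow>
     (let L = energy_rep A c E; x = snd c \<circ> \<gamma>; x' = (\<lambda>s. vector_derivative x (at s)) in
      \<forall>w. ((\<lambda>s. frechet_derivative (\<lambda>y. L (x s) y) (at (x' s)) w) has_real_derivative
             frechet_derivative (\<lambda>z. L z (x' t)) (at (x t)) w) (at t))"

definition metric_geodesic ::
  "('m, 'e::real_normed_vector) atlas \<Rightarrow> (('m, 'e) tangent \<Rightarrow> real)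
    \<Rightarrow> real set \<Rightarrow> (real \<Rightarrow> 'm) \<Rightarrow> bool" where
  "metric_geodesic A E I \<gamma> \<longleftrightarrow> regular_curve A I \<gamma> \<and>
     (\<forall>t\<in>I. \<forall>c\<in>A. \<gamma> t \<in> fst c \<longrightarrow> euler_lagrange_at A E \<gamma> c t)"


section \<open>Projective equivalence\<close>

text \<open>A family of curves is a predicate on pairs of an open interval and a map whose values
  outside that interval are irrelevant.\<close>

definition oriented_reparametrization :: "real set \<Rightarrow> real set \<Rightarrow> (real \<Rightarrow> real) \<Rightarrow> bool" where
  "oriented_reparametrization J I \<phi> \<longleftrightarrow> is_interval J \<and> open J \<and> \<phi> ` J = I \<and>
     smooth_on J \<phi> \<and> (\<forall>t\<in>J. deriv \<phi> t > 0)"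

definition projectively_equivalent ::
  "(real set \<Rightarrow> (real \<Rightarrow> 'm) \<Rightarrow> bool) \<Rightarrow> (real set \<Rightarrow> (real \<Rightarrow> 'm) \<Rightarrow> bool) \<Rightarrow> bool" where
  "projectively_equivalent F1 F2 \<longleftrightarrow>
     (\<forall>I \<gamma>. F1 I \<gamma> \<longrightarrow> (\<exists>J \<phi>. oriented_reparametrization J I \<phi> \<and> F2 J (\<gamma> \<circ> \<phi>))) \<and>
     (\<forall>I \<gamma>. F2 I \<gamma> \<longrightarrow> (\<exists>J \<phi>. oriented_reparametrization J I \<phi> \<and> F1 J (\<gamma> \<circ> \<phi>)))"


section \<open>Lie groups and homogeneous spaces\<close>

definition lie_group ::
  "('g, 'b) monoid_scheme \<Rightarrow> ('g, 'h::euclidean_space) atlas \<Rightarrow> bool" where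
  "lie_group G B \<longleftrightarrow> group G \<and> smooth_manifold B \<and> carrier G = mcarrier B \<and>
     smooth_map_on (product_atlas B B) (carrier G \<times> carrier G) B (\<lambda>(g, h). g \<otimes>\<^bsub>G\<^esub> h) \<and>
     smooth_map_on B (carrier G) B (\<lambda>g. inv\<^bsub>G\<^esub> g)"

definition one_parameter_subgroup ::
  "('g, 'b) monoid_scheme \<Rightarrow> ('g, 'h::euclidean_space) atlas \<Rightarrow> (real \<Rightarrow> 'g) \<Rightarrow> bool" where
  "one_parameter_subgroup G B \<sigma> \<longleftrightarrow>
     smooth_map_on euclidean_atlas UNIV B \<sigma> \<and> (\<forall>s t. \<sigma> (s + t) = \<sigma> s \<otimes>\<^bsub>G\<^esub> \<sigma> t)"

text \<open>Only the underlying vector space of the Lie algebra is used.\<close>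

definition lie_algebra ::
  "('g, 'b) monoid_scheme \<Rightarrow> ('g, 'h::euclidean_space) atlas \<Rightarrow> ('g, 'h) tangent set" where
  "lie_algebra G B = tangent_space B \<one>\<^bsub>G\<^esub>"

definition lie_exp ::
  "('g, 'b) monoid_scheme \<Rightarrow> ('g, 'h::euclidean_space) atlas \<Rightarrow> ('g, 'h) tangent \<Rightarrow> 'g" where
  "lie_exp G B X =
     (THE g. \<exists>\<sigma>. one_parameter_subgroup G B \<sigma> \<and> velocity B \<sigma> 0 = X \<and> g = \<sigma> 1)"

definition smooth_transitive_action ::
  "('g, 'b) monoid_scheme \<Rightarrow> ('g, 'h::euclidean_space) atlas \<Rightarrow> ('m, 'e::euclidean_space) atlas
    \<Rightarrow> ('g \<Rightarrow> 'm \<Rightarrow> 'm) \<Rightarrow> bool" where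
  "smooth_transitive_action G B A act \<longleftrightarrow>
     transitive_action G (mcarrier A) act \<and>
     smooth_map_on (product_atlas B A) (carrier G \<times> mcarrier A) A (\<lambda>(g, p). act g p)"

definition invariant_function ::
  "('g, 'b) monoid_scheme \<Rightarrow> ('m, 'e::real_normed_vector) atlas \<Rightarrow> ('g \<Rightarrow> 'm \<Rightarrow> 'm)
    \<Rightarrow> (('m, 'e) tangent \<Rightarrow> real) \<Rightarrow> bool" where
  "invariant_function G A act L \<longleftrightarrow>
     (\<forall>g \<in> carrier G. \<forall>u \<in> tangent_bundle A. L (tangent_map A A (act g) u) = L u)"

definition invariant_spray ::
  "('g, 'b) monoid_scheme \<Rightarrow> ('m, 'e::real_normed_vector) atlas \<Rightarrow> ('g \<Rightarrow> 'm \<Rightarrow> 'm)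
    \<Rightarrow> (('m, 'e) tangent \<Rightarrow> (('m, 'e) tangent, 'e \<times> 'e) tangent) \<Rightarrow> bool" where
  "invariant_spray G A act S \<longleftrightarrow> spray A S \<and>
     (\<forall>g \<in> carrier G. \<forall>u \<in> slit_tangent_bundle A.
        S (tangent_map A A (act g) u) =
        tangent_map (tangent_atlas A) (tangent_atlas A) (tangent_map A A (act g)) (S u))"

definition go_spray ::
  "('g, 'b) monoid_scheme \<Rightarrow> ('g, 'h::euclidean_space) atlas \<Rightarrow> ('m, 'e::euclidean_space) atlas
    \<Rightarrow> ('g \<Rightarrow> 'm \<Rightarrow> 'm) \<Rightarrow> 'm
    \<Rightarrow> (('m, 'e) tangent \<Rightarrow> (('m, 'e) tangent, 'e \<times> 'e) tangent) \<Rightarrow> bool" where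
  "go_spray G B A act orig S \<longleftrightarrow> invariant_spray G A act S \<and>
     (\<forall>I \<gamma>. spray_geodesic A S I \<gamma> \<and> 0 \<in> I \<and> \<gamma> 0 = orig \<longrightarrow>
        (\<exists>X \<in> lie_algebra G B. \<forall>t\<in>I. \<gamma> t = act (lie_exp G B (tangent_scale t X)) orig))"

definition invariant_projectively_finsler_metrizable ::
  "('g, 'b) monoid_scheme \<Rightarrow> ('m, 'e::real_normed_vector) atlas \<Rightarrow> ('g \<Rightarrow> 'm \<Rightarrow> 'm)
    \<Rightarrow> (('m, 'e) tangent \<Rightarrow> (('m, 'e) tangent, 'e \<times> 'e) tangent) \<Rightarrow> bool" where
  "invariant_projectively_finsler_metrizable G A act S \<longleftrightarrow>
     (\<exists>E. finsler_metric A E \<and> invariant_function G A act E \<and>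
        projectively_equivalent (metric_geodesic A E) (spray_geodesic A S))"

definition invariant_riemann_metrizable ::
  "('g, 'b) monoid_scheme \<Rightarrow> ('m, 'e::real_normed_vector) atlas \<Rightarrow> ('g \<Rightarrow> 'm \<Rightarrow> 'm)
    \<Rightarrow> (('m, 'e) tangent \<Rightarrow> (('m, 'e) tangent, 'e \<times> 'e) tangent) \<Rightarrow> bool" where
  "invariant_riemann_metrizable G A act S \<longleftrightarrow>
     (\<exists>E. riemannian_metric A E \<and> invariant_function G A act E \<and>
        (\<forall>I \<gamma>. metric_geodesic A E I \<gamma> \<longleftrightarrow> spray_geodesic A S I \<gamma>))"

end

theory Submission
  imports Defs
begin

text \<open>
  Let \<open>E\<close> be an invariant Finsler energy whose geodesics are projectively those of \<open>S\<close>. Geodesics of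
  \<open>S\<close> are orbits of one-parameter subgroups, so \<open>E\<close> is constant along them; hence they solve the
  Euler-Lagrange equations of \<open>E\<close> without reparametrization. Differentiating \<open>S E = 0\<close> in the fibre
  and subtracting the Euler-Lagrange equations shows that \<open>E\<close> is invariant under the parallel transport
  of the affine connection \<open>\<Gamma>\<close> of the quadratic spray \<open>S\<close>. Averaging (Matveev, Szabo): any inner product
  that is built from a norm in a way equivariant under all linear isomorphisms inherits both
  symmetries of \<open>E\<close>. The Binet-Legendre inner product, the inverse of the second moments of the weight
  \<open>max 0 (1 - E)\<close> on the fibre, is therefore \<open>G\<close>-invariant and \<open>\<Gamma>\<close>-parallel. Being parallel, it solves
  a linear first-order system with smooth coefficients, which makes it smooth, and its geodesics are
  those of \<open>S\<close>.
\<close>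

section \<open>Smooth maps\<close>

text \<open>The integrals behind the averaged metric are never differentiated: \<open>E\<close> is
  smooth only off the zero section, and the weight is merely continuous. Instead, \<open>E\<close>
  at \<open>x + v\<close> is pulled back along \<open>y + \<Gamma> v y\<close>; since
  \<open>E\<close> is horizontally constant this changes it by o(v) only, and a mean that depends on
  its gauge in a Lipschitz way then has derivative 0. The weight \<open>max 0 (1 - E)\<close> suits
  this: it is 1-Lipschitz in \<open>E\<close> and compactly supported, whereas the indicator of the
  unit ball would jump. Dividing by the total weight cancels the Jacobian of linear maps, so no
  determinant occurs. Quadraticity is decisive because the fibre derivative of \<open>f\<close> is
  then \<open>2 \<Gamma> w y\<close>, linear in \<open>y\<close>, so that transport is linear and
  respects averages. Projective equivalence and homogeneity are statements about curves; they become
  identities at every tangent vector because a geodesic starts in each nonzero direction.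
  Homogeneity is phrased with \<open>lie_exp\<close>, a definite description, so uniqueness of
  one-parameter subgroups has to be proved and directions without one excluded.\<close>

lemma frechet_derivative_cong_open:
  assumes "open U" "x \<in> U" "\<And>y. y \<in> U \<Longrightarrow> f y = g y"
  shows "frechet_derivative f (at x) = frechet_derivative g (at x)"
proof -
  \<comment> \<open>The sets of derivatives coincide, so the choice made by
    \<open>frechet_derivative\<close> does too, even where no derivative exists.\<close>
  have "(f has_derivative D) (at x) \<longleftrightarrow> (g has_derivative D) (at x)" for D
    using has_derivative_transform_within_open[of f D x UNIV U g]
      has_derivative_transform_within_open[of g D x UNIV U f] assms by auto
  then show ?thesis unfolding frechet_derivative_def by simp
qed

lemma Ck_on_subset: "Ck_on k U f \<Longrightarrow> V \<subseteq> U \<Longrightarrow> Ck_on k V f"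
  by (induction k arbitrary: f) (auto intro: continuous_on_subset)

lemma Ck_on_local:
  assumes "\<And>x. x \<in> U \<Longrightarrow> \<exists>V. open V \<and> x \<in> V \<and> Ck_on k V f"
  shows "Ck_on k U f"
  using assms
proof (induction k arbitrary: f)
  case 0
  have "isCont f x" if "x \<in> U" for x
    using 0[OF that] by (auto simp: continuous_on_eq_continuous_at)
  then show ?case by (simp add: continuous_at_imp_continuous_on)
next
  case (Suc k)
  have "f differentiable (at x)" if "x \<in> U" for x using Suc.prems[OF that] by auto
  moreover have "Ck_on k U (\<lambda>x. frechet_derivative f (at x) w)" for w
  proof (rule Suc.IH)
    fix x assume "x \<in> U"
    then show "\<exists>V. open V \<and> x \<in> V \<and> Ck_on k V (\<lambda>x. frechet_derivative f (at x) w)"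
      using Suc.prems[of x] by auto
  qed
  ultimately show ?case by simp
qed

lemma Ck_on_cong:
  assumes "open U" "\<And>x. x \<in> U \<Longrightarrow> f x = g x" "Ck_on k U g"
  shows "Ck_on k U f"
  using assms(2,3)
proof (induction k arbitrary: f g)
  case 0
  then show ?case by (simp cong: continuous_on_cong)
next
  case (Suc k)
  have eq: "frechet_derivative f (at x) = frechet_derivative g (at x)" if "x \<in> U" for x
    using frechet_derivative_cong_open[OF assms(1) that, of f g] Suc.prems(1) by blast
  have "Ck_on k U (\<lambda>x. frechet_derivative f (at x) w)" for w
    by (rule Suc.IH[where g="\<lambda>x. frechet_derivative g (at x) w"]) (use Suc.prems(2) eq in auto)
  moreover have "f differentiable (at x)" if "x \<in> U" for x
  proof -
    obtain D where "(g has_derivative D) (at x)"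
      using Suc.prems(2) \<open>x \<in> U\<close> by (auto simp: differentiable_def)
    then have "(f has_derivative D) (at x)"
      using has_derivative_transform_within_open[of g D x UNIV U f] \<open>x \<in> U\<close> assms(1) Suc.prems(1)
      by auto
    then show ?thesis by (auto simp: differentiable_def)
  qed
  ultimately show ?case by simp
qed

lemma Ck_on_SucD:
  "Ck_on (Suc k) U f \<Longrightarrow> x \<in> U \<Longrightarrow> (f has_derivative frechet_derivative f (at x)) (at x)"
  by (simp add: frechet_derivative_works)

text \<open>Trades the choice-based \<open>frechet_derivative\<close> for an explicit formula
  \<open>f'\<close>; the inductions on the order of smoothness rest on it. Openness of
  \<open>U\<close> lets the equality of the two derivatives on \<open>U\<close> be differentiated
  further.\<close>

lemma Ck_on_SucI:
  assumes "open U" "\<And>x. x \<in> U \<Longrightarrow> (f has_derivative f' x) (at x)" "\<And>w. Ck_on k U (\<lambda>x. f' x w)"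
  shows "Ck_on (Suc k) U f"
proof -
  have "frechet_derivative f (at x) = f' x" if "x \<in> U" for x
    using assms(2)[OF that] frechet_derivative_at by metis
  then have "Ck_on k U (\<lambda>x. frechet_derivative f (at x) w)" for w
    by (intro Ck_on_cong[OF assms(1) _ assms(3)[of w]]) simp
  then show ?thesis using assms(2) by (auto simp: differentiable_def)
qed

lemma Ck_on_Suc_imp:
  "Ck_on (Suc k) U f \<Longrightarrow> Ck_on k U f"
proof (induction k arbitrary: f)
  case 0
  then show ?case
    by (simp add: continuous_at_imp_continuous_on differentiable_imp_continuous_within)
qed auto

lemma Ck_on_const: "open U \<Longrightarrow> Ck_on k U (\<lambda>x. c)"
proof (induction k arbitrary: c)
  case (Suc k)
  show ?case by (rule Ck_on_SucI[where f'="\<lambda>x w. 0"]) (use Suc in \<open>auto intro: derivative_eq_intros\<close>)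
qed simp

lemma Ck_on_add:
  assumes "open U" "Ck_on k U f" "Ck_on k U g" shows "Ck_on k U (\<lambda>x. f x + g x)"
  using assms(2,3)
proof (induction k arbitrary: f g)
  case (Suc k)
  show ?case
    by (rule Ck_on_SucI[OF assms(1), where f'="\<lambda>x w. frechet_derivative f (at x) w + frechet_derivative g (at x) w"])
      (use Suc in \<open>auto intro!: has_derivative_add Ck_on_SucD\<close>)
qed (auto intro: continuous_on_add)

lemma Ck_on_linear:
  assumes "open U" "bounded_linear h" "Ck_on k U f" shows "Ck_on k U (\<lambda>x. h (f x))"
  using assms(3)
proof (induction k arbitrary: f)
  case 0
  then show ?case using bounded_linear.continuous_on[OF assms(2)] by auto
next
  case (Suc k)
  show ?case
  proof (rule Ck_on_SucI[OF assms(1), where f'="\<lambda>x w. h (frechet_derivative f (at x) w)"])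
    show "Ck_on k U (\<lambda>x. h (frechet_derivative f (at x) w))" for w
      by (rule Suc.IH) (use Suc.prems in simp)
  qed (auto intro!: bounded_linear.has_derivative[OF assms(2)] Ck_on_SucD[OF Suc.prems])
qed

lemma Ck_on_sum:
  assumes "open U" "\<And>i. i \<in> I \<Longrightarrow> Ck_on k U (f i)" shows "Ck_on k U (\<lambda>x. \<Sum>i\<in>I. f i x)"
  using assms(2)
  by (induction I rule: infinite_finite_induct) (auto simp: Ck_on_const Ck_on_add assms(1))

lemma Ck_on_bilinear:
  assumes "open U" "bounded_bilinear h" "Ck_on k U f" "Ck_on k U g"
  shows "Ck_on k U (\<lambda>x. h (f x) (g x))"
  using assms(3,4)
proof (induction k arbitrary: f g)
  case 0
  then show ?case using bounded_bilinear.continuous_on[OF assms(2)] by auto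
next
  case (Suc k)
  show ?case
    by (rule Ck_on_SucI[OF assms(1), where
        f'="\<lambda>x w. h (f x) (frechet_derivative g (at x) w) + h (frechet_derivative f (at x) w) (g x)"])
      (use Suc.prems Ck_on_Suc_imp[OF Suc.prems(1)] Ck_on_Suc_imp[OF Suc.prems(2)] in
        \<open>auto intro!: bounded_bilinear.FDERIV[OF assms(2)] Ck_on_SucD Ck_on_add[OF assms(1)] Suc.IH\<close>)
qed

lemma Ck_on_id: "open U \<Longrightarrow> Ck_on k U (\<lambda>x. x)"
proof (cases k)
  case (Suc n)
  assume "open U"
  then show ?thesis unfolding Suc by (intro Ck_on_SucI[where f'="\<lambda>x w. w"]) (auto intro: Ck_on_const)
qed simp

lemma linear_basis_expansion:
  fixes L :: "'b::euclidean_space \<Rightarrow> 'c::real_normed_vector"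
  assumes "linear L"
  shows "L y = (\<Sum>b\<in>Basis. (y \<bullet> b) *\<^sub>R L b)"
proof -
  interpret linear L by fact
  have "L y = L (\<Sum>b\<in>Basis. (y \<bullet> b) *\<^sub>R b)" by (simp add: euclidean_representation)
  then show ?thesis by (simp add: sum scaleR)
qed

text \<open>\<open>Ck_on\<close> controls derivatives in fixed directions only, but the chain rule
  evaluates that of \<open>f\<close> in the moving direction \<open>?Dg x w\<close>. Expanding this
  direction in a basis leaves finitely many fixed ones, which is why \<open>g\<close> takes values
  in a Euclidean space.\<close>

lemma Ck_on_compose:
  fixes g :: "'a::real_normed_vector \<Rightarrow> 'b::euclidean_space" and f :: "'b \<Rightarrow> 'c::real_normed_vector"
  assumes "open U" "g ` U \<subseteq> V" "Ck_on k U g" "Ck_on k V f"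
  shows "Ck_on k U (\<lambda>x. f (g x))"
  using assms(3,4)
proof (induction k arbitrary: f)
  case 0
  then show ?case using assms(2) by (auto intro: continuous_on_compose2)
next
  case (Suc k)
  let ?Dg = "\<lambda>x. frechet_derivative g (at x)" and ?Df = "\<lambda>x. frechet_derivative f (at x)"
  show ?case
  proof (rule Ck_on_SucI[OF assms(1), where f'="\<lambda>x w. \<Sum>b\<in>Basis. (?Dg x w \<bullet> b) *\<^sub>R ?Df (g x) b"])
    fix x assume x: "x \<in> U"
    have f: "(f has_derivative ?Df (g x)) (at (g x))"
      using Ck_on_SucD[OF Suc.prems(2)] x assms(2) by blast
    have "((\<lambda>x. f (g x)) has_derivative (\<lambda>w. ?Df (g x) (?Dg x w))) (at x)"
      using has_derivative_compose[OF Ck_on_SucD[OF Suc.prems(1) x] f] .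
    then show "((\<lambda>x. f (g x)) has_derivative (\<lambda>w. \<Sum>b\<in>Basis. (?Dg x w \<bullet> b) *\<^sub>R ?Df (g x) b)) (at x)"
      by (subst linear_basis_expansion[OF has_derivative_linear[OF f], symmetric])
  next
    fix w
    have "Ck_on k U (\<lambda>x. ?Dg x w)" using Suc.prems(1) by simp
    then have "Ck_on k U (\<lambda>x. ?Dg x w \<bullet> b)" for b
      by (intro Ck_on_linear[OF assms(1) bounded_linear_inner_left])
    moreover have "Ck_on k U (\<lambda>x. ?Df (g x) b)" for b
      by (rule Suc.IH) (use Suc.prems Ck_on_Suc_imp[OF Suc.prems(1)] in auto)
    ultimately show "Ck_on k U (\<lambda>x. \<Sum>b\<in>Basis. (?Dg x w \<bullet> b) *\<^sub>R ?Df (g x) b)"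
      by (intro Ck_on_sum Ck_on_bilinear[OF _ bounded_bilinear_scaleR] assms(1)) auto
  qed
qed

lemma Ck_on_Pair:
  assumes "open U" "Ck_on k U f" "Ck_on k U g" shows "Ck_on k U (\<lambda>x. (f x, g x))"
proof -
  have "Ck_on k U (\<lambda>x. (f x, 0) + (0, g x))"
    by (intro Ck_on_add assms Ck_on_linear[OF assms(1) _ assms(2), of "\<lambda>a. (a, 0)"]
        Ck_on_linear[OF assms(1) _ assms(3), of "\<lambda>a. (0, a)"] bounded_linear_Pair
        bounded_linear_ident bounded_linear_zero)
  then show ?thesis by simp
qed

lemma smooth_on_subset: "smooth_on U f \<Longrightarrow> V \<subseteq> U \<Longrightarrow> smooth_on V f"
  by (auto simp: smooth_on_def intro: Ck_on_subset)

lemma smooth_on_local: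
  "(\<And>x. x \<in> U \<Longrightarrow> \<exists>V. open V \<and> x \<in> V \<and> smooth_on V f) \<Longrightarrow> smooth_on U f"
  unfolding smooth_on_def by (intro allI Ck_on_local) blast

lemma smooth_on_cong:
  "open U \<Longrightarrow> (\<And>x. x \<in> U \<Longrightarrow> f x = g x) \<Longrightarrow> smooth_on U g \<Longrightarrow> smooth_on U f"
  unfolding smooth_on_def using Ck_on_cong by blast

lemma smooth_on_derivative: "smooth_on U f \<Longrightarrow> smooth_on U (\<lambda>x. frechet_derivative f (at x) w)"
  unfolding smooth_on_def using Ck_on.simps(2) by blast

lemma smooth_on_has_derivative:
  "smooth_on U f \<Longrightarrow> x \<in> U \<Longrightarrow> (f has_derivative frechet_derivative f (at x)) (at x)"
  unfolding smooth_on_def using Ck_on_SucD by blast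

lemma smooth_on_continuous_on: "smooth_on U f \<Longrightarrow> continuous_on U f"
  unfolding smooth_on_def using Ck_on.simps(1) by blast

lemma smooth_on_const: "open U \<Longrightarrow> smooth_on U (\<lambda>x. c)"
  by (simp add: smooth_on_def Ck_on_const)

lemma smooth_on_id: "open U \<Longrightarrow> smooth_on U (\<lambda>x. x)"
  by (simp add: smooth_on_def Ck_on_id)

lemma smooth_on_add: "open U \<Longrightarrow> smooth_on U f \<Longrightarrow> smooth_on U g \<Longrightarrow> smooth_on U (\<lambda>x. f x + g x)"
  by (simp add: smooth_on_def Ck_on_add)

lemma smooth_on_linear:
  "open U \<Longrightarrow> bounded_linear h \<Longrightarrow> smooth_on U f \<Longrightarrow> smooth_on U (\<lambda>x. h (f x))"
  by (simp add: smooth_on_def Ck_on_linear)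

lemma smooth_on_bounded_linear: "open U \<Longrightarrow> bounded_linear h \<Longrightarrow> smooth_on U h"
  using smooth_on_linear[OF _ _ smooth_on_id] .

lemma smooth_on_bilinear:
  "open U \<Longrightarrow> bounded_bilinear h \<Longrightarrow> smooth_on U f \<Longrightarrow> smooth_on U g \<Longrightarrow>
    smooth_on U (\<lambda>x. h (f x) (g x))"
  by (simp add: smooth_on_def Ck_on_bilinear)

lemma smooth_on_sum:
  "open U \<Longrightarrow> (\<And>i. i \<in> I \<Longrightarrow> smooth_on U (f i)) \<Longrightarrow> smooth_on U (\<lambda>x. \<Sum>i\<in>I. f i x)"
  by (simp add: smooth_on_def Ck_on_sum)

lemma smooth_on_Pair:
  "open U \<Longrightarrow> smooth_on U f \<Longrightarrow> smooth_on U g \<Longrightarrow> smooth_on U (\<lambda>x. (f x, g x))"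
  by (simp add: smooth_on_def Ck_on_Pair)

lemma smooth_on_compose:
  fixes g :: "'a::real_normed_vector \<Rightarrow> 'b::euclidean_space"
  shows "open U \<Longrightarrow> g ` U \<subseteq> V \<Longrightarrow> smooth_on U g \<Longrightarrow> smooth_on V f \<Longrightarrow>
    smooth_on U (\<lambda>x. f (g x))"
  unfolding smooth_on_def using Ck_on_compose by blast

text \<open>The basis expansion of the chain rule again, with base point and direction both moving.
  It yields smoothness of the fibre component of tangent maps and of the coordinate changes of the
  tangent bundle.\<close>

lemma smooth_on_derivative_along:
  fixes f :: "'b::euclidean_space \<Rightarrow> 'c::real_normed_vector"
  assumes "open U" "g ` U \<subseteq> V" "smooth_on U g" "smooth_on V f" "smooth_on U h"
  shows "smooth_on U (\<lambda>x. frechet_derivative f (at (g x)) (h x))"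
proof (rule smooth_on_cong[OF assms(1)])
  fix x assume "x \<in> U"
  then show "frechet_derivative f (at (g x)) (h x)
      = (\<Sum>b\<in>Basis. (h x \<bullet> b) *\<^sub>R frechet_derivative f (at (g x)) b)"
    using assms(2,4) smooth_on_has_derivative[OF assms(4), of "g x"]
    by (intro linear_basis_expansion has_derivative_linear[of f _ "at (g x)"]) auto
next
  show "smooth_on U (\<lambda>x. \<Sum>b\<in>Basis. (h x \<bullet> b) *\<^sub>R frechet_derivative f (at (g x)) b)"
    by (intro smooth_on_sum smooth_on_bilinear[OF _ bounded_bilinear_scaleR] assms(1)
        smooth_on_linear[OF _ bounded_linear_inner_left assms(5)]
        smooth_on_compose[OF assms(1-3) smooth_on_derivative[OF assms(4)]])
qed

text \<open>Bootstrap: if \<open>z\<close> is of class C^k, then so is its derivative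
  \<open>F (z t)\<close>, hence \<open>z\<close> is of class C^(k+1).\<close>

lemma smooth_on_integral_curve:
  fixes z :: "real \<Rightarrow> 'a::euclidean_space"
  assumes "open I" "\<And>t. t \<in> I \<Longrightarrow> (z has_vector_derivative F (z t)) (at t)"
    "z ` I \<subseteq> U" "smooth_on U F"
  shows "smooth_on I z"
proof -
  have "Ck_on k I z" for k
  proof (induction k)
    case 0
    show ?case unfolding Ck_on.simps
      using assms(2) by (meson continuous_at_imp_continuous_on has_derivative_continuous has_vector_derivative_def)
  next
    case (Suc k)
    show ?case
    proof (rule Ck_on_SucI[OF assms(1), where f'="\<lambda>t w. w *\<^sub>R F (z t)"])
      fix w :: real
      have "Ck_on k I (\<lambda>t. F (z t))"
        using assms(4) by (intro Ck_on_compose[OF assms(1,3) Suc]) (auto simp: smooth_on_def)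
      then show "Ck_on k I (\<lambda>t. w *\<^sub>R F (z t))"
        by (intro Ck_on_linear[OF assms(1) bounded_linear_scaleR_right])
    qed (use assms(2) in \<open>simp add: has_vector_derivative_def\<close>)
  qed
  then show ?thesis by (simp add: smooth_on_def)
qed

section \<open>Second derivatives and local solutions of differential equations\<close>

text \<open>The mean value theorem, applied in direction \<open>h\<close> and then in direction
  \<open>k\<close>, turns the quotient into the mixed derivative at a nearby point; continuity of
  that derivative concludes. The quotient is symmetric in \<open>h\<close> and \<open>k\<close>, the
  derivative not visibly so.\<close>

lemma second_difference_quotient:
  fixes f :: "'a::euclidean_space \<Rightarrow> real"
  assumes U: "open U" and f: "smooth_on U f" and z: "z \<in> U" and e: "e > 0"
  shows "\<forall>\<^sub>F t in at_right 0. \<bar>(f (z + t *\<^sub>R h + t *\<^sub>R k) - f (z + t *\<^sub>R h) - f (z + t *\<^sub>R k) + f z) / t\<^sup>2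
    - frechet_derivative (\<lambda>z. frechet_derivative f (at z) h) (at z) k\<bar> < e"
proof -
  let ?D = "\<lambda>z. frechet_derivative f (at z)"
  let ?D2 = "\<lambda>z. frechet_derivative (\<lambda>z. ?D z h) (at z) k"
  have "continuous_on U ?D2"
    by (intro smooth_on_continuous_on smooth_on_derivative f)
  then obtain d where d: "d > 0" "\<And>y. y \<in> U \<Longrightarrow> dist y z < d \<Longrightarrow> \<bar>?D2 y - ?D2 z\<bar> < e"
    using z e unfolding continuous_on_iff dist_real_def by metis
  obtain r where r: "r > 0" "ball z r \<subseteq> U" using U z openE by blast
  let ?N = "norm h + norm k + 1"
  \<comment> \<open>As \<open>?N\<close> exceeds the sum of the two norms, all points
    \<open>z + a h + b k\<close> with \<open>a\<close>, \<open>b\<close> up to \<open>t\<close> stay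
    in \<open>U\<close> and in the ball where \<open>?D2\<close> is close to its value at
    \<open>z\<close>.\<close>
  let ?\<delta> = "min d r / ?N"
  have N: "?N > 0" by (simp add: add_nonneg_pos)
  have in_U: "z + a *\<^sub>R h + b *\<^sub>R k \<in> U \<and> dist (z + a *\<^sub>R h + b *\<^sub>R k) z < d"
    if "0 \<le> a" "a \<le> t" "0 \<le> b" "b \<le> t" "0 < t" "t < ?\<delta>" for a b t
  proof -
    have "norm (a *\<^sub>R h + b *\<^sub>R k) \<le> t * norm h + t * norm k"
      using that by (intro norm_triangle_le add_mono) (auto intro: mult_right_mono)
    also have "\<dots> \<le> t * ?N" using that by (simp add: algebra_simps)
    also have "\<dots> < min d r" using that N by (simp add: pos_less_divide_eq)
    finally have "norm (a *\<^sub>R h + b *\<^sub>R k) < min d r" .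
    then have "dist (z + a *\<^sub>R h + b *\<^sub>R k) z < min d r" by (simp add: dist_norm add.assoc)
    then show ?thesis using r(2) by (auto simp: dist_commute)
  qed
  have "\<bar>(f (z + t *\<^sub>R h + t *\<^sub>R k) - f (z + t *\<^sub>R h) - f (z + t *\<^sub>R k) + f z) / t\<^sup>2 - ?D2 z\<bar> < e"
    if t: "0 < t" "t < ?\<delta>" for t
  proof -
    \<comment> \<open>Increment of \<open>f\<close> in direction \<open>t k\<close> while the foot
      point moves along \<open>h\<close>; the numerator of the quotient is
      \<open>u t - u 0\<close>.\<close>
    define u where "u s = f (z + s *\<^sub>R h + t *\<^sub>R k) - f (z + s *\<^sub>R h)" for s
    define u' where "u' s = ?D (z + s *\<^sub>R h + t *\<^sub>R k) h - ?D (z + s *\<^sub>R h) h" for s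
    have "(u has_real_derivative u' s) (at s)" if s: "0 \<le> s" "s \<le> t" for s
    proof -
      have 1: "(f has_derivative ?D (z + s *\<^sub>R h + t *\<^sub>R k)) (at (z + s *\<^sub>R h + t *\<^sub>R k))"
        using in_U[of s t t] s t by (intro smooth_on_has_derivative[OF f]) auto
      have 2: "(f has_derivative ?D (z + s *\<^sub>R h)) (at (z + s *\<^sub>R h))"
        using in_U[of s t 0] s t by (intro smooth_on_has_derivative[OF f]) auto
      have "((\<lambda>s. f (z + s *\<^sub>R h + t *\<^sub>R k)) has_derivative (\<lambda>w. ?D (z + s *\<^sub>R h + t *\<^sub>R k) (w *\<^sub>R h))) (at s)"
        by (rule has_derivative_compose[where g=f and f="\<lambda>s. z + s *\<^sub>R h + t *\<^sub>R k", OF _ 1])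
          (auto intro!: derivative_eq_intros)
      moreover have "((\<lambda>s. f (z + s *\<^sub>R h)) has_derivative (\<lambda>w. ?D (z + s *\<^sub>R h) (w *\<^sub>R h))) (at s)"
        by (rule has_derivative_compose[where g=f and f="\<lambda>s. z + s *\<^sub>R h", OF _ 2])
          (auto intro!: derivative_eq_intros)
      ultimately have "(u has_derivative (\<lambda>w. ?D (z + s *\<^sub>R h + t *\<^sub>R k) (w *\<^sub>R h) - ?D (z + s *\<^sub>R h) (w *\<^sub>R h))) (at s)"
        unfolding u_def by (rule has_derivative_diff)
      moreover have "?D (z + s *\<^sub>R h + t *\<^sub>R k) (w *\<^sub>R h) - ?D (z + s *\<^sub>R h) (w *\<^sub>R h) = u' s * w" for w
        using linear_scale[OF has_derivative_linear[OF 1]] linear_scale[OF has_derivative_linear[OF 2]]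
        by (simp add: u'_def algebra_simps)
      ultimately show ?thesis by (simp add: has_field_derivative_def)
    qed
    then obtain s where s: "0 < s" "s < t" "u t - u 0 = (t - 0) * u' s"
      using MVT2[of 0 t u u'] t by auto
    define w where "w r = ?D (z + s *\<^sub>R h + r *\<^sub>R k) h" for r
    have "(w has_real_derivative ?D2 (z + s *\<^sub>R h + r *\<^sub>R k)) (at r)" if q: "0 \<le> r" "r \<le> t" for r
    proof -
      have 1: "((\<lambda>z. ?D z h) has_derivative frechet_derivative (\<lambda>z. ?D z h) (at (z + s *\<^sub>R h + r *\<^sub>R k)))
          (at (z + s *\<^sub>R h + r *\<^sub>R k))"
        using in_U[of s t r] s q t by (intro smooth_on_has_derivative[OF smooth_on_derivative[OF f]]) auto
      have "(w has_derivative (\<lambda>x. frechet_derivative (\<lambda>z. ?D z h) (at (z + s *\<^sub>R h + r *\<^sub>R k)) (x *\<^sub>R k))) (at r)"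
        unfolding w_def
        by (rule has_derivative_compose[where g="\<lambda>z. ?D z h" and f="\<lambda>r. z + s *\<^sub>R h + r *\<^sub>R k", OF _ 1])
          (auto intro!: derivative_eq_intros)
      moreover have "(\<lambda>x. frechet_derivative (\<lambda>z. ?D z h) (at (z + s *\<^sub>R h + r *\<^sub>R k)) (x *\<^sub>R k))
          = (*) (?D2 (z + s *\<^sub>R h + r *\<^sub>R k))"
        by (rule ext) (simp add: linear_scale[OF has_derivative_linear[OF 1]])
      ultimately show ?thesis by (simp add: has_field_derivative_def)
    qed
    then obtain r where r: "0 < r" "r < t" "w t - w 0 = (t - 0) * ?D2 (z + s *\<^sub>R h + r *\<^sub>R k)"
      using MVT2[of 0 t w "\<lambda>r. ?D2 (z + s *\<^sub>R h + r *\<^sub>R k)"] t by auto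
    have "u' s = w t - w 0" by (simp add: u'_def w_def)
    then have "u t - u 0 = t\<^sup>2 * ?D2 (z + s *\<^sub>R h + r *\<^sub>R k)"
      using s r by (simp add: power2_eq_square)
    then have "(f (z + t *\<^sub>R h + t *\<^sub>R k) - f (z + t *\<^sub>R h) - f (z + t *\<^sub>R k) + f z) / t\<^sup>2
        = ?D2 (z + s *\<^sub>R h + r *\<^sub>R k)"
      using t by (simp add: u_def field_simps)
    then show ?thesis using d(2) in_U[of s t r] s r t by simp
  qed
  then show ?thesis
    unfolding eventually_at_right_field using d(1) r(1) N by (intro exI[of _ ?\<delta>]) auto
qed

text \<open>Schwarz's theorem: both mixed derivatives are limits of the same symmetric difference
  quotient.\<close>

lemma second_derivative_symmetric:
  fixes f :: "'a::euclidean_space \<Rightarrow> real"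
  assumes "open U" "smooth_on U f" "z \<in> U"
  shows "frechet_derivative (\<lambda>z. frechet_derivative f (at z) h) (at z) k
       = frechet_derivative (\<lambda>z. frechet_derivative f (at z) k) (at z) h" (is "?a = ?b")
proof -
  have "\<bar>?a - ?b\<bar> < 2 * e" if "e > 0" for e
  proof -
    have "\<forall>\<^sub>F t in at_right (0::real). \<bar>?a - ?b\<bar> < 2 * e"
      using second_difference_quotient[OF assms that, of h k] second_difference_quotient[OF assms that, of k h]
      by eventually_elim (simp add: algebra_simps)
    then show ?thesis by simp
  qed
  from this[of "\<bar>?a - ?b\<bar> / 2"] show ?thesis by fastforce
qed

text \<open>The remainder bound is uniform in the foot point because the partial derivatives are
  uniformly continuous on a compact neighbourhood \<open>K'\<close> of \<open>K\<close>. Applied to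
  \<open>{x}\<close> times the unit sphere, it is later spread over the whole fibre by
  homogeneity.\<close>

lemma uniformly_differentiable_on_compact:
  fixes f :: "'a::euclidean_space \<Rightarrow> 'b::real_normed_vector"
  assumes U: "open U" and f: "Ck_on 1 U f" and K: "compact K" "K \<subseteq> U" and e: "e > 0"
  shows "\<exists>r>0. \<forall>z\<in>K. \<forall>h. norm h < r \<longrightarrow>
    z + h \<in> U \<and> norm (f (z + h) - f z - frechet_derivative f (at z) h) \<le> e * norm h"
proof -
  let ?D = "\<lambda>z. frechet_derivative f (at z)"
  obtain \<delta> where \<delta>: "\<delta> > 0" "(\<Union>z\<in>K. cball z \<delta>) \<subseteq> U"
    using compact_subset_open_imp_cball_epsilon_subset[OF K(1) U K(2)] by blast
  define K' where "K' = {x + y | x y. x \<in> K \<and> y \<in> cball 0 \<delta>}"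
  have "compact K'" unfolding K'_def by (intro compact_sums K compact_cball)
  have K'U: "K' \<subseteq> U" using \<delta> unfolding K'_def by (force simp: dist_norm)
  \<comment> \<open>One share for each basis direction, so that the operator norm of the difference
    of derivatives stays below \<open>e\<close>.\<close>
  define e' where "e' = e / DIM('a)"
  have e': "e' > 0" using e by (simp add: e'_def)
  have "\<exists>d>0. \<forall>x\<in>K'. \<forall>y\<in>K'. dist y x < d \<longrightarrow> norm (?D y b - ?D x b) < e'" for b
  proof -
    have "continuous_on U (\<lambda>x. ?D x b)" using f by simp
    then have "uniformly_continuous_on K' (\<lambda>x. ?D x b)"
      using compact_uniformly_continuous \<open>compact K'\<close> K'U continuous_on_subset by blast
    then show ?thesis using e' unfolding uniformly_continuous_on_def dist_norm by blast
  qed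
  then obtain d where d: "\<And>b. d b > 0"
    "\<And>b x y. x \<in> K' \<Longrightarrow> y \<in> K' \<Longrightarrow> dist y x < d b \<Longrightarrow> norm (?D y b - ?D x b) < e'" by metis
  define r where "r = Min (insert \<delta> (d ` Basis))"
  have r: "r > 0" "r \<le> \<delta>" "\<And>b. b \<in> Basis \<Longrightarrow> r \<le> d b"
    using \<delta>(1) d(1) by (auto simp: r_def intro: Min_le min.coboundedI2)
  have "z + h \<in> U \<and> norm (f (z + h) - f z - ?D z h) \<le> e * norm h"
    if z: "z \<in> K" and h: "norm h < r" for z h
  proof -
    have inK: "z + k \<in> K'" if "norm k \<le> norm h" for k
      using that z h r(2) unfolding K'_def by (force simp: dist_norm)
    have hd: "(f has_derivative ?D x) (at x)" if "x \<in> K'" for x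
      using that K'U f by (intro Ck_on_SucD[of 0 U]) auto
    have zk: "z \<in> K'" using inK[of 0] by simp
    have bound: "onorm (\<lambda>w. ?D (z + k) w - ?D z w) \<le> e" if k: "norm k \<le> norm h" for k
    proof (rule onorm_le)
      fix w :: 'a
      let ?L = "\<lambda>w. ?D (z + k) w - ?D z w"
      have lin: "linear ?L"
        using has_derivative_linear[OF hd[OF inK[OF k]]] has_derivative_linear[OF hd[OF zk]]
        by (rule linear_compose_sub)
      have "norm (?L w) = norm (\<Sum>b\<in>Basis. (w \<bullet> b) *\<^sub>R ?L b)"
        by (subst linear_basis_expansion[OF lin, symmetric]) simp
      also have "\<dots> \<le> (\<Sum>b\<in>(Basis::'a set). norm w * e')"
      proof (rule sum_norm_le)
        fix b :: 'a assume b: "b \<in> Basis"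
        have "norm (?L b) \<le> e'"
          using d(2)[OF zk inK[OF k], of b] r(3)[OF b] k h by (force simp: dist_norm)
        then show "norm ((w \<bullet> b) *\<^sub>R ?L b) \<le> norm w * e'"
          using Basis_le_norm[OF b, of w] by (auto intro!: mult_mono)
      qed
      also have "\<dots> = e * norm w" by (simp add: e'_def)
      finally show "norm (?L w) \<le> e * norm w" .
    qed
    define T where "T = (\<lambda>k. z + k) ` cball 0 (norm h)"
    have "norm (f (z + h) - f z - ?D z ((z + h) - z)) \<le> norm ((z + h) - z) * e"
    proof (rule differentiable_bound_linearization[where S=T])
      fix t :: real assume "t \<in> {0..1}"
      then show "z + t *\<^sub>R (z + h - z) \<in> T"
        by (auto simp: T_def dist_norm intro!: imageI mult_left_le_one_le)
    next
      fix x assume "x \<in> T"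
      then have "norm (x - z) \<le> norm h" by (auto simp: T_def dist_norm norm_minus_commute)
      then obtain k where k: "x = z + k" "norm k \<le> norm h" by (metis add.commute diff_add_cancel)
      show "(f has_derivative ?D x) (at x within T)"
        unfolding k(1) by (rule has_derivative_at_withinI[OF hd[OF inK[OF k(2)]]])
      show "onorm (?D x - ?D z) \<le> e"
        using bound[OF k(2)] by (simp add: k(1) fun_diff_def)
    qed (auto simp: T_def intro!: image_eqI[of _ _ 0])
    moreover have "z + h \<in> U" using inK[of h] K'U by blast
    ultimately show ?thesis by (simp add: mult.commute)
  qed
  then show ?thesis using r(1) by blast
qed

section \<open>Local solutions of autonomous systems (Picard-Lindelof)\<close>

lemma C1_lipschitz_on_cball:
  fixes f :: "'a::euclidean_space \<Rightarrow> 'b::real_normed_vector"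
  assumes f: "Ck_on 1 U f" and sub: "cball z r \<subseteq> U"
  shows "\<exists>B\<ge>0. \<forall>x\<in>cball z r. \<forall>y\<in>cball z r. norm (f x - f y) \<le> B * norm (x - y)"
proof -
  let ?D = "\<lambda>z. frechet_derivative f (at z)"
  have "\<exists>C. \<forall>x\<in>cball z r. norm (?D x b) \<le> C" for b
  proof -
    have "continuous_on (cball z r) (\<lambda>x. ?D x b)"
      using f sub by (auto intro: continuous_on_subset)
    then have "bounded ((\<lambda>x. ?D x b) ` cball z r)"
      by (intro compact_imp_bounded compact_continuous_image) auto
    then show ?thesis by (auto simp: bounded_iff)
  qed
  then obtain C where C: "\<And>b x. x \<in> cball z r \<Longrightarrow> norm (?D x b) \<le> C b" by metis
  define B where "B = (\<Sum>b\<in>Basis. \<bar>C b\<bar>)"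
  have hd: "(f has_derivative ?D x) (at x)" if "x \<in> cball z r" for x
    using that sub f by (intro Ck_on_SucD[of 0 U]) auto
  have "onorm (?D x) \<le> B" if x: "x \<in> cball z r" for x
  proof (rule onorm_le)
    fix w
    have "norm (?D x w) = norm (\<Sum>b\<in>Basis. (w \<bullet> b) *\<^sub>R ?D x b)"
      by (subst linear_basis_expansion[OF has_derivative_linear[OF hd[OF x]], symmetric]) simp
    also have "\<dots> \<le> (\<Sum>b\<in>Basis. \<bar>C b\<bar> * norm w)"
    proof (rule sum_norm_le)
      fix b :: 'a assume b: "b \<in> Basis"
      show "norm ((w \<bullet> b) *\<^sub>R ?D x b) \<le> \<bar>C b\<bar> * norm w"
        using Basis_le_norm[OF b, of w] C[OF x, of b] by (auto simp: mult.commute intro!: mult_mono)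
    qed
    finally show "norm (?D x w) \<le> B * norm w" by (simp add: B_def sum_distrib_right)
  qed
  then have "norm (f x - f y) \<le> B * norm (x - y)" if "x \<in> cball z r" "y \<in> cball z r" for x y
    using that has_derivative_at_withinI[OF hd]
    by (intro differentiable_bound[OF convex_cball, of z r f ?D]) auto
  moreover have "B \<ge> 0" by (auto simp: B_def intro: sum_nonneg)
  ultimately show ?thesis by blast
qed

text \<open>Banach's fixed point theorem is applied in the complete space of bounded continuous
  functions on the whole line. So \<open>F\<close> is composed with the projection onto a closed
  ball, which makes it globally Lipschitz, and time is clamped to
  \<open>[-\<epsilon>, \<epsilon>]\<close>; the fixed point stays in the ball, where the projection
  does nothing.\<close>

lemma ode_local_solution:
  fixes F :: "'a::euclidean_space \<Rightarrow> 'a"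
  assumes \<Omega>: "open \<Omega>" and F: "Ck_on 1 \<Omega> F" and z0: "z0 \<in> \<Omega>"
  shows "\<exists>\<epsilon>>0. \<exists>z. z 0 = z0 \<and>
    (\<forall>t. \<bar>t\<bar> < \<epsilon> \<longrightarrow> z t \<in> \<Omega> \<and> (z has_vector_derivative F (z t)) (at t))"
proof -
  obtain r where r: "r > 0" "cball z0 r \<subseteq> \<Omega>" using \<Omega> z0 open_contains_cball by blast
  let ?C = "cball z0 r"
  obtain B where B: "B \<ge> 0" "\<And>x y. x \<in> ?C \<Longrightarrow> y \<in> ?C \<Longrightarrow> norm (F x - F y) \<le> B * norm (x - y)"
    using C1_lipschitz_on_cball[OF F r(2)] by blast
  define P where "P = closest_point ?C"
  define G where "G = F \<circ> P"
  have C: "convex ?C" "closed ?C" "?C \<noteq> {}" using r by auto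
  have P: "P x \<in> ?C" for x unfolding P_def by (rule closest_point_in_set) (use C in auto)
  have Pid: "P x = x" if "x \<in> ?C" for x using that by (simp add: P_def closest_point_self)
  have G_lip: "norm (G x - G y) \<le> B * norm (x - y)" for x y
  proof -
    have "norm (G x - G y) \<le> B * norm (P x - P y)" using B(2)[OF P P] by (simp add: G_def)
    also have "\<dots> \<le> B * norm (x - y)"
      using closest_point_lipschitz[OF C, of x y] B(1) by (simp add: P_def dist_norm mult_left_mono)
    finally show ?thesis .
  qed
  have G_cont: "continuous_on UNIV G"
  proof -
    have "continuous_on ?C F" using F r(2) Ck_on_Suc_imp[of 0 \<Omega> F]
      by (auto intro: continuous_on_subset)
    moreover have "continuous_on UNIV P" unfolding P_def by (rule continuous_on_closest_point[OF C])
    ultimately show ?thesis unfolding G_def o_def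
      by (rule continuous_on_compose2) (use P in auto)
  qed
  define M where "M = norm (F z0) + B * r"
  have G_bd: "norm (G x) \<le> M" for x
  proof -
    have "norm (F (P x) - F z0) \<le> B * norm (P x - z0)" using B(2)[OF P, of z0] r by simp
    also have "\<dots> \<le> B * r" using P[of x] B(1) by (intro mult_left_mono) (auto simp: dist_norm norm_minus_commute)
    finally show ?thesis using norm_triangle_sub[of "F (P x)" "F z0"] by (simp add: M_def G_def)
  qed
  have M: "M \<ge> 0" using G_bd norm_ge_zero order_trans by blast
  \<comment> \<open>The first entry makes the iteration a contraction with factor 3/4, the second
    keeps its values within distance \<open>r\<close> of \<open>z0\<close>. The factor 3 accounts
    for the two integrals in \<open>T\<close>, over lengths of at most \<open>2 \<epsilon>\<close>
    and \<open>\<epsilon>\<close>.\<close>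
  define \<epsilon> where "\<epsilon> = min (1 / (4 * (B + 1))) (r / (3 * (M + 1)))"
  have \<epsilon>: "\<epsilon> > 0" using B M r by (simp add: \<epsilon>_def)
  have \<epsilon>B: "3 * \<epsilon> * B \<le> 3/4"
  proof -
    have "\<epsilon> * B \<le> 1 / (4 * (B + 1)) * B" using B by (intro mult_right_mono) (auto simp: \<epsilon>_def)
    also have "\<dots> \<le> 1/4" using B by (simp add: field_simps)
    finally show ?thesis by (simp add: mult.commute)
  qed
  have \<epsilon>M: "3 * \<epsilon> * M \<le> r"
  proof -
    have "\<epsilon> * M \<le> r / (3 * (M + 1)) * M" using M by (intro mult_right_mono) (auto simp: \<epsilon>_def)
    also have "\<dots> \<le> r / 3" using M r by (simp add: field_simps)
    finally show ?thesis by simp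
  qed
  define cl where "cl t = max (-\<epsilon>) (min \<epsilon> t)" for t
  have cl: "-\<epsilon> \<le> cl t" "cl t \<le> \<epsilon>" for t using \<epsilon> by (auto simp: cl_def)
  define I where "I z t = integral {-\<epsilon>..t} (\<lambda>s. G (z s))" for z t
  have Gz: "continuous_on X (\<lambda>s. G (apply_bcontfun z s))" for z and X :: "real set"
    by (rule continuous_on_compose2[OF G_cont]) auto
  have I_bd: "norm (I (apply_bcontfun z) t) \<le> M * (t + \<epsilon>)" if "-\<epsilon> \<le> t" for z t
    using integral_bound[OF that Gz, of z M] G_bd by (simp add: I_def)
  have I_diff: "norm (I (apply_bcontfun z) t - I (apply_bcontfun w) t) \<le> B * dist z w * (t + \<epsilon>)"
    if "-\<epsilon> \<le> t" for z w t
  proof -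
    have "I (apply_bcontfun z) t - I (apply_bcontfun w) t
        = integral {-\<epsilon>..t} (\<lambda>s. G (apply_bcontfun z s) - G (apply_bcontfun w s))"
      unfolding I_def by (intro integral_diff[symmetric] integrable_continuous_real Gz)
    also have "norm \<dots> \<le> B * dist z w * (t - (-\<epsilon>))"
    proof (rule integral_bound[OF that])
      fix s
      have "norm (G (apply_bcontfun z s) - G (apply_bcontfun w s)) \<le> B * norm (apply_bcontfun z s - apply_bcontfun w s)"
        by (rule G_lip)
      also have "\<dots> \<le> B * dist z w"
        using dist_bounded[of z s w] B(1) by (intro mult_left_mono) (auto simp: dist_norm)
      finally show "norm (G (apply_bcontfun z s) - G (apply_bcontfun w s)) \<le> B * dist z w" .
    qed (intro continuous_on_diff Gz)
    finally show ?thesis by simp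
  qed
  \<comment> \<open>Subtracting the value at 0 turns the integral from \<open>-\<epsilon>\<close>,
    which suits times on both sides of 0, into the Picard integral from 0 to
    \<open>cl t\<close>.\<close>
  define T where "T z t = z0 + I (apply_bcontfun z) (cl t) - I (apply_bcontfun z) 0" for z t
  have T_z0: "norm (T z t - z0) \<le> r" for z t
  proof -
    have "norm (T z t - z0) \<le> norm (I (apply_bcontfun z) (cl t)) + norm (I (apply_bcontfun z) 0)"
      unfolding T_def by (simp add: norm_triangle_ineq4)
    also have "\<dots> \<le> M * (\<epsilon> + \<epsilon>) + M * (0 + \<epsilon>)"
      using cl \<epsilon> M by (intro add_mono order_trans[OF I_bd] mult_left_mono) auto
    finally show ?thesis using \<epsilon>M by (simp add: algebra_simps)
  qed
  have T_bc: "T z \<in> bcontfun" for z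
  proof (rule bcontfun_normI)
    show "continuous_on UNIV (T z)"
    proof -
      have "continuous_on {-\<epsilon>..\<epsilon>} (I (apply_bcontfun z))"
        unfolding I_def by (intro indefinite_integral_continuous_1 integrable_continuous_real Gz)
      then have "continuous_on UNIV (\<lambda>t. I (apply_bcontfun z) (cl t))"
        by (rule continuous_on_compose2) (use cl in \<open>auto simp: cl_def intro!: continuous_intros\<close>)
      then show ?thesis unfolding T_def by (intro continuous_intros)
    qed
    show "norm (T z t) \<le> norm z0 + r" for t using T_z0[of z t] norm_triangle_sub[of "T z t" z0] by simp
  qed
  have "\<exists>!z. Bcontfun (T z) = z"
  proof (rule banach_fix_type[of "3/4"])
    show "\<forall>z w. dist (Bcontfun (T z)) (Bcontfun (T w)) \<le> 3/4 * dist z w"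
    proof (intro allI dist_bound)
      fix z w t
      have "T z t - T w t = (I (apply_bcontfun z) (cl t) - I (apply_bcontfun w) (cl t))
          - (I (apply_bcontfun z) 0 - I (apply_bcontfun w) 0)" by (simp add: T_def)
      then have "norm (T z t - T w t) \<le> norm (I (apply_bcontfun z) (cl t) - I (apply_bcontfun w) (cl t))
          + norm (I (apply_bcontfun z) 0 - I (apply_bcontfun w) 0)"
        by (simp only: norm_triangle_ineq4)
      also have "\<dots> \<le> B * dist z w * (\<epsilon> + \<epsilon>) + B * dist z w * (0 + \<epsilon>)"
        using cl \<epsilon> B(1) by (intro add_mono order_trans[OF I_diff] mult_left_mono) auto
      also have "\<dots> = 3 * \<epsilon> * B * dist z w" by (simp add: algebra_simps)
      also have "\<dots> \<le> 3/4 * dist z w" by (intro mult_right_mono \<epsilon>B) simp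
      finally show "dist (apply_bcontfun (Bcontfun (T z)) t) (apply_bcontfun (Bcontfun (T w)) t) \<le> 3/4 * dist z w"
        by (simp add: Bcontfun_inverse T_bc dist_norm)
    qed
  qed auto
  then obtain zz where zz: "Bcontfun (T zz) = zz" by blast
  define z where "z = apply_bcontfun zz"
  have z: "z t = T zz t" for t unfolding z_def by (metis zz Bcontfun_inverse T_bc)
  have zC: "z t \<in> ?C" for t using T_z0[of zz t] by (simp add: z dist_norm norm_minus_commute)
  have GF: "G (z s) = F (z s)" for s using Pid[OF zC] by (simp add: G_def)
  have "z 0 = z0" using \<epsilon> by (simp add: z T_def cl_def)
  moreover have "(z has_vector_derivative F (z t)) (at t)" if t: "\<bar>t\<bar> < \<epsilon>" for t
  proof -
    have "(I z has_vector_derivative G (z t)) (at t within {-\<epsilon>..\<epsilon>})"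
      unfolding I_def by (rule integral_has_vector_derivative) (use t Gz in \<open>auto simp: z_def\<close>)
    then have "(I z has_vector_derivative F (z t)) (at t)"
      using t by (subst (asm) at_within_interior) (auto simp: GF)
    then have "((\<lambda>t. z0 + I z t - I z 0) has_vector_derivative F (z t)) (at t)"
      by (auto intro!: derivative_eq_intros)
    then show ?thesis
    proof (rule has_vector_derivative_transform_within_open[of _ _ _ "{-\<epsilon><..<\<epsilon>}"])
      fix s assume "s \<in> {-\<epsilon><..<\<epsilon>}"
      then have "cl s = s" by (simp add: cl_def)
      then show "z0 + I z s - I z 0 = z s" by (simp add: z T_def flip: z_def)
    qed (use t in auto)
  qed
  ultimately show ?thesis using \<epsilon> zC r(2) by blast
qed

section \<open>Weighted means over the unit ball of a norm\<close>

lemma nn_integral_lborel_translate: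
  fixes f :: "'a::euclidean_space \<Rightarrow> ennreal"
  assumes [measurable]: "f \<in> borel_measurable borel"
  shows "(\<integral>\<^sup>+ x. f (x + a) \<partial>lborel) = (\<integral>\<^sup>+ x. f x \<partial>lborel)"
proof -
  have "(\<integral>\<^sup>+ x. f x \<partial>lborel) = (\<integral>\<^sup>+ x. f x \<partial>distr lborel borel ((+) a))"
    by (simp add: lborel_distr_plus)
  also have "\<dots> = (\<integral>\<^sup>+ x. f (a + x) \<partial>lborel)" by (rule nn_integral_distr) auto
  finally show ?thesis by (simp add: add.commute)
qed

text \<open>Uniqueness of Haar measure: both sides are the double integral of
  \<open>f (T x + y) * indicator (ball 0 1) y\<close>, up to translations of the variables.\<close>

lemma nn_integral_lborel_linear_ball:
  fixes f :: "'a::euclidean_space \<Rightarrow> ennreal"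
  assumes T: "linear T" "bij T" and f [measurable]: "f \<in> borel_measurable borel"
  shows "(\<integral>\<^sup>+ x. f (T x) \<partial>lborel) * emeasure lborel (ball (0::'a) 1)
    = (\<integral>\<^sup>+ y. f y \<partial>lborel) * emeasure lborel (T -` ball 0 1)"
proof -
  have T_cont: "continuous_on UNIV T" using T(1) by (simp add: linear_continuous_on linear_conv_bounded_linear)
  then have [measurable]: "T \<in> borel_measurable borel" by (rule borel_measurable_continuous_onI)
  define S where "S = Hilbert_Choice.inv T"
  have TS: "T (S y) = y" for y by (simp add: S_def bij_is_surj[OF T(2)] surj_f_inv_f)
  have T_add: "T (x + y) = T x + T y" for x y using T(1) by (simp add: linear_add)
  define b where "b = (indicator (ball (0::'a) 1) :: 'a \<Rightarrow> ennreal)"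
  have b_even: "b (- y) = b y" for y by (simp add: b_def indicator_def)
  have [measurable]: "b \<in> borel_measurable borel" unfolding b_def by (rule borel_measurable_indicator) simp
  have "(\<integral>\<^sup>+ x. f (T x) \<partial>lborel) * emeasure lborel (ball (0::'a) 1)
      = (\<integral>\<^sup>+ x. f (T x) \<partial>lborel) * (\<integral>\<^sup>+ y. b y \<partial>lborel)" by (simp add: b_def)
  also have "\<dots> = (\<integral>\<^sup>+ y. (\<integral>\<^sup>+ x. f (T x) \<partial>lborel) * b y \<partial>lborel)"
    by (rule nn_integral_cmult[symmetric]) simp
  also have "\<dots> = (\<integral>\<^sup>+ y. (\<integral>\<^sup>+ x. f (T x + y) * b y \<partial>lborel) \<partial>lborel)"
  proof (rule nn_integral_cong)
    fix y
    have "(\<integral>\<^sup>+ x. f (T x) \<partial>lborel) = (\<integral>\<^sup>+ x. f (T (x + S y)) \<partial>lborel)"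
      by (rule nn_integral_lborel_translate[symmetric]) simp
    then show "(\<integral>\<^sup>+ x. f (T x) \<partial>lborel) * b y = (\<integral>\<^sup>+ x. f (T x + y) * b y \<partial>lborel)"
      by (simp add: T_add TS nn_integral_multc)
  qed
  also have "\<dots> = (\<integral>\<^sup>+ x. (\<integral>\<^sup>+ y. f (T x + y) * b y \<partial>lborel) \<partial>lborel)"
    by (rule lborel_pair.Fubini') simp
  also have "\<dots> = (\<integral>\<^sup>+ x. (\<integral>\<^sup>+ y. f y * b (y - T x) \<partial>lborel) \<partial>lborel)"
  proof (rule nn_integral_cong)
    fix x
    show "(\<integral>\<^sup>+ y. f (T x + y) * b y \<partial>lborel) = (\<integral>\<^sup>+ y. f y * b (y - T x) \<partial>lborel)"
      using nn_integral_lborel_translate[of "\<lambda>y. f y * b (y - T x)" "T x"] by (simp add: add.commute)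
  qed
  also have "\<dots> = (\<integral>\<^sup>+ y. (\<integral>\<^sup>+ x. f y * b (y - T x) \<partial>lborel) \<partial>lborel)"
    by (rule lborel_pair.Fubini'[symmetric]) simp
  also have "\<dots> = (\<integral>\<^sup>+ y. f y * (\<integral>\<^sup>+ x. b (T x) \<partial>lborel) \<partial>lborel)"
  proof (rule nn_integral_cong)
    fix y
    have "(\<integral>\<^sup>+ x. b (T x) \<partial>lborel) = (\<integral>\<^sup>+ x. b (T (x + S (- y))) \<partial>lborel)"
      by (rule nn_integral_lborel_translate[symmetric]) simp
    also have "\<dots> = (\<integral>\<^sup>+ x. b (y - T x) \<partial>lborel)"
      by (rule nn_integral_cong) (metis T_add TS b_even minus_diff_eq uminus_add_conv_diff add.commute)
    finally show "(\<integral>\<^sup>+ x. f y * b (y - T x) \<partial>lborel) = f y * (\<integral>\<^sup>+ x. b (T x) \<partial>lborel)"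
      by (simp add: nn_integral_cmult)
  qed
  also have "\<dots> = (\<integral>\<^sup>+ y. f y \<partial>lborel) * (\<integral>\<^sup>+ x. b (T x) \<partial>lborel)"
    by (rule nn_integral_multc) simp
  also have "(\<integral>\<^sup>+ x. b (T x) \<partial>lborel) = (\<integral>\<^sup>+ x. indicator (T -` ball 0 1) x \<partial>lborel)"
    by (intro nn_integral_cong) (auto simp: b_def indicator_def)
  also have "\<dots> = emeasure lborel (T -` ball 0 1)"
    using open_vimage[OF _ T_cont, of "ball 0 1"] by (intro nn_integral_indicator) auto
  finally show ?thesis .
qed

lemma open_imp_emeasure_lborel_pos:
  fixes W :: "'a::euclidean_space set"
  assumes "open W" "x \<in> W"
  shows "emeasure lborel W > 0"
proof -
  obtain r where r: "r > 0" "ball x r \<subseteq> W" using assms openE by blast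
  have "emeasure lborel (ball x r) \<noteq> 0"
    using content_ball_pos[OF r(1), of x] by (auto simp: measure_def)
  moreover have "emeasure lborel (ball x r) \<le> emeasure lborel W"
    using r(2) assms(1) by (intro emeasure_mono) auto
  ultimately show ?thesis by (metis le_zero_eq not_gr_zero)
qed

text \<open>The factor is the ratio of the volumes of the preimage of the unit ball and of the unit
  ball itself. Only its existence matters, since it cancels in \<open>gauge_mean\<close>; this
  spares the determinant.\<close>

lemma lebesgue_integral_linear_change:
  fixes T :: "'a::euclidean_space \<Rightarrow> 'a"
  assumes T: "linear T" "bij T"
  shows "\<exists>c>0. \<forall>f \<in> borel_measurable borel.
    (\<integral>x. f (T x) \<partial>lborel) = c * (\<integral>x. f x \<partial>lborel :: real)"
proof -
  have T_cont: "continuous_on UNIV T" using T(1) by (simp add: linear_continuous_on linear_conv_bounded_linear)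
  then have [measurable]: "T \<in> borel_measurable borel" by (rule borel_measurable_continuous_onI)
  let ?B = "ball (0::'a) 1"
  have op: "open (T -` ?B)" using open_vimage[OF _ T_cont] by blast
  have "bounded (Hilbert_Choice.inv T ` ?B)"
    using T by (intro bounded_linear_image) (auto simp: bij_is_inj inj_linear_imp_inv_linear linear_conv_bounded_linear[symmetric])
  then have bd: "bounded (T -` ?B)" using T(2) by (simp add: bij_vimage_eq_inv_image)
  have fin: "emeasure lborel ?B < \<infinity>" "emeasure lborel (T -` ?B) < \<infinity>"
    using emeasure_bounded_finite[of ?B] emeasure_bounded_finite[OF bd] by auto
  have pos: "emeasure lborel ?B > 0" "emeasure lborel (T -` ?B) > 0"
    using open_imp_emeasure_lborel_pos[of ?B 0] open_imp_emeasure_lborel_pos[OF op, of 0] T(1)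
    by (auto simp: linear_0)
  define p where "p = measure lborel ?B"
  define q where "q = measure lborel (T -` ?B)"
  have p: "emeasure lborel ?B = ennreal p" and q: "emeasure lborel (T -` ?B) = ennreal q"
    using fin by (auto simp: p_def q_def emeasure_eq_ennreal_measure less_top)
  have pq: "p > 0" "q > 0" using pos unfolding p q by auto
  have distr: "distr lborel borel T = density lborel (\<lambda>_. ennreal (q / p))"
  proof (rule measure_eqI)
    fix X assume "X \<in> sets (distr lborel borel T)"
    then have [measurable]: "X \<in> sets borel" by simp
    have TX: "T -` X \<in> sets borel" using measurable_sets_borel[of T borel X] by simp
    have "(\<integral>\<^sup>+ x. indicator X (T x) \<partial>lborel) = (\<integral>\<^sup>+ x. indicator (T -` X) x \<partial>lborel)"
      by (intro nn_integral_cong) (simp add: indicator_def)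
    then have "emeasure lborel (T -` X) * ennreal p = emeasure lborel X * ennreal q"
      using nn_integral_lborel_linear_ball[OF T, of "indicator X"] TX by (simp add: p q)
    then have "emeasure lborel (T -` X) = emeasure lborel X * ennreal q / ennreal p"
      using pq by (metis ennreal_mult_divide_eq ennreal_eq_0_iff ennreal_neq_top linorder_not_le)
    also have "\<dots> = ennreal (q / p) * emeasure lborel X"
      using pq by (simp add: divide_ennreal[symmetric] ennreal_times_divide mult.commute)
    finally show "emeasure (distr lborel borel T) X = emeasure (density lborel (\<lambda>_. ennreal (q / p))) X"
      by (simp add: emeasure_distr emeasure_density nn_integral_cmult_indicator)
  qed simp
  have "(\<integral>x. f (T x) \<partial>lborel) = q / p * (\<integral>x. f x \<partial>lborel)" if [measurable]: "f \<in> borel_measurable borel" for f :: "'a \<Rightarrow> real"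
  proof -
    have "(\<integral>x. f (T x) \<partial>lborel) = (\<integral>x. f x \<partial>distr lborel borel T)" by (rule integral_distr[symmetric]) auto
    also have "\<dots> = (\<integral>x. (q / p) *\<^sub>R f x \<partial>lborel)"
      unfolding distr using pq by (intro integral_density) auto
    finally show ?thesis by simp
  qed
  then show ?thesis using pq by (intro exI[of _ "q / p"]) auto
qed

section \<open>Gauges, their weights and the stability of weighted means\<close>

lemma integral_lborel_continuous_pos:
  fixes f :: "'a::euclidean_space \<Rightarrow> real"
  assumes f: "integrable lborel f" "continuous_on UNIV f" "\<And>x. f x \<ge> 0" and x: "f x > 0"
  shows "(\<integral>x. f x \<partial>lborel) > 0"
proof (rule ccontr)
  assume "\<not> ?thesis"
  moreover have "(\<integral>x. f x \<partial>lborel) \<ge> 0" using f(3) by simp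
  ultimately have "(\<integral>x. f x \<partial>lborel) = 0" by linarith
  then have "AE x in lborel. f x = 0"
    using integral_nonneg_eq_0_iff_AE[OF f(1)] f(3) by simp
  then have "emeasure lborel {x. f x \<noteq> 0} = 0"
    by (subst (asm) AE_iff_measurable[OF _ refl]) (use borel_measurable_continuous_onI[OF f(2)] in auto)
  moreover have "open {x. f x \<noteq> 0}"
    by (intro open_Collect_neq f continuous_on_const)
  ultimately show False using open_imp_emeasure_lborel_pos[of "{x. f x \<noteq> 0}" x] x by simp
qed

text \<open>The traits of a Finsler energy on one tangent space that averaging uses: the quadratic
  lower bound confines the weight to a ball, and \<open>e 0 = 0\<close> together with continuity
  makes the weight positive near 0.\<close>

definition quadratic_gauge :: "('a::euclidean_space \<Rightarrow> real) \<Rightarrow> bool" where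
  "quadratic_gauge e \<longleftrightarrow> continuous_on UNIV e \<and> e 0 = 0 \<and> (\<exists>m>0. \<forall>y. m * (norm y)\<^sup>2 \<le> e y)"

text \<open>Vanishes continuously at the boundary of the unit ball of \<open>e\<close> and is
  1-Lipschitz in \<open>e\<close>, so that integrals against it respond proportionally to a change
  of \<open>e\<close>.\<close>

definition gauge_weight :: "('a::euclidean_space \<Rightarrow> real) \<Rightarrow> 'a \<Rightarrow> real" where
  "gauge_weight e y = max 0 (1 - e y)"

text \<open>Normalized by the total weight, so that the volume factor of a linear change of
  variables cancels.\<close>

definition gauge_mean :: "('a::euclidean_space \<Rightarrow> real) \<Rightarrow> ('a \<Rightarrow> real) \<Rightarrow> real" where
  "gauge_mean e p = (\<integral>y. gauge_weight e y * p y \<partial>lborel) / (\<integral>y. gauge_weight e y \<partial>lborel)"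

lemma continuous_on_gauge_weight:
  "continuous_on S e \<Longrightarrow> continuous_on S (gauge_weight e)"
  unfolding gauge_weight_def by (intro continuous_intros)

lemma gauge_weight_eq_0:
  assumes "m > 0" "m * (norm y)\<^sup>2 \<le> e y" "y \<notin> cball 0 (1 / sqrt m)"
  shows "gauge_weight e y = 0"
proof -
  have "1 / sqrt m \<le> norm y" using assms(3) by simp
  then have "(1 / sqrt m)\<^sup>2 \<le> (norm y)\<^sup>2" using assms(1) by (intro power_mono) auto
  then have "1 \<le> m * (norm y)\<^sup>2" using assms(1) by (simp add: power_divide field_simps)
  then show ?thesis using assms(2) by (simp add: gauge_weight_def)
qed

lemma integrable_gauge_weight:
  assumes e: "continuous_on UNIV e" "m > 0" "\<And>y. m * (norm y)\<^sup>2 \<le> e y" and p: "continuous_on UNIV p"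
  shows "integrable lborel (\<lambda>y. gauge_weight e y * p y :: real)"
proof -
  let ?C = "cball 0 (1 / sqrt m)"
  have "integrable lborel (\<lambda>y. indicator ?C y *\<^sub>R (gauge_weight e y * p y))"
    using e p by (intro borel_integrable_compact continuous_on_mult continuous_on_gauge_weight)
      (auto intro: continuous_on_subset)
  also have "(\<lambda>y. indicator ?C y *\<^sub>R (gauge_weight e y * p y)) = (\<lambda>y. gauge_weight e y * p y)"
    using gauge_weight_eq_0[of m _ e, OF e(2,3)] by (auto simp: indicator_def fun_eq_iff)
  finally show ?thesis .
qed

text \<open>Both weights live in the ball of radius \<open>R\<close>: as
  \<open>\<delta> \<le> m / 2\<close>, the perturbed \<open>e'\<close> keeps a lower bound with
  constant \<open>m / 2\<close>. On that ball the weights differ by at most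
  \<open>\<delta> * R^2\<close>, by the Lipschitz property, and \<open>K\<close> is the integral of
  the absolute value of \<open>p\<close> over it.\<close>

lemma integral_gauge_weight_close:
  assumes e: "continuous_on UNIV e" "m > 0" "\<And>y. m * (norm y)\<^sup>2 \<le> e y" and p: "continuous_on UNIV p"
  shows "\<exists>C\<ge>0. \<forall>e' \<delta>. continuous_on UNIV e' \<longrightarrow> 0 \<le> \<delta> \<longrightarrow> \<delta> \<le> m / 2 \<longrightarrow>
    (\<forall>y. \<bar>e' y - e y\<bar> \<le> \<delta> * (norm y)\<^sup>2) \<longrightarrow>
    \<bar>(\<integral>y. gauge_weight e' y * p y \<partial>lborel) - (\<integral>y. gauge_weight e y * p y \<partial>lborel)\<bar> \<le> C * \<delta>"
proof -
  define R where "R = 1 / sqrt (m / 2)"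
  let ?C = "cball 0 R"
  define K where "K = (\<integral>y. indicator ?C y *\<^sub>R \<bar>p y\<bar> \<partial>lborel)"
  have K_int: "integrable lborel (\<lambda>y. indicator ?C y *\<^sub>R \<bar>p y\<bar>)"
    using p by (intro borel_integrable_compact continuous_on_rabs) (auto intro: continuous_on_subset)
  have "K \<ge> 0" unfolding K_def by (rule Bochner_Integration.integral_nonneg) simp
  moreover have "\<bar>(\<integral>y. gauge_weight e' y * p y \<partial>lborel) - (\<integral>y. gauge_weight e y * p y \<partial>lborel)\<bar> \<le> R\<^sup>2 * K * \<delta>"
    if e': "continuous_on UNIV e'" and \<delta>: "0 \<le> \<delta>" "\<delta> \<le> m / 2"
      and close: "\<And>y. \<bar>e' y - e y\<bar> \<le> \<delta> * (norm y)\<^sup>2" for e' \<delta>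
  proof -
    have e'_low: "m / 2 * (norm y)\<^sup>2 \<le> e' y" for y
    proof -
      have "\<delta> * (norm y)\<^sup>2 \<le> m / 2 * (norm y)\<^sup>2" using \<delta> by (intro mult_right_mono) auto
      then show ?thesis using close[of y] e(3)[of y] by linarith
    qed
    have e_low: "m / 2 * (norm y)\<^sup>2 \<le> e y" for y
      by (rule order_trans[OF mult_right_mono e(3)]) (use e(2) in auto)
    have m2: "m / 2 > 0" using e(2) by simp
    have i: "integrable lborel (\<lambda>y. gauge_weight e' y * p y)" "integrable lborel (\<lambda>y. gauge_weight e y * p y)"
      using integrable_gauge_weight[OF e' m2 e'_low p] integrable_gauge_weight[OF e p] by auto
    have "\<bar>\<integral>y. gauge_weight e' y * p y - gauge_weight e y * p y \<partial>lborel\<bar>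
        \<le> (\<integral>y. \<bar>gauge_weight e' y * p y - gauge_weight e y * p y\<bar> \<partial>lborel)"
      by (rule integral_abs_bound)
    also have "\<dots> \<le> (\<integral>y. \<delta> * R\<^sup>2 * (indicator ?C y *\<^sub>R \<bar>p y\<bar>) \<partial>lborel)"
    proof (rule integral_mono)
      fix y :: 'a
      show "\<bar>gauge_weight e' y * p y - gauge_weight e y * p y\<bar> \<le> \<delta> * R\<^sup>2 * (indicator ?C y *\<^sub>R \<bar>p y\<bar>)"
      proof (cases "y \<in> ?C")
        case True
        have "(norm y)\<^sup>2 \<le> R\<^sup>2" using True by (intro power_mono) auto
        then have "\<bar>e' y - e y\<bar> \<le> \<delta> * R\<^sup>2"
          by (rule order_trans[OF close mult_left_mono[OF _ \<delta>(1)]])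
        moreover have "\<bar>gauge_weight e' y - gauge_weight e y\<bar> \<le> \<bar>e' y - e y\<bar>"
          by (simp add: gauge_weight_def max_def abs_minus_commute)
        ultimately have "\<bar>gauge_weight e' y - gauge_weight e y\<bar> \<le> \<delta> * R\<^sup>2" by linarith
        then have "\<bar>gauge_weight e' y - gauge_weight e y\<bar> * \<bar>p y\<bar> \<le> \<delta> * R\<^sup>2 * \<bar>p y\<bar>"
          by (rule mult_right_mono) simp
        then show ?thesis using True by (simp add: left_diff_distrib[symmetric] abs_mult)
      next
        case False
        then show ?thesis
          using gauge_weight_eq_0[of "m/2" y e', OF m2 e'_low] gauge_weight_eq_0[of "m/2" y e, OF m2 e_low]
          by (simp add: R_def)
      qed
    qed (use i K_int in auto)
    also have "\<dots> = \<delta> * R\<^sup>2 * K" unfolding K_def by (rule integral_mult_right_zero)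
    also have "\<dots> = R\<^sup>2 * K * \<delta>" by simp
    also have "(\<integral>y. gauge_weight e' y * p y - gauge_weight e y * p y \<partial>lborel)
        = (\<integral>y. gauge_weight e' y * p y \<partial>lborel) - (\<integral>y. gauge_weight e y * p y \<partial>lborel)"
      by (rule Bochner_Integration.integral_diff[OF i])
    finally show ?thesis .
  qed
  ultimately show ?thesis by (intro exI[of _ "R\<^sup>2 * K"]) auto
qed

text \<open>The weight is known to be positive only on some small ball about 0; hence
  \<open>p\<close> is asked to be positive at points arbitrarily close to 0.\<close>

lemma integral_gauge_weight_pos:
  assumes e: "quadratic_gauge e" and p: "continuous_on UNIV p" "\<And>y. p y \<ge> 0" "\<And>r. r > 0 \<Longrightarrow> \<exists>y. norm y < r \<and> p y > 0"
  shows "(\<integral>y. gauge_weight e y * p y \<partial>lborel) > 0"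
proof -
  obtain m where m: "m > 0" "\<And>y. m * (norm y)\<^sup>2 \<le> e y" and c: "continuous_on UNIV e" "e 0 = 0"
    using e by (auto simp: quadratic_gauge_def)
  have "isCont e 0" using c(1) by (simp add: continuous_on_eq_continuous_at)
  then obtain r where r: "r > 0" "\<And>y. norm y < r \<Longrightarrow> \<bar>e y\<bar> < 1"
    using c(2) unfolding continuous_at_eps_delta by (metis diff_zero dist_norm dist_real_def zero_less_one)
  obtain y where y: "norm y < r" "p y > 0" using p(3)[OF r(1)] by blast
  show ?thesis
  proof (rule integral_lborel_continuous_pos)
    show "0 < gauge_weight e y * p y" using y r(2)[of y] by (auto simp: gauge_weight_def)
    show "continuous_on UNIV (\<lambda>y. gauge_weight e y * p y)"
      by (intro continuous_on_mult continuous_on_gauge_weight c p)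
  qed (use integrable_gauge_weight[OF c(1) m p(1)] p in \<open>auto simp: gauge_weight_def\<close>)
qed

lemma gauge_volume_pos:
  fixes e :: "'a::euclidean_space \<Rightarrow> real"
  shows "quadratic_gauge e \<Longrightarrow> (\<integral>y. gauge_weight e y \<partial>lborel) > 0"
proof -
  have "\<exists>y::'a. norm y < r" if "r > 0" for r using that by (intro exI[of _ 0]) simp
  then show "quadratic_gauge e \<Longrightarrow> ?thesis"
    using integral_gauge_weight_pos[of e "\<lambda>_. 1"] by simp
qed

text \<open>Quotient estimate for the numerator and the total weight. The smallness bound on
  \<open>\<delta>\<close> keeps the perturbed total weight above half the original one,
  \<open>V / 2\<close>, so the denominators stay away from 0.\<close>

lemma gauge_mean_close:
  assumes e: "quadratic_gauge e" and p: "continuous_on UNIV p"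
  shows "\<exists>C\<ge>0. \<exists>\<delta>\<^sub>0>0. \<forall>e' \<delta>. continuous_on UNIV e' \<longrightarrow> 0 \<le> \<delta> \<longrightarrow> \<delta> \<le> \<delta>\<^sub>0 \<longrightarrow>
    (\<forall>y. \<bar>e' y - e y\<bar> \<le> \<delta> * (norm y)\<^sup>2) \<longrightarrow> \<bar>gauge_mean e' p - gauge_mean e p\<bar> \<le> C * \<delta>"
proof -
  obtain m where m: "m > 0" "\<And>y. m * (norm y)\<^sup>2 \<le> e y" and c: "continuous_on UNIV e"
    using e by (auto simp: quadratic_gauge_def)
  let ?N = "\<lambda>e. \<integral>y. gauge_weight e y * p y \<partial>lborel" and ?V = "\<lambda>e. \<integral>y. gauge_weight e y \<partial>lborel"
  obtain C1 where C1: "C1 \<ge> 0" "\<And>e' \<delta>. continuous_on UNIV e' \<Longrightarrow> 0 \<le> \<delta> \<Longrightarrow> \<delta> \<le> m / 2 \<Longrightarrow>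
      (\<And>y. \<bar>e' y - e y\<bar> \<le> \<delta> * (norm y)\<^sup>2) \<Longrightarrow> \<bar>?N e' - ?N e\<bar> \<le> C1 * \<delta>"
    using integral_gauge_weight_close[OF c m p] by blast
  obtain C0 where C0: "C0 \<ge> 0" "\<And>e' \<delta>. continuous_on UNIV e' \<Longrightarrow> 0 \<le> \<delta> \<Longrightarrow> \<delta> \<le> m / 2 \<Longrightarrow>
      (\<And>y. \<bar>e' y - e y\<bar> \<le> \<delta> * (norm y)\<^sup>2) \<Longrightarrow> \<bar>?V e' - ?V e\<bar> \<le> C0 * \<delta>"
    using integral_gauge_weight_close[OF c m continuous_on_const, of 1] by auto
  define V where "V = ?V e"
  define N where "N = ?N e"
  have V: "V > 0" using gauge_volume_pos[OF e] by (simp add: V_def)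
  define \<delta>\<^sub>0 where "\<delta>\<^sub>0 = min (m / 2) (V / (2 * (C0 + 1)))"
  define C where "C = (C1 * V + \<bar>N\<bar> * C0) * 2 / V\<^sup>2"
  have "\<bar>gauge_mean e' p - gauge_mean e p\<bar> \<le> C * \<delta>"
    if e': "continuous_on UNIV e'" and \<delta>: "0 \<le> \<delta>" "\<delta> \<le> \<delta>\<^sub>0"
      and close: "\<And>y. \<bar>e' y - e y\<bar> \<le> \<delta> * (norm y)\<^sup>2" for e' \<delta>
  proof -
    define V' where "V' = ?V e'"
    define N' where "N' = ?N e'"
    have N': "\<bar>N' - N\<bar> \<le> C1 * \<delta>" and V': "\<bar>V' - V\<bar> \<le> C0 * \<delta>"
      using C1(2)[OF e' \<delta>(1) _ close] C0(2)[OF e' \<delta>(1) _ close] \<delta>(2)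
      by (auto simp: N'_def N_def V'_def V_def \<delta>\<^sub>0_def)
    have "C0 * \<delta> \<le> C0 * (V / (2 * (C0 + 1)))" using C0(1) \<delta>(2) by (intro mult_left_mono) (auto simp: \<delta>\<^sub>0_def)
    also have "\<dots> \<le> V / 2" using C0(1) V by (simp add: field_simps)
    finally have V'2: "V / 2 \<le> V'" using V' by linarith
    then have "V' > 0" using V by linarith
    have "gauge_mean e' p = N' / V'" "gauge_mean e p = N / V"
      by (simp_all only: gauge_mean_def N_def N'_def V_def V'_def)
    then have "gauge_mean e' p - gauge_mean e p = ((N' - N) * V - N * (V' - V)) / (V * V')"
      using V \<open>V' > 0\<close> by (simp add: field_simps)
    also have "\<bar>\<dots>\<bar> = \<bar>(N' - N) * V - N * (V' - V)\<bar> / (V * V')" using V \<open>V' > 0\<close> by simp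
    also have "\<dots> \<le> ((C1 * \<delta>) * V + \<bar>N\<bar> * (C0 * \<delta>)) / (V * (V / 2))"
    proof (rule frac_le)
      have "\<bar>(N' - N) * V\<bar> \<le> (C1 * \<delta>) * V" using N' V by (simp add: abs_mult)
      moreover have "\<bar>N * (V' - V)\<bar> \<le> \<bar>N\<bar> * (C0 * \<delta>)" using V' by (simp add: abs_mult mult_left_mono)
      ultimately show "\<bar>(N' - N) * V - N * (V' - V)\<bar> \<le> (C1 * \<delta>) * V + \<bar>N\<bar> * (C0 * \<delta>)" by linarith
      show "V * (V / 2) \<le> V * V'" using V V'2 by (intro mult_left_mono) auto
    qed (use V C1(1) C0(1) \<delta>(1) in auto)
    also have "\<dots> = C * \<delta>" using V by (simp add: C_def power2_eq_square field_simps)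
    finally show ?thesis .
  qed
  moreover have "\<delta>\<^sub>0 > 0" using m V C0(1) by (simp add: \<delta>\<^sub>0_def)
  moreover have "C \<ge> 0" using V C1(1) C0(1) by (simp add: C_def)
  ultimately show ?thesis by blast
qed

text \<open>Takes the place of differentiation under the integral sign: if the gauges agree at
  \<open>x\<close> to first order, uniformly relative to \<open>(norm y)\<^sup>2\<close>, the means
  differ by at most a constant times that error, which is o(norm (z - x)).\<close>

lemma gauge_mean_has_derivative_0:
  assumes U: "open U" "x \<in> U" and F: "quadratic_gauge (F x)" "\<And>z. z \<in> U \<Longrightarrow> continuous_on UNIV (F z)"
    and p: "continuous_on UNIV p"
    and close: "\<And>\<eta>. \<eta> > 0 \<Longrightarrow> \<exists>r>0. \<forall>z y. norm (z - x) < r \<longrightarrow>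
      \<bar>F z y - F x y\<bar> \<le> \<eta> * norm (z - x) * (norm y)\<^sup>2"
  shows "((\<lambda>z. gauge_mean (F z) p) has_derivative (\<lambda>_. 0)) (at x)"
  unfolding has_derivative_at_alt
proof (intro conjI allI impI bounded_linear_zero)
  fix \<epsilon> :: real assume \<epsilon>: "\<epsilon> > 0"
  obtain C \<delta>\<^sub>0 where C: "C \<ge> 0" "\<delta>\<^sub>0 > 0" "\<And>e' \<delta>. continuous_on UNIV e' \<Longrightarrow> 0 \<le> \<delta> \<Longrightarrow> \<delta> \<le> \<delta>\<^sub>0 \<Longrightarrow>
    (\<And>y. \<bar>e' y - F x y\<bar> \<le> \<delta> * (norm y)\<^sup>2) \<Longrightarrow> \<bar>gauge_mean e' p - gauge_mean (F x) p\<bar> \<le> C * \<delta>"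
    using gauge_mean_close[OF F(1) p] by blast
  define \<eta> where "\<eta> = \<epsilon> / (C + 1)"
  have \<eta>: "\<eta> > 0" "C * \<eta> \<le> \<epsilon>" using \<epsilon> C(1) by (auto simp: \<eta>_def field_simps)
  obtain r where r: "r > 0" "\<And>z y. norm (z - x) < r \<Longrightarrow> \<bar>F z y - F x y\<bar> \<le> \<eta> * norm (z - x) * (norm y)\<^sup>2"
    using close[OF \<eta>(1)] by blast
  obtain s where s: "s > 0" "ball x s \<subseteq> U" using U openE by blast
  define d where "d = min r (min s (\<delta>\<^sub>0 / \<eta>))"
  have "norm (gauge_mean (F z) p - gauge_mean (F x) p - 0) \<le> \<epsilon> * norm (z - x)" if z: "norm (z - x) < d" for z
  proof -
    have "z \<in> U" using z s(2) by (auto simp: d_def dist_norm norm_minus_commute)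
    moreover have "\<eta> * norm (z - x) \<le> \<delta>\<^sub>0" using z \<eta>(1) by (simp add: d_def field_simps)
    ultimately have "\<bar>gauge_mean (F z) p - gauge_mean (F x) p\<bar> \<le> C * (\<eta> * norm (z - x))"
      using z r(2)[of z] \<eta>(1) F(2) by (intro C(3)) (auto simp: d_def)
    also have "\<dots> \<le> \<epsilon> * norm (z - x)" using mult_right_mono[OF \<eta>(2), of "norm (z - x)"] by (simp add: mult.assoc)
    finally show ?thesis by simp
  qed
  moreover have "d > 0" using r(1) s(1) C(2) \<eta>(1) by (simp add: d_def)
  ultimately show "\<exists>d>0. \<forall>z. norm (z - x) < d \<longrightarrow>
      norm (gauge_mean (F z) p - gauge_mean (F x) p - 0) \<le> \<epsilon> * norm (z - x)" by blast
qed

lemma gauge_mean_linear_change: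
  fixes T :: "'a::euclidean_space \<Rightarrow> 'a"
  assumes "continuous_on UNIV e" "continuous_on UNIV p" "linear T" "bij T"
  shows "gauge_mean (\<lambda>y. e (T y)) (\<lambda>y. p (T y)) = gauge_mean e p"
proof -
  obtain c where c: "c > 0" "\<And>f. f \<in> borel_measurable borel \<Longrightarrow> (\<integral>x. f (T x) \<partial>lborel) = c * (\<integral>x. f x \<partial>lborel :: real)"
    using lebesgue_integral_linear_change[OF assms(3,4)] by blast
  have "(\<integral>y. gauge_weight e (T y) * p (T y) \<partial>lborel) = c * (\<integral>y. gauge_weight e y * p y \<partial>lborel)"
    by (intro c(2)[of "\<lambda>y. gauge_weight e y * p y"] borel_measurable_continuous_onI continuous_on_mult continuous_on_gauge_weight assms)
  moreover have "(\<integral>y. gauge_weight e (T y) \<partial>lborel) = c * (\<integral>y. gauge_weight e y \<partial>lborel)"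
    by (intro c(2) borel_measurable_continuous_onI continuous_on_gauge_weight assms)
  ultimately show ?thesis using c(1) by (simp add: gauge_mean_def gauge_weight_def)
qed

lemma quadratic_gauge_linear_change:
  fixes T :: "'a::euclidean_space \<Rightarrow> 'a"
  assumes e: "quadratic_gauge e" and T: "linear T" "inj T"
  shows "quadratic_gauge (\<lambda>y. e (T y))"
proof -
  obtain m where m: "m > 0" "\<And>y. m * (norm y)\<^sup>2 \<le> e y" and c: "continuous_on UNIV e" "e 0 = 0"
    using e by (auto simp: quadratic_gauge_def)
  obtain B where B: "B > 0" "\<And>x. B * norm x \<le> norm (T x)" using linear_inj_bounded_below_pos[OF T] by blast
  have "m * B\<^sup>2 * (norm y)\<^sup>2 \<le> e (T y)" for y
  proof -
    have "(B * norm y)\<^sup>2 \<le> (norm (T y))\<^sup>2" using B by (intro power_mono) auto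
    then have "m * (B\<^sup>2 * (norm y)\<^sup>2) \<le> m * (norm (T y))\<^sup>2" using m by (simp add: power_mult_distrib)
    then show ?thesis using m(2)[of "T y"] by (simp add: mult.assoc)
  qed
  moreover have "continuous_on UNIV (\<lambda>y. e (T y))"
    using continuous_on_compose2[OF c(1), of UNIV T] T(1) by (simp add: linear_continuous_on linear_conv_bounded_linear)
  ultimately show ?thesis using m(1) B(1) c(2) T(1) unfolding quadratic_gauge_def
    by (intro conjI exI[of _ "m * B\<^sup>2"]) (auto simp: linear_0)
qed

section \<open>The Binet-Legendre inner product\<close>

text \<open>The formula for the derivative of a matrix inverse, for families of linear maps given
  pointwise. The remainder is estimated after applying \<open>M z\<close>, where it becomes
  computable, and the lower bound \<open>c\<close>, valid for all \<open>z\<close> near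
  \<open>x\<close>, carries the estimate back.\<close>

lemma inverse_operator_has_derivative:
  fixes M :: "'a::real_normed_vector \<Rightarrow> 'b::euclidean_space \<Rightarrow> 'b"
  assumes U: "open U" "x \<in> U" and lin: "\<And>z. z \<in> U \<Longrightarrow> linear (M z)" "inj (M x)"
    and deriv: "\<And>\<xi>. ((\<lambda>z. M z \<xi>) has_derivative M' \<xi>) (at x)"
  shows "((\<lambda>z. Hilbert_Choice.inv (M z) a) has_derivative
    (\<lambda>w. - Hilbert_Choice.inv (M x) (M' (Hilbert_Choice.inv (M x) a) w))) (at x)"
proof -
  let ?N = "\<lambda>z. Hilbert_Choice.inv (M z)"
  obtain B where B: "B > 0" "\<And>\<xi>. B * norm \<xi> \<le> norm (M x \<xi>)"
    using linear_inj_bounded_below_pos[OF lin(1)[OF U(2)] lin(2)] by blast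
  have close: "\<forall>\<^sub>F z in nhds x. z \<in> U \<and> (\<forall>\<xi>. norm (M z \<xi> - M x \<xi>) \<le> \<epsilon> * norm \<xi>)" if \<epsilon>: "\<epsilon> > 0" for \<epsilon>
  proof -
    define \<epsilon>' where "\<epsilon>' = \<epsilon> / DIM('b)"
    have \<epsilon>': "\<epsilon>' > 0" using \<epsilon> by (simp add: \<epsilon>'_def)
    have "\<forall>\<^sub>F z in nhds x. norm (M z b - M x b) < \<epsilon>'" for b
    proof -
      have "isCont (\<lambda>z. M z b) x" using has_derivative_continuous[OF deriv] .
      then have "((\<lambda>z. M z b) \<longlongrightarrow> M x b) (nhds x)" 
        using tendsto_at_iff_tendsto_nhds[of "\<lambda>z. M z b" x] by (simp add: isCont_def)
      from tendstoD[OF this \<epsilon>'] show ?thesis by (simp add: dist_norm)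
    qed
    then have "\<forall>\<^sub>F z in nhds x. \<forall>b\<in>Basis. norm (M z b - M x b) < \<epsilon>'"
      by (intro eventually_ball_finite) auto
    moreover have "\<forall>\<^sub>F z in nhds x. z \<in> U" using U by (simp add: eventually_nhds_in_open)
    ultimately show ?thesis
    proof eventually_elim
      case (elim z)
      have "norm (M z \<xi> - M x \<xi>) \<le> \<epsilon> * norm \<xi>" for \<xi>
      proof -
        let ?L = "\<lambda>\<xi>. M z \<xi> - M x \<xi>"
        have "linear ?L" using lin(1) elim(2) U(2) by (intro linear_compose_sub) auto
        then have "norm (?L \<xi>) = norm (\<Sum>b\<in>Basis. (\<xi> \<bullet> b) *\<^sub>R ?L b)" by (subst linear_basis_expansion[symmetric]) auto
        also have "\<dots> \<le> (\<Sum>b\<in>(Basis::'b set). norm \<xi> * \<epsilon>')"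
        proof (rule sum_norm_le)
          fix b :: 'b assume b: "b \<in> Basis"
          then have "norm (?L b) \<le> \<epsilon>'" using elim(1) by (simp add: less_imp_le)
          then show "norm ((\<xi> \<bullet> b) *\<^sub>R ?L b) \<le> norm \<xi> * \<epsilon>'"
            using mult_mono[OF Basis_le_norm[OF b, of \<xi>], of "norm (?L b)" \<epsilon>'] by simp
        qed
        also have "\<dots> = \<epsilon> * norm \<xi>" by (simp add: \<epsilon>'_def)
        finally show ?thesis .
      qed
      then show ?case using elim(2) by blast
    qed
  qed
  \<comment> \<open>Half the lower bound of \<open>M x\<close>; the other half is spent on the
    deviation of \<open>M z\<close> from \<open>M x\<close>.\<close>
  define c where "c = B / 2"
  have c: "c > 0" using B by (simp add: c_def)
  have low: "\<forall>\<^sub>F z in nhds x. z \<in> U \<and> (\<forall>\<xi>. c * norm \<xi> \<le> norm (M z \<xi>))"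
    using close[OF c]
  proof eventually_elim
    case (elim z)
    have "c * norm \<xi> \<le> norm (M z \<xi>)" for \<xi>
    proof -
      have "norm (M z \<xi> - M x \<xi>) \<le> c * norm \<xi>" "2 * (c * norm \<xi>) \<le> norm (M x \<xi>)"
        using elim B(2)[of \<xi>] by (auto simp: c_def)
      then show ?thesis using norm_triangle_ineq2[of "M x \<xi>" "M x \<xi> - M z \<xi>"] by (simp add: norm_minus_commute)
    qed
    then show ?case using elim by blast
  qed
  have bij: "M z (?N z b) = b \<and> ?N z (M z b) = b" and norm_inv: "c * norm (?N z b) \<le> norm b"
    if z: "z \<in> U" "\<And>\<xi>. c * norm \<xi> \<le> norm (M z \<xi>)" for z b
  proof -
    have l: "linear (M z)" by (rule lin(1)[OF z(1)])
    have i: "inj (M z)"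
    proof (subst linear_injective_0[OF l], intro allI impI)
      fix \<xi> assume "M z \<xi> = 0"
      then have "c * norm \<xi> \<le> 0" using z(2)[of \<xi>] by simp
      then show "\<xi> = 0" using c by (simp add: mult_le_0_iff)
    qed
    then have "surj (M z)" using linear_inj_imp_surj[OF l] by blast
    then show *: "M z (?N z b) = b \<and> ?N z (M z b) = b" using i by (simp add: surj_f_inv_f)
    show "c * norm (?N z b) \<le> norm b" using z(2)[of "?N z b"] * by simp
  qed
  have lowx: "c * norm \<xi> \<le> norm (M x \<xi>)" for \<xi>
    using low eventually_nhds_x_imp_x by fastforce
  note bijx = bij[OF U(2) lowx] and normx = norm_inv[OF U(2) lowx]
  have linN: "linear (?N x)" using inj_linear_imp_inv_linear[OF lin(1)[OF U(2)] lin(2)] .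
  define \<zeta> where "\<zeta> = ?N x a"
  have M'lin: "bounded_linear (M' \<zeta>)" using deriv has_derivative_bounded_linear by blast
  have bl: "bounded_linear (\<lambda>w. - ?N x (M' \<zeta> w))"
    using bounded_linear_minus[OF bounded_linear_compose[OF _ M'lin]] linN by (simp add: linear_conv_bounded_linear)
  obtain K where K: "K > 0" "\<And>w. norm (?N x (M' \<zeta> w)) \<le> K * norm w"
    using bounded_linear.pos_bounded[OF bl] by (auto simp: mult.commute)
  show ?thesis unfolding has_derivative_within_alt2
  proof (intro conjI allI impI bl[unfolded \<zeta>_def])
    fix \<epsilon> :: real assume \<epsilon>: "\<epsilon> > 0"
    define \<epsilon>1 where "\<epsilon>1 = \<epsilon> * c / (1 + K)"
    have \<epsilon>1: "\<epsilon>1 > 0" using \<epsilon> c K(1) by (simp add: \<epsilon>1_def)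
    have "\<forall>\<^sub>F z in at x. norm (M z \<zeta> - M x \<zeta> - M' \<zeta> (z - x)) \<le> \<epsilon>1 * norm (z - x)"
      using deriv[of \<zeta>] \<epsilon>1 unfolding has_derivative_within_alt2 by blast
    then have "\<forall>\<^sub>F z in nhds x. norm (M z \<zeta> - M x \<zeta> - M' \<zeta> (z - x)) \<le> \<epsilon>1 * norm (z - x)"
      by (rule eventually_nhds_conv_at[THEN iffD2, OF conjI]) (simp add: linear_0 bounded_linear.linear[OF M'lin])
    then have "\<forall>\<^sub>F z in nhds x. norm (?N z a - ?N x a - - ?N x (M' \<zeta> (z - x))) \<le> \<epsilon> * norm (z - x)"
      using low close[OF \<epsilon>1]
    proof eventually_elim
      case (elim z)
      have z: "z \<in> U" "\<And>\<xi>. c * norm \<xi> \<le> norm (M z \<xi>)" using elim(2) by auto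
      define \<zeta>' where "\<zeta>' = ?N x (M' \<zeta> (z - x))"
      define d where "d = ?N z a - ?N x a - - ?N x (M' \<zeta> (z - x))"
      \<comment> \<open>Under \<open>M z\<close> the remainder splits into two small parts: the
        first-order error of \<open>M\<close> at \<open>\<zeta>\<close>, and the change of
        \<open>M\<close> on \<open>\<zeta>'\<close>, a vector that is itself O(norm (z -
        x)).\<close>
      have "M z d = a - M z \<zeta> + M z \<zeta>'"
        using lin(1)[OF z(1)] bij[OF z] by (simp add: d_def \<zeta>_def \<zeta>'_def linear_add linear_diff)
      also have "a = M x \<zeta>" using bijx by (simp add: \<zeta>_def)
      also have "M x \<zeta> - M z \<zeta> + M z \<zeta>' = (M z \<zeta>' - M x \<zeta>') - (M z \<zeta> - M x \<zeta> - M' \<zeta> (z - x))"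
        using bijx by (simp add: \<zeta>'_def)
      also have "norm \<dots> \<le> norm (M z \<zeta>' - M x \<zeta>') + norm (M z \<zeta> - M x \<zeta> - M' \<zeta> (z - x))"
        by (rule norm_triangle_ineq4)
      also have "\<dots> \<le> \<epsilon>1 * norm \<zeta>' + \<epsilon>1 * norm (z - x)" using elim by (intro add_mono) auto
      also have "\<dots> \<le> \<epsilon>1 * (K * norm (z - x)) + \<epsilon>1 * norm (z - x)"
        using K(2) \<epsilon>1 by (intro add_mono mult_left_mono) (auto simp: \<zeta>'_def)
      also have "\<dots> = (\<epsilon>1 * (1 + K)) * norm (z - x)" by (simp add: algebra_simps)
      also have "\<epsilon>1 * (1 + K) = \<epsilon> * c" using K(1) by (simp add: \<epsilon>1_def)
      also have "\<epsilon> * c * norm (z - x) = c * (\<epsilon> * norm (z - x))" by simp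
      finally have "c * norm d \<le> c * (\<epsilon> * norm (z - x))" using z(2)[of d] by linarith
      then show ?case using c by (simp add: d_def)
    qed
    then show "\<forall>\<^sub>F z in at x. norm (?N z a - ?N x a - - ?N x (M' (?N x a) (z - x))) \<le> \<epsilon> * norm (z - x)"
      by (simp add: eventually_nhds_conv_at \<zeta>_def)
  qed
qed

text \<open>The matrix of second moments of the weight. It is a symmetric form on covectors; through
  the inner product it reads as an operator on vectors.\<close>

definition gauge_operator :: "('a::euclidean_space \<Rightarrow> real) \<Rightarrow> 'a \<Rightarrow> 'a" where
  "gauge_operator e \<xi> = (\<Sum>b\<in>Basis. gauge_mean e (\<lambda>y. (\<xi> \<bullet> y) * (b \<bullet> y)) *\<^sub>R b)"

text \<open>The Binet-Legendre inner product of \<open>e\<close>. It does not depend on the inner product \<open>\<bullet>\<close>, which only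
  serves to identify the space with its dual.\<close>

definition legendre_form :: "('a::euclidean_space \<Rightarrow> real) \<Rightarrow> 'a \<Rightarrow> 'a \<Rightarrow> real" where
  "legendre_form e a b = a \<bullet> Hilbert_Choice.inv (gauge_operator e) b"

section \<open>Symmetry, positivity and invertibility of the second-moment operator\<close>

lemma gauge_mean_add:
  assumes "quadratic_gauge e" "continuous_on UNIV p" "continuous_on UNIV q"
  shows "gauge_mean e (\<lambda>y. p y + q y) = gauge_mean e p + gauge_mean e q"
proof -
  obtain m where m: "m > 0" "\<And>y. m * (norm y)\<^sup>2 \<le> e y" and c: "continuous_on UNIV e"
    using assms(1) by (auto simp: quadratic_gauge_def)
  have "(\<integral>y. gauge_weight e y * (p y + q y) \<partial>lborel)
      = (\<integral>y. gauge_weight e y * p y \<partial>lborel) + (\<integral>y. gauge_weight e y * q y \<partial>lborel)"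
    unfolding distrib_left
    by (intro Bochner_Integration.integral_add integrable_gauge_weight[of e m, OF c m] assms)
  then show ?thesis by (simp add: gauge_mean_def add_divide_distrib)
qed

lemma gauge_mean_cmult: "gauge_mean e (\<lambda>y. r * p y) = r * gauge_mean e p"
proof -
  have "(\<integral>y. gauge_weight e y * (r * p y) \<partial>lborel) = (\<integral>y. r * (gauge_weight e y * p y) \<partial>lborel)"
    by (simp only: mult.left_commute)
  then show ?thesis by (simp add: gauge_mean_def)
qed

lemma gauge_mean_sum:
  assumes "quadratic_gauge e" "finite I" "\<And>i. i \<in> I \<Longrightarrow> continuous_on UNIV (p i)"
  shows "gauge_mean e (\<lambda>y. \<Sum>i\<in>I. p i y) = (\<Sum>i\<in>I. gauge_mean e (p i))"
  using assms(2,3)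
proof (induction I)
  case empty
  show ?case by (simp add: gauge_mean_def)
next
  case (insert i I)
  then show ?case by (simp add: gauge_mean_add[OF assms(1)] continuous_on_sum)
qed

lemma gauge_operator_inner:
  assumes "quadratic_gauge e"
  shows "gauge_operator e \<xi> \<bullet> \<eta> = gauge_mean e (\<lambda>y. (\<xi> \<bullet> y) * (\<eta> \<bullet> y))"
proof -
  have "gauge_mean e (\<lambda>y. (\<xi> \<bullet> y) * (\<eta> \<bullet> y))
      = gauge_mean e (\<lambda>y. \<Sum>b\<in>Basis. (\<eta> \<bullet> b) * ((\<xi> \<bullet> y) * (b \<bullet> y)))"
    by (subst (2) euclidean_inner)
      (simp add: sum_distrib_left sum_distrib_right inner_commute mult.assoc mult.left_commute)
  also have "\<dots> = (\<Sum>b\<in>Basis. (\<eta> \<bullet> b) * gauge_mean e (\<lambda>y. (\<xi> \<bullet> y) * (b \<bullet> y)))"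
    by (subst gauge_mean_sum[OF assms]) (auto simp: gauge_mean_cmult intro!: continuous_intros)
  also have "\<dots> = gauge_operator e \<xi> \<bullet> \<eta>"
    unfolding gauge_operator_def inner_sum_left inner_scaleR_left
    by (rule sum.cong) (simp_all add: inner_commute[of \<eta>] mult.commute)
  finally show ?thesis by simp
qed

lemma gauge_operator_symmetric:
  "quadratic_gauge e \<Longrightarrow> gauge_operator e \<xi> \<bullet> \<eta> = \<xi> \<bullet> gauge_operator e \<eta>"
  by (subst (2) inner_commute) (simp add: gauge_operator_inner mult.commute)

lemma linear_gauge_operator:
  assumes "quadratic_gauge e" shows "linear (gauge_operator e)"
proof (rule linearI)
  fix a b :: 'a and r :: real
  have "gauge_operator e (a + b) \<bullet> \<eta> = (gauge_operator e a + gauge_operator e b) \<bullet> \<eta>" for \<eta>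
    by (simp add: gauge_operator_inner[OF assms] inner_add_left distrib_right)
      (intro gauge_mean_add assms continuous_intros)
  then show "gauge_operator e (a + b) = gauge_operator e a + gauge_operator e b" by (metis inner_commute vector_eq_ldot)
  have "gauge_operator e (r *\<^sub>R a) \<bullet> \<eta> = (r *\<^sub>R gauge_operator e a) \<bullet> \<eta>" for \<eta>
    by (simp add: gauge_operator_inner[OF assms] mult.assoc gauge_mean_cmult)
  then show "gauge_operator e (r *\<^sub>R a) = r *\<^sub>R gauge_operator e a" by (metis inner_commute vector_eq_ldot)
qed

lemma gauge_operator_pos:
  assumes e: "quadratic_gauge e" and "\<xi> \<noteq> 0" shows "gauge_operator e \<xi> \<bullet> \<xi> > 0"
proof -
  have "(\<integral>y. gauge_weight e y * ((\<xi> \<bullet> y) * (\<xi> \<bullet> y)) \<partial>lborel) > 0"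
  proof (rule integral_gauge_weight_pos[OF e])
    fix r :: real assume r: "r > 0"
    show "\<exists>y. norm y < r \<and> 0 < (\<xi> \<bullet> y) * (\<xi> \<bullet> y)"
      using r assms(2) by (intro exI[of _ "(r / 2 / norm \<xi>) *\<^sub>R \<xi>"]) simp
  qed (auto intro!: continuous_intros)
  then show ?thesis using gauge_volume_pos[OF e] by (simp add: gauge_operator_inner[OF e] gauge_mean_def)
qed

lemma gauge_operator_inverse:
  assumes "quadratic_gauge e"
  shows "inj (gauge_operator e)"
    and "gauge_operator e (Hilbert_Choice.inv (gauge_operator e) a) = a"
    and "Hilbert_Choice.inv (gauge_operator e) (gauge_operator e a) = a"
    and "linear (Hilbert_Choice.inv (gauge_operator e))"
proof -
  note l = linear_gauge_operator[OF assms]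
  show i: "inj (gauge_operator e)"
    using gauge_operator_pos[OF assms] by (subst linear_injective_0[OF l]) (metis inner_zero_left less_irrefl)
  have "surj (gauge_operator e)" using linear_inj_imp_surj[OF l i] .
  then show "gauge_operator e (Hilbert_Choice.inv (gauge_operator e) a) = a" by (rule surj_f_inv_f)
  show "Hilbert_Choice.inv (gauge_operator e) (gauge_operator e a) = a" using i by simp
  show "linear (Hilbert_Choice.inv (gauge_operator e))" using inj_linear_imp_inv_linear[OF l i] .
qed

lemma legendre_form_symmetric:
  assumes "quadratic_gauge e" shows "legendre_form e a b = legendre_form e b a"
  using gauge_operator_symmetric[OF assms, of "Hilbert_Choice.inv (gauge_operator e) a" "Hilbert_Choice.inv (gauge_operator e) b"]
  by (simp add: legendre_form_def gauge_operator_inverse[OF assms]) (simp add: inner_commute)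

lemma bilinear_legendre_form:
  assumes "quadratic_gauge e" shows "bilinear (legendre_form e)"
  unfolding bilinear_def legendre_form_def using gauge_operator_inverse(4)[OF assms]
  by (auto intro!: linearI simp: inner_add inner_left_distrib linear_add linear_scale)

lemma legendre_form_pos:
  assumes "quadratic_gauge e" "a \<noteq> 0" shows "legendre_form e a a > 0"
proof -
  let ?\<xi> = "Hilbert_Choice.inv (gauge_operator e) a"
  have "?\<xi> \<noteq> 0" using assms gauge_operator_inverse(2)[OF assms(1), of a] linear_0[OF linear_gauge_operator[OF assms(1)]] by metis
  from gauge_operator_pos[OF assms(1) this] show ?thesis
    by (simp add: legendre_form_def gauge_operator_inverse[OF assms(1)])
qed

text \<open>Substitution relates the moments of \<open>e\<close> to those of its pullback: with
  \<open>S\<close> the inverse of \<open>T\<close>, the operator of the pullback is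
  \<open>S op S^T\<close>, so its inverse is \<open>T^T op^-1 T\<close>. Instead of inverting, the
  proof checks that \<open>adjoint T \<beta>\<close> is a preimage of \<open>b\<close>.\<close>

lemma legendre_form_linear_change:
  fixes T :: "'a::euclidean_space \<Rightarrow> 'a"
  assumes e: "quadratic_gauge e" and T: "linear T" "inj T"
  shows "legendre_form (\<lambda>y. e (T y)) a b = legendre_form e (T a) (T b)"
proof -
  have surj: "surj T" using linear_inj_imp_surj[OF T] .
  define S where "S = Hilbert_Choice.inv T"
  have S: "linear S" "S (T y) = y" "T (S y) = y" for y
    using T surj inj_linear_imp_inv_linear[OF T] by (auto simp: S_def surj_f_inv_f)
  have eT: "quadratic_gauge (\<lambda>y. e (T y))" using quadratic_gauge_linear_change[OF e T] .
  have c: "continuous_on UNIV e" using e by (simp add: quadratic_gauge_def)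
  define \<beta> where "\<beta> = Hilbert_Choice.inv (gauge_operator e) (T b)"
  \<comment> \<open>Tested against \<open>\<eta>\<close>: \<open>adjoint S\<close> rewrites
    \<open>\<eta> \<bullet> y\<close> as a covector evaluated at \<open>T y\<close>, so that the
    whole integrand depends on \<open>T y\<close> and the substitution applies.\<close>
  have "gauge_operator (\<lambda>y. e (T y)) (adjoint T \<beta>) \<bullet> \<eta> = b \<bullet> \<eta>" for \<eta>
  proof -
    have "gauge_operator (\<lambda>y. e (T y)) (adjoint T \<beta>) \<bullet> \<eta>
        = gauge_mean (\<lambda>y. e (T y)) (\<lambda>y. (\<beta> \<bullet> T y) * (adjoint S \<eta> \<bullet> T y))"
      by (simp add: gauge_operator_inner[OF eT] adjoint_clauses[OF T(1)] adjoint_clauses[OF S(1)] S)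
    also have "\<dots> = gauge_mean e (\<lambda>y. (\<beta> \<bullet> y) * (adjoint S \<eta> \<bullet> y))"
      using gauge_mean_linear_change[OF c, of "\<lambda>y. (\<beta> \<bullet> y) * (adjoint S \<eta> \<bullet> y)" T] T surj
      by (simp add: bij_def continuous_intros)
    also have "\<dots> = gauge_operator e \<beta> \<bullet> adjoint S \<eta>" by (rule gauge_operator_inner[OF e, symmetric])
    also have "\<dots> = b \<bullet> \<eta>"
      by (simp add: \<beta>_def gauge_operator_inverse[OF e] adjoint_clauses[OF S(1)] S)
    finally show ?thesis .
  qed
  then have "gauge_operator (\<lambda>y. e (T y)) (adjoint T \<beta>) = b" by (metis inner_commute vector_eq_ldot)
  then have "Hilbert_Choice.inv (gauge_operator (\<lambda>y. e (T y))) b = adjoint T \<beta>"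
    using gauge_operator_inverse(3)[OF eT] by metis
  then show ?thesis by (simp add: legendre_form_def \<beta>_def adjoint_clauses[OF T(1)])
qed

text \<open>Separates the moments from the arguments. In a product rule the moments can then be
  differentiated at fixed basis vectors, while the moving arguments contribute scalar coefficients
  only.\<close>

lemma gauge_operator_bilinear_expand:
  assumes "quadratic_gauge e"
  shows "gauge_operator e \<xi> \<bullet> \<eta>
    = (\<Sum>b\<in>Basis. \<Sum>c\<in>Basis. (\<xi> \<bullet> b) * (\<eta> \<bullet> c) * (gauge_operator e b \<bullet> c))"
proof -
  have "gauge_operator e \<xi> \<bullet> \<eta> = (\<Sum>b\<in>Basis. (\<xi> \<bullet> b) *\<^sub>R gauge_operator e b) \<bullet> \<eta>"
    by (subst linear_basis_expansion[OF linear_gauge_operator[OF assms], of \<xi>]) simp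
  also have "\<dots> = (\<Sum>b\<in>Basis. (\<xi> \<bullet> b) * (gauge_operator e b \<bullet> \<eta>))" by (simp add: inner_sum_left)
  also have "\<dots> = (\<Sum>b\<in>Basis. \<Sum>c\<in>Basis. (\<xi> \<bullet> b) * (\<eta> \<bullet> c) * (gauge_operator e b \<bullet> c))"
  proof (rule sum.cong[OF refl])
    fix b :: 'a
    show "(\<xi> \<bullet> b) * (gauge_operator e b \<bullet> \<eta>) = (\<Sum>c\<in>Basis. (\<xi> \<bullet> b) * (\<eta> \<bullet> c) * (gauge_operator e b \<bullet> c))"
      by (subst euclidean_inner) (simp add: sum_distrib_left mult_ac)
  qed
  finally show ?thesis .
qed

text \<open>The second moments of \<open>E (x + v)\<close> are those of \<open>y \<mapsto> E (x + v) (y + \<Gamma> v y)\<close>, transported by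
  \<open>y \<mapsto> y + \<Gamma> v y\<close>; to first order in \<open>v\<close>, the latter function has the same moments as \<open>E x\<close>.\<close>

lemma legendre_form_has_derivative:
  fixes E :: "'a::euclidean_space \<Rightarrow> 'a \<Rightarrow> real" and \<Gamma> :: "'a \<Rightarrow> 'a \<Rightarrow> 'a"
  assumes U: "open U" "x \<in> U" and E: "\<And>z. z \<in> U \<Longrightarrow> quadratic_gauge (E z)" and \<Gamma>: "bilinear \<Gamma>"
    and close: "\<And>\<eta>. \<eta> > 0 \<Longrightarrow> \<exists>r>0. \<forall>v y. norm v < r \<longrightarrow>
      \<bar>E (x + v) (y + \<Gamma> v y) - E x y\<bar> \<le> \<eta> * norm v * (norm y)\<^sup>2"
  shows "((\<lambda>z. legendre_form (E z) a b) has_derivative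
    (\<lambda>w. - legendre_form (E x) (\<Gamma> w a) b - legendre_form (E x) a (\<Gamma> w b))) (at x)"
proof -
  obtain K where K: "K > 0" "\<And>v y. norm (\<Gamma> v y) \<le> K * norm v * norm y"
    using bilinear_bounded_pos[OF \<Gamma>] by blast
  \<comment> \<open>On this ball \<open>\<Gamma> (z - x) y\<close> is shorter than every nonzero
    \<open>y\<close>, which makes \<open>A z\<close> injective.\<close>
  define V where "V = U \<inter> ball x (1 / K)"
  have V: "open V" "x \<in> V" "V \<subseteq> U" using U K(1) by (auto simp: V_def)
  define A where "A z y = y + \<Gamma> (z - x) y" for z y
  define F where "F z y = E z (A z y)" for z y
  have \<Gamma>lin: "linear (\<Gamma> w)" "linear (\<lambda>w. \<Gamma> w y)" for w y using \<Gamma> by (auto simp: bilinear_def)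
  have A_lin: "linear (A z)" for z
    unfolding A_def by (intro linear_compose_add[unfolded o_def] linear_ident \<Gamma>lin)
  have A_inj: "inj (A z)" if "z \<in> V" for z
  proof (subst linear_injective_0[OF A_lin], intro allI impI)
    fix y assume "A z y = 0"
    then have "norm y = norm (\<Gamma> (z - x) y)" by (simp add: A_def add_eq_0_iff norm_minus_commute)
    also have "\<dots> \<le> K * norm (z - x) * norm y" by (rule K(2))
    finally have "norm y \<le> K * norm (z - x) * norm y" .
    moreover have "K * norm (z - x) < 1"
      using that K(1) by (simp add: V_def dist_norm norm_minus_commute field_simps)
    ultimately show "y = 0" by (metis mult_le_cancel_right1 norm_le_zero_iff not_le)
  qed
  have F: "quadratic_gauge (F z)" if "z \<in> V" for z
    unfolding F_def by (rule quadratic_gauge_linear_change[OF E A_lin A_inj]) (use that V(3) in auto)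
  have A_x: "A x y = y" for y using linear_0[OF \<Gamma>lin(2)] by (simp add: A_def)
  have F_x: "F x = E x" by (simp add: F_def A_x fun_eq_iff)
  \<comment> \<open>The transpose of \<open>\<Gamma> w\<close>; likewise
    \<open>\<alpha> \<xi> z\<close> below is the transpose of \<open>A z\<close> applied to
    \<open>\<xi>\<close>.\<close>
  define Ad where "Ad w \<xi> = (\<Sum>k\<in>Basis. (\<xi> \<bullet> \<Gamma> w k) *\<^sub>R k)" for w \<xi>
  have Ad: "Ad w \<xi> \<bullet> y = \<xi> \<bullet> \<Gamma> w y" for w \<xi> y
    by (subst linear_basis_expansion[OF \<Gamma>lin(1)[of w], of y]) (simp add: Ad_def inner_sum_left inner_sum_right inner_commute mult.commute)
  have Ad_bl: "bounded_linear (\<lambda>w. Ad w \<xi> \<bullet> b)" for \<xi> b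
    unfolding Ad using \<Gamma>lin(2) by (intro bounded_linear_inner_right_comp) (simp add: linear_conv_bounded_linear)
  define \<alpha> where "\<alpha> \<xi> z = \<xi> + Ad (z - x) \<xi>" for \<xi> z
  have \<alpha>: "\<alpha> \<xi> z \<bullet> y = \<xi> \<bullet> A z y" for \<xi> z y by (simp add: \<alpha>_def A_def Ad inner_add)
  have \<alpha>_x: "\<alpha> \<xi> x \<bullet> b = \<xi> \<bullet> b" for \<xi> b by (simp add: \<alpha> A_x)
  have \<alpha>_deriv: "((\<lambda>z. \<alpha> \<xi> z \<bullet> b) has_derivative (\<lambda>w. Ad w \<xi> \<bullet> b)) (at x)" for \<xi> b
  proof -
    have "((\<lambda>z. Ad (z - x) \<xi> \<bullet> b) has_derivative (\<lambda>w. Ad w \<xi> \<bullet> b)) (at x)"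
      by (rule bounded_linear.has_derivative[OF Ad_bl]) (auto intro!: derivative_eq_intros)
    from has_derivative_add[OF has_derivative_const[of "\<xi> \<bullet> b"] this] show ?thesis
      unfolding \<alpha>_def inner_add_left by simp
  qed
  \<comment> \<open>Here \<open>close\<close> enters: seen through the moving identification
    \<open>A z\<close>, the moments of the energy are stationary at \<open>x\<close>.\<close>
  have mean_deriv: "((\<lambda>z. gauge_operator (F z) b \<bullet> c) has_derivative (\<lambda>_. 0)) (at x)" for b c
  proof -
    have "((\<lambda>z. gauge_mean (F z) (\<lambda>y. (b \<bullet> y) * (c \<bullet> y))) has_derivative (\<lambda>_. 0)) (at x)"
    proof (rule gauge_mean_has_derivative_0[OF V(1,2)])
      fix \<eta> :: real assume "\<eta> > 0"
      then obtain r where r: "r > 0" "\<And>v y. norm v < r \<Longrightarrow> \<bar>E (x + v) (y + \<Gamma> v y) - E x y\<bar> \<le> \<eta> * norm v * (norm y)\<^sup>2"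
        using close by blast
      have "\<bar>F z y - F x y\<bar> \<le> \<eta> * norm (z - x) * (norm y)\<^sup>2" if "norm (z - x) < r" for z y
        using r(2)[OF that, of y] by (simp add: F_x) (simp add: F_def A_def)
      then show "\<exists>r>0. \<forall>z y. norm (z - x) < r \<longrightarrow> \<bar>F z y - F x y\<bar> \<le> \<eta> * norm (z - x) * (norm y)\<^sup>2"
        using r(1) by blast
    qed (use F V(2) in \<open>auto simp: quadratic_gauge_def intro!: continuous_intros\<close>)
    then show ?thesis
      by (rule has_derivative_transform_within_open[OF _ V(1,2)]) (simp add: gauge_operator_inner F)
  qed
  let ?op = "gauge_operator (E x)"
  note Ex = E[OF U(2)]
  \<comment> \<open>Moments of \<open>E z\<close> are moments of the pullback \<open>F z\<close> at
    transposed arguments, so only the two arguments contribute to the derivative.\<close>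
  have op_deriv: "((\<lambda>z. gauge_operator (E z) \<xi> \<bullet> \<eta>) has_derivative
      (\<lambda>w. ?op (Ad w \<xi>) \<bullet> \<eta> + ?op \<xi> \<bullet> Ad w \<eta>)) (at x)" for \<xi> \<eta>
  proof -
    have "((\<lambda>z. \<Sum>b\<in>Basis. \<Sum>c\<in>Basis. (\<alpha> \<xi> z \<bullet> b) * (\<alpha> \<eta> z \<bullet> c) * (gauge_operator (F z) b \<bullet> c)) has_derivative
      (\<lambda>w. \<Sum>b\<in>Basis. \<Sum>c\<in>Basis. (\<alpha> \<xi> x \<bullet> b) * (\<alpha> \<eta> x \<bullet> c) * 0
        + ((\<alpha> \<xi> x \<bullet> b) * (Ad w \<eta> \<bullet> c) + (Ad w \<xi> \<bullet> b) * (\<alpha> \<eta> x \<bullet> c)) * (gauge_operator (F x) b \<bullet> c))) (at x)"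
      by (intro has_derivative_sum has_derivative_mult \<alpha>_deriv mean_deriv)
    also have "(\<lambda>w. \<Sum>b\<in>Basis. \<Sum>c\<in>Basis. (\<alpha> \<xi> x \<bullet> b) * (\<alpha> \<eta> x \<bullet> c) * 0
        + ((\<alpha> \<xi> x \<bullet> b) * (Ad w \<eta> \<bullet> c) + (Ad w \<xi> \<bullet> b) * (\<alpha> \<eta> x \<bullet> c)) * (gauge_operator (F x) b \<bullet> c))
      = (\<lambda>w. ?op (Ad w \<xi>) \<bullet> \<eta> + ?op \<xi> \<bullet> Ad w \<eta>)"
      unfolding gauge_operator_bilinear_expand[OF Ex, of "Ad _ _"] gauge_operator_bilinear_expand[OF Ex, of _ "Ad _ _"]
      by (simp add: F_x \<alpha>_x distrib_right sum.distrib add.commute)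
    finally show ?thesis
    proof (rule has_derivative_transform_within_open[OF _ V(1,2)])
      fix z assume z: "z \<in> V"
      then have Ez: "quadratic_gauge (E z)" using V(3) E by blast
      have "(\<Sum>b\<in>Basis. \<Sum>c\<in>Basis. (\<alpha> \<xi> z \<bullet> b) * (\<alpha> \<eta> z \<bullet> c) * (gauge_operator (F z) b \<bullet> c))
          = gauge_operator (F z) (\<alpha> \<xi> z) \<bullet> \<alpha> \<eta> z"
        by (rule gauge_operator_bilinear_expand[OF F[OF z], symmetric])
      also have "\<dots> = gauge_mean (F z) (\<lambda>y. (\<xi> \<bullet> A z y) * (\<eta> \<bullet> A z y))"
        by (simp add: gauge_operator_inner[OF F[OF z]] \<alpha>)
      also have "\<dots> = gauge_mean (E z) (\<lambda>y. (\<xi> \<bullet> y) * (\<eta> \<bullet> y))"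
        unfolding F_def using Ez linear_inj_imp_surj[OF A_lin A_inj[OF z]] A_inj[OF z]
        by (intro gauge_mean_linear_change[of _ "\<lambda>y. (\<xi> \<bullet> y) * (\<eta> \<bullet> y)"] A_lin)
          (auto simp: quadratic_gauge_def bij_def intro!: continuous_intros)
      finally show "(\<Sum>b\<in>Basis. \<Sum>c\<in>Basis. (\<alpha> \<xi> z \<bullet> b) * (\<alpha> \<eta> z \<bullet> c) * (gauge_operator (F z) b \<bullet> c))
          = gauge_operator (E z) \<xi> \<bullet> \<eta>" by (simp add: gauge_operator_inner[OF Ez])
    qed
  qed
  have "((\<lambda>z. gauge_operator (E z) \<xi>) has_derivative (\<lambda>w. ?op (Ad w \<xi>) + \<Gamma> w (?op \<xi>))) (at x)" for \<xi>
  proof (subst has_derivative_componentwise_within, intro ballI)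
    fix i :: 'a
    have "?op (Ad w \<xi>) \<bullet> i + ?op \<xi> \<bullet> Ad w i = (?op (Ad w \<xi>) + \<Gamma> w (?op \<xi>)) \<bullet> i" for w
      by (simp add: inner_add_left inner_commute[of _ "Ad w i"] Ad) (simp add: inner_commute)
    then show "((\<lambda>z. gauge_operator (E z) \<xi> \<bullet> i) has_derivative (\<lambda>w. (?op (Ad w \<xi>) + \<Gamma> w (?op \<xi>)) \<bullet> i)) (at x)"
      using op_deriv[of \<xi> i] by simp
  qed
  then have "((\<lambda>z. Hilbert_Choice.inv (gauge_operator (E z)) b) has_derivative
      (\<lambda>w. - Hilbert_Choice.inv ?op (?op (Ad w (Hilbert_Choice.inv ?op b)) + \<Gamma> w (?op (Hilbert_Choice.inv ?op b))))) (at x)"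
    by (intro inverse_operator_has_derivative[OF U]) (auto intro: linear_gauge_operator E gauge_operator_inverse(1)[OF Ex])
  then have "((\<lambda>z. legendre_form (E z) a b) has_derivative
      (\<lambda>w. a \<bullet> - Hilbert_Choice.inv ?op (?op (Ad w (Hilbert_Choice.inv ?op b)) + \<Gamma> w (?op (Hilbert_Choice.inv ?op b))))) (at x)"
    unfolding legendre_form_def by (rule has_derivative_inner_right)
  also have "(\<lambda>w. a \<bullet> - Hilbert_Choice.inv ?op (?op (Ad w (Hilbert_Choice.inv ?op b)) + \<Gamma> w (?op (Hilbert_Choice.inv ?op b))))
    = (\<lambda>w. - legendre_form (E x) (\<Gamma> w a) b - legendre_form (E x) a (\<Gamma> w b))"
  proof (rule ext)
    fix w
    let ?\<xi> = "Hilbert_Choice.inv ?op b"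
    have "a \<bullet> Ad w ?\<xi> = \<Gamma> w a \<bullet> ?\<xi>" using Ad[of w ?\<xi> a] by (simp add: inner_commute)
    moreover have "Hilbert_Choice.inv ?op (?op (Ad w ?\<xi>) + \<Gamma> w (?op ?\<xi>)) = Ad w ?\<xi> + Hilbert_Choice.inv ?op (\<Gamma> w b)"
      by (simp add: linear_add[OF gauge_operator_inverse(4)[OF Ex]] gauge_operator_inverse[OF Ex])
    ultimately show "a \<bullet> - Hilbert_Choice.inv ?op (?op (Ad w ?\<xi>) + \<Gamma> w (?op ?\<xi>))
        = - legendre_form (E x) (\<Gamma> w a) b - legendre_form (E x) a (\<Gamma> w b)"
      by (simp add: legendre_form_def inner_add_right inner_diff_right)
  qed
  finally show ?thesis .
qed

section \<open>Finsler metrics on an open set\<close>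

text \<open>The coordinate form of \<open>finsler_metric\<close> on one chart, so that calculus
  takes place on an open subset of a vector space. Smoothness excludes \<open>y = 0\<close>, where a
  Finsler energy need not be twice differentiable.\<close>

locale finsler_chart =
  fixes U :: "'e::euclidean_space set" and L :: "'e \<Rightarrow> 'e \<Rightarrow> real"
  assumes open_U: "open U"
    and smooth_L: "smooth_on (U \<times> - {0}) (case_prod L)"
    and homogeneous: "\<And>x r y. x \<in> U \<Longrightarrow> r > 0 \<Longrightarrow> L x (r *\<^sub>R y) = r\<^sup>2 * L x y"
    and hessian_pos: "\<And>x y w. x \<in> U \<Longrightarrow> y \<noteq> 0 \<Longrightarrow> w \<noteq> 0 \<Longrightarrow> vertical_hessian L x y w w > 0"
begin

definition D :: "'e \<times> 'e \<Rightarrow> 'e \<times> 'e \<Rightarrow> real" where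
  "D z = frechet_derivative (case_prod L) (at z)"

definition D2 :: "'e \<times> 'e \<Rightarrow> 'e \<times> 'e \<Rightarrow> 'e \<times> 'e \<Rightarrow> real" where
  "D2 z h = frechet_derivative (\<lambda>z. D z h) (at z)"

lemma open_\<Omega>: "open (U \<times> - {0::'e})" using open_U by (intro open_Times) (auto simp: open_Compl)

lemma D: "x \<in> U \<Longrightarrow> y \<noteq> 0 \<Longrightarrow> (case_prod L has_derivative D (x, y)) (at (x, y))"
  unfolding D_def by (intro smooth_on_has_derivative[OF smooth_L]) auto

lemma D2: "x \<in> U \<Longrightarrow> y \<noteq> 0 \<Longrightarrow> ((\<lambda>z. D z h) has_derivative D2 (x, y) h) (at (x, y))"
  unfolding D_def D2_def by (intro smooth_on_has_derivative[OF smooth_on_derivative[OF smooth_L]]) auto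

lemma D2_symmetric: "x \<in> U \<Longrightarrow> y \<noteq> 0 \<Longrightarrow> D2 (x, y) h k = D2 (x, y) k h"
  unfolding D_def D2_def by (intro second_derivative_symmetric[OF open_\<Omega> smooth_L]) auto

lemma linear_D: "x \<in> U \<Longrightarrow> y \<noteq> 0 \<Longrightarrow> linear (D (x, y))"
  using D has_derivative_linear by blast

lemma linear_D2: "x \<in> U \<Longrightarrow> y \<noteq> 0 \<Longrightarrow> linear (D2 (x, y) h)"
  using D2 has_derivative_linear by blast

lemma linear_D2_left: "x \<in> U \<Longrightarrow> y \<noteq> 0 \<Longrightarrow> linear (\<lambda>h. D2 (x, y) h k)"
  using linear_D2 by (simp add: D2_symmetric[of x y _ k])

lemma vertical_derivative:
  assumes "x \<in> U" "y \<noteq> 0" shows "frechet_derivative (L x) (at y) w = D (x, y) (0, w)"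
proof -
  have "((\<lambda>y. case_prod L (x, y)) has_derivative (\<lambda>w. D (x, y) (0, w))) (at y)"
    by (rule has_derivative_compose[where f="\<lambda>y. (x, y)", OF _ D[OF assms]]) (auto intro!: derivative_eq_intros)
  then have "(L x has_derivative (\<lambda>w. D (x, y) (0, w))) (at y)" by simp
  from frechet_derivative_at[OF this] show ?thesis by metis
qed

lemma horizontal_derivative:
  assumes "x \<in> U" "y \<noteq> 0" shows "frechet_derivative (\<lambda>x. L x y) (at x) w = D (x, y) (w, 0)"
proof -
  have "((\<lambda>x. case_prod L (x, y)) has_derivative (\<lambda>w. D (x, y) (w, 0))) (at x)"
    by (rule has_derivative_compose[where f="\<lambda>x. (x, y)", OF _ D[OF assms]]) (auto intro!: derivative_eq_intros)
  then have "((\<lambda>x. L x y) has_derivative (\<lambda>w. D (x, y) (w, 0))) (at x)" by simp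
  from frechet_derivative_at[OF this] show ?thesis by metis
qed

lemma vertical_hessian_eq:
  assumes "x \<in> U" "y \<noteq> 0" shows "vertical_hessian L x y v w = D2 (x, y) (0, v) (0, w)"
proof -
  have "((\<lambda>y. D (x, y) (0, v)) has_derivative (\<lambda>w. D2 (x, y) (0, v) (0, w))) (at y)"
    by (rule has_derivative_compose[where f="\<lambda>y. (x, y)" and g="\<lambda>z. D z (0, v)", OF _ D2[OF assms]])
      (auto intro!: derivative_eq_intros)
  then have "((\<lambda>y. frechet_derivative (L x) (at y) v) has_derivative (\<lambda>w. D2 (x, y) (0, v) (0, w))) (at y)"
    by (rule has_derivative_transform_within_open[of _ _ _ _ "- {0}"])
      (use assms in \<open>auto simp: vertical_derivative\<close>)
  from frechet_derivative_at[OF this] show ?thesis unfolding vertical_hessian_def by metis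
qed

text \<open>Differentiates the homogeneity relation with the vertical increment scaled along with
  \<open>y\<close>. The function \<open>F\<close> is general because the lemma serves for
  \<open>L\<close> and again for its vertical derivative, whose degree is one lower.\<close>

lemma homogeneous_derivative:
  fixes F :: "'e \<times> 'e \<Rightarrow> real"
  assumes hom: "\<And>x y. x \<in> U \<Longrightarrow> y \<noteq> 0 \<Longrightarrow> F (x, r *\<^sub>R y) = c * F (x, y)"
    and F: "\<And>x y. x \<in> U \<Longrightarrow> y \<noteq> 0 \<Longrightarrow> (F has_derivative F' (x, y)) (at (x, y))"
    and r: "r > 0" and z: "x \<in> U" "y \<noteq> 0"
  shows "F' (x, r *\<^sub>R y) (u, r *\<^sub>R v) = c * F' (x, y) (u, v)"
proof -
  have "((\<lambda>z. F (fst z, r *\<^sub>R snd z)) has_derivative (\<lambda>w. F' (x, r *\<^sub>R y) (fst w, r *\<^sub>R snd w))) (at (x, y))"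
    by (rule has_derivative_compose[where f="\<lambda>z. (fst z, r *\<^sub>R snd z)" and g=F])
      (use F[of x "r *\<^sub>R y"] r z in \<open>auto intro!: derivative_eq_intros\<close>)
  moreover have "((\<lambda>z. F (fst z, r *\<^sub>R snd z)) has_derivative (\<lambda>w. c * F' (x, y) w)) (at (x, y))"
  proof (rule has_derivative_transform_within_open[of "\<lambda>z. c * F z", OF _ open_\<Omega>])
    show "((\<lambda>z. c * F z) has_derivative (\<lambda>w. c * F' (x, y) w)) (at (x, y))"
      by (rule has_derivative_mult_right[OF F[OF z]])
    fix w assume "w \<in> U \<times> - {0::'e}"
    then obtain a b where "w = (a, b)" "a \<in> U" "b \<noteq> 0" by auto
    then show "c * F w = F (fst w, r *\<^sub>R snd w)" using hom[of a b] by simp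
  qed (use z in auto)
  ultimately have "(\<lambda>w. F' (x, r *\<^sub>R y) (fst w, r *\<^sub>R snd w)) = (\<lambda>w. c * F' (x, y) w)"
    by (rule has_derivative_unique)
  from fun_cong[OF this, of "(u, v)"] show ?thesis by simp
qed

text \<open>Euler's theorem: both sides are the derivative at \<open>r = 1\<close> of
  \<open>F\<close> along the ray through \<open>y\<close>.\<close>

lemma euler_identity:
  fixes F :: "'e \<times> 'e \<Rightarrow> real"
  assumes hom: "\<And>r. r > 0 \<Longrightarrow> F (x, r *\<^sub>R y) = r ^ k * F (x, y)"
    and F: "(F has_derivative F') (at (x, y))"
  shows "F' (0, y) = k * F (x, y)"
proof -
  have "((\<lambda>r. F (x, r *\<^sub>R y)) has_derivative (\<lambda>s. F' (0, s *\<^sub>R y))) (at 1)"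
    by (rule has_derivative_compose[where f="\<lambda>r. (x, r *\<^sub>R y)" and g=F])
      (use F in \<open>auto intro!: derivative_eq_intros\<close>)
  moreover have "((\<lambda>r. F (x, r *\<^sub>R y)) has_derivative (\<lambda>s. real k * s * F (x, y))) (at 1)"
    by (rule has_derivative_transform_within_open[of "\<lambda>r. r ^ k * F (x, y)" _ _ _ "{0<..}"])
      (use hom in \<open>auto intro!: derivative_eq_intros\<close>)
  ultimately have "(\<lambda>s. F' (0, s *\<^sub>R y)) = (\<lambda>s. real k * s * F (x, y))"
    by (rule has_derivative_unique)
  from fun_cong[OF this, of 1] show ?thesis by simp
qed

lemma D_scale: "x \<in> U \<Longrightarrow> y \<noteq> 0 \<Longrightarrow> r > 0 \<Longrightarrow> D (x, r *\<^sub>R y) (u, r *\<^sub>R v) = r\<^sup>2 * D (x, y) (u, v)"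
  by (rule homogeneous_derivative[where F="case_prod L"]) (auto simp: homogeneous D)

lemma D_scale_horizontal: "x \<in> U \<Longrightarrow> y \<noteq> 0 \<Longrightarrow> r > 0 \<Longrightarrow> D (x, r *\<^sub>R y) (u, 0) = r\<^sup>2 * D (x, y) (u, 0)"
  using D_scale[of x y r u 0] by simp

lemma D_scale_vertical:
  assumes "x \<in> U" "y \<noteq> 0" "r > 0" shows "D (x, r *\<^sub>R y) (0, w) = r * D (x, y) (0, w)"
  using D_scale[OF assms, of 0 "(1 / r) *\<^sub>R w"] linear_scale[OF linear_D[OF assms(1,2)], of "1 / r" "(0, w)"] assms(3)
  by (simp add: power2_eq_square)

lemma D2_scale:
  assumes "x \<in> U" "y \<noteq> 0" "r > 0"
  shows "D2 (x, r *\<^sub>R y) (0, w) (u, r *\<^sub>R v) = r * D2 (x, y) (0, w) (u, v)"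
  using D_scale_vertical assms by (intro homogeneous_derivative[where F="\<lambda>z. D z (0, w)" and F'="\<lambda>z. D2 z (0, w)"] D2) auto

lemma D_euler: "x \<in> U \<Longrightarrow> y \<noteq> 0 \<Longrightarrow> D (x, y) (0, y) = 2 * L x y"
  using euler_identity[of "case_prod L" x y 2] by (simp add: homogeneous D)

lemma D2_euler_vertical: "x \<in> U \<Longrightarrow> y \<noteq> 0 \<Longrightarrow> D2 (x, y) (0, w) (0, y) = D (x, y) (0, w)"
  using euler_identity[of "\<lambda>z. D z (0, w)" x y 1] by (simp add: D_scale_vertical D2)

lemma D2_euler_horizontal: "x \<in> U \<Longrightarrow> y \<noteq> 0 \<Longrightarrow> D2 (x, y) (u, 0) (0, y) = 2 * D (x, y) (u, 0)"
  using euler_identity[of "\<lambda>z. D z (u, 0)" x y 2] by (simp add: D_scale_horizontal D2)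

text \<open>Euler's identity, used twice, gives
  \<open>vertical_hessian L x y y y = 2 * L x y\<close>, so positivity is inherited from the
  Hessian.\<close>

lemma L_pos: "x \<in> U \<Longrightarrow> y \<noteq> 0 \<Longrightarrow> L x y > 0"
  using hessian_pos[of x y y] by (simp add: vertical_hessian_eq D2_euler_vertical D_euler)

text \<open>Scaling by 2 fixes the zero vector, so \<open>L x 0 = 4 * L x 0\<close>.\<close>

lemma L_0: "x \<in> U \<Longrightarrow> L x 0 = 0"
  using homogeneous[of x 2 0] by simp

text \<open>If a reparametrization with first derivative \<open>\<rho>\<close> and second derivative \<open>\<mu>\<close> solves the
  Euler-Lagrange equations and the energy is constant along the curve itself, then testing
  against the velocity gives \<open>\<mu> = 0\<close>.\<close>

lemma euler_lagrange_reparametrization: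
  assumes z: "x \<in> U" "y \<noteq> 0" and \<rho>: "\<rho> > 0" and const: "D (x, y) (y, f) = 0"
    and EL: "\<And>w. D2 (x, \<rho> *\<^sub>R y) (0, w) (\<rho> *\<^sub>R y, \<rho>\<^sup>2 *\<^sub>R f + \<mu> *\<^sub>R y) = D (x, \<rho> *\<^sub>R y) (w, 0)"
  shows "D2 (x, y) (0, w) (y, f) = D (x, y) (w, 0)"
proof -
  note lin = linear_D[OF z] linear_D2[OF z]
  have split: "D (x, y) (a, b) = D (x, y) (a, 0) + D (x, y) (0, b)" for a b
    using linear_add[OF lin(1), of "(a, 0)" "(0, b)"] by simp
  have split2: "D2 (x, y) h (a, b) = D2 (x, y) h (a, 0) + D2 (x, y) h (0, b)" for h a b
    using linear_add[OF lin(2), of h "(a, 0)" "(0, b)"] by simp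
  \<comment> \<open>Homogeneity removes the factor \<open>\<rho>\<close> from the base point. The
    extra acceleration \<open>\<mu> y\<close> is radial, so Euler's identity turns its contribution
    into a multiple of the first vertical derivative.\<close>
  have eq: "\<rho>\<^sup>2 * D2 (x, y) (0, w) (y, f) + \<mu> * D (x, y) (0, w) = \<rho>\<^sup>2 * D (x, y) (w, 0)" for w
  proof -
    have "\<rho>\<^sup>2 *\<^sub>R f + \<mu> *\<^sub>R y = \<rho> *\<^sub>R (\<rho> *\<^sub>R f + (\<mu> / \<rho>) *\<^sub>R y)"
      using \<rho> by (simp add: scaleR_add_right power2_eq_square)
    then have "D2 (x, \<rho> *\<^sub>R y) (0, w) (\<rho> *\<^sub>R y, \<rho>\<^sup>2 *\<^sub>R f + \<mu> *\<^sub>R y)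
        = \<rho> * D2 (x, y) (0, w) (\<rho> *\<^sub>R y, \<rho> *\<^sub>R f + (\<mu> / \<rho>) *\<^sub>R y)"
      using D2_scale[OF z \<rho>] by simp
    also have "(\<rho> *\<^sub>R y, \<rho> *\<^sub>R f + (\<mu> / \<rho>) *\<^sub>R y) = \<rho> *\<^sub>R (y, f) + (\<mu> / \<rho>) *\<^sub>R (0, y)" by simp
    also have "D2 (x, y) (0, w) \<dots> = \<rho> * D2 (x, y) (0, w) (y, f) + \<mu> / \<rho> * D (x, y) (0, w)"
      using D2_euler_vertical[OF z] by (simp add: linear_add[OF lin(2)] linear_scale[OF lin(2)] del: scaleR_Pair add_Pair)
    finally show ?thesis
      using EL[of w] \<rho> D_scale_horizontal[OF z \<rho>] by (simp add: power2_eq_square algebra_simps)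
  qed
  \<comment> \<open>Test with \<open>w = y\<close>: by Euler's identities and constancy of the
    energy, the remaining terms of \<open>eq\<close> already balance. So the term with
    \<open>\<mu>\<close> vanishes, and \<open>L\<close> is positive.\<close>
  have "D2 (x, y) (0, y) (y, f) = 2 * D (x, y) (y, 0) + D (x, y) (0, f)"
    using D2_euler_vertical[OF z, of f] D2_euler_horizontal[OF z, of y]
    by (subst split2) (simp add: D2_symmetric[OF z, of "(0, y)"])
  also have "\<dots> = D (x, y) (y, 0)" using const split[of y f] by simp
  finally have "\<mu> * (2 * L x y) = 0" using eq[of y] D_euler[OF z] by simp
  then have "\<mu> = 0" using L_pos[OF z] by simp
  then show ?thesis using eq[of w] \<rho> by simp
qed

text \<open>By symmetry the fibre derivative of \<open>G y y\<close> is \<open>2 G w y\<close>.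
  Differentiating \<open>const\<close> in direction \<open>w\<close> gives a second-order term,
  which \<open>EL\<close> identifies with \<open>D (x, y) (w, 0)\<close>, plus
  \<open>D (x, y) (w, 2 G w y)\<close>; the sum is twice the claim. The vector
  \<open>(w, G w y)\<close> is the horizontal lift of \<open>w\<close>.\<close>

lemma horizontally_constant:
  assumes z: "x \<in> U" "y \<noteq> 0"
    and G: "bilinear G" "\<And>a b. G a b = G b a"
    and const: "\<And>y. y \<noteq> 0 \<Longrightarrow> D (x, y) (y, G y y) = 0"
    and EL: "D2 (x, y) (0, w) (y, G y y) = D (x, y) (w, 0)"
  shows "D (x, y) (w, G w y) = 0"
proof -
  have Gb: "bounded_bilinear G" using G(1) by (simp add: bilinear_conv_bounded_bilinear)
  let ?h = "\<lambda>y. (y, G y y)" and ?h' = "\<lambda>w. (w, G y w + G w y)"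
  have h: "(?h has_derivative ?h') (at y)"
    by (intro has_derivative_Pair has_derivative_ident) (rule bounded_bilinear.FDERIV[OF Gb]; rule has_derivative_ident)
  have Db: "((\<lambda>y. D (x, y) b) has_derivative (\<lambda>w. D2 (x, y) b (0, w))) (at y)" for b
    by (rule has_derivative_compose[where f="\<lambda>y. (x, y)" and g="\<lambda>z. D z b", OF _ D2[OF z]])
      (auto intro!: derivative_eq_intros)
  \<comment> \<open>Both the linear map \<open>D (x, y)\<close> and its argument depend on
    \<open>y\<close>; expansion in a basis reduces the differentiation to the product rule for real
    functions.\<close>
  have "((\<lambda>y. \<Sum>b\<in>Basis. (?h y \<bullet> b) * D (x, y) b) has_derivative
      (\<lambda>w. \<Sum>b\<in>Basis. (?h y \<bullet> b) * D2 (x, y) b (0, w) + (?h' w \<bullet> b) * D (x, y) b)) (at y)"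
    by (intro has_derivative_sum has_derivative_mult Db has_derivative_inner_left h)
  moreover have "((\<lambda>y. \<Sum>b\<in>Basis. (?h y \<bullet> b) * D (x, y) b) has_derivative (\<lambda>w. 0)) (at y)"
  proof (rule has_derivative_transform_within_open[of "\<lambda>_. 0" _ _ _ "- {0}"])
    fix y :: 'e assume "y \<in> - {0}"
    then have y: "y \<noteq> 0" by simp
    show "0 = (\<Sum>b\<in>Basis. (?h y \<bullet> b) * D (x, y) b)"
      using const[OF y] linear_basis_expansion[OF linear_D[OF z(1) y], of "?h y"] by simp
  qed (use z in auto)
  ultimately have "(\<lambda>w. \<Sum>b\<in>Basis. (?h y \<bullet> b) * D2 (x, y) b (0, w) + (?h' w \<bullet> b) * D (x, y) b) = (\<lambda>w. 0)"
    by (rule has_derivative_unique)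
  from fun_cong[OF this, of w]
  have "D2 (x, y) (?h y) (0, w) + D (x, y) (?h' w) = 0"
    using linear_basis_expansion[OF linear_D2_left[OF z, of "(0, w)"], of "?h y"] linear_basis_expansion[OF linear_D[OF z], of "?h' w"]
    by (simp add: sum.distrib)
  then have "D (x, y) (w, 0) + D (x, y) (?h' w) = 0" using EL by (simp add: D2_symmetric[OF z, of _ "(0, w)"])
  moreover have "(w, 0) + ?h' w = 2 *\<^sub>R (w, G w y)" by (simp add: G(2)[of y w] scaleR_2)
  ultimately show ?thesis
    using linear_add[OF linear_D[OF z], of "(w, 0)" "?h' w"] linear_scale[OF linear_D[OF z], of 2 "(w, G w y)"] by simp
qed

text \<open>Bounds on the compact unit sphere spread to the fibre by homogeneity. Continuity at 0,
  where no smoothness is assumed, follows by squeezing between 0 and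
  \<open>M * (norm y)\<^sup>2\<close>.\<close>

lemma quadratic_gauge_L:
  assumes x: "x \<in> U" shows "quadratic_gauge (L x)"
proof -
  have cont: "continuous_on (- {0}) (L x)"
  proof -
    have "continuous_on (- {0}) (\<lambda>y. case_prod L (x, y))"
      by (rule continuous_on_compose2[OF smooth_on_continuous_on[OF smooth_L]])
        (use x in \<open>auto intro!: continuous_intros\<close>)
    then show ?thesis by simp
  qed
  have "compact (L x ` sphere 0 1)" "L x ` sphere 0 1 \<noteq> {}"
    using continuous_on_subset[OF cont, of "sphere 0 1"] by (auto intro!: compact_continuous_image)
  then obtain m M where m: "m \<in> L x ` sphere 0 1" "\<And>s. s \<in> L x ` sphere 0 1 \<Longrightarrow> m \<le> s \<and> s \<le> M"
    by (metis compact_attains_inf compact_attains_sup)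
  obtain e where "norm e = 1" "m = L x e" using m(1) by auto
  moreover from this have "e \<noteq> 0" by auto
  ultimately have m_pos: "m > 0" using L_pos[OF x, of e] by simp
  have bd: "m * (norm y)\<^sup>2 \<le> L x y \<and> L x y \<le> M * (norm y)\<^sup>2" for y
  proof (cases "y = 0")
    case False
    then have "L x y = (norm y)\<^sup>2 * L x (y /\<^sub>R norm y)" using homogeneous[OF x, of "norm y" "y /\<^sub>R norm y"] by simp
    moreover have "m \<le> L x (y /\<^sub>R norm y) \<and> L x (y /\<^sub>R norm y) \<le> M"
      using False by (intro m(2)) auto
    ultimately show ?thesis by (simp add: mult.commute[of _ "(norm y)\<^sup>2"] mult_left_mono)
  qed (simp add: L_0[OF x])
  have "isCont (L x) y" for y
  proof (cases "y = 0")
    case True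
    have "isCont (\<lambda>y::'e. M * (norm y)\<^sup>2) 0" by (intro continuous_intros)
    then have A: "(\<lambda>y. M * (norm y)\<^sup>2) \<midarrow>(0::'e)\<rightarrow> 0" by (simp add: isCont_def)
    have B: "\<forall>\<^sub>F y in at 0. 0 \<le> L x y" 
      using m_pos by (intro always_eventually allI order_trans[OF _ conjunct1[OF bd]]) simp
    have C: "\<forall>\<^sub>F y in at 0. L x y \<le> M * (norm y)\<^sup>2" using bd by (intro always_eventually) auto
    from tendsto_sandwich[OF B C tendsto_const A] show ?thesis using True L_0[OF x] by (simp add: isCont_def)
  next
    case False
    then show ?thesis using cont continuous_on_eq_continuous_at[of "- {0}" "L x"] by (simp add: open_Compl)
  qed
  then show ?thesis unfolding quadratic_gauge_def
    using m_pos bd L_0[OF x] by (auto intro!: continuous_at_imp_continuous_on)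
qed

text \<open>The map from \<open>y\<close> to \<open>y + G v y\<close> is parallel transport along
  \<open>v\<close> to first order, and \<open>hor\<close> kills the linear term of \<open>L\<close>
  under it. Uniform differentiability on the unit sphere bounds the rest; linearity of the map in
  \<open>y\<close> and homogeneity of \<open>L\<close> give the factor
  \<open>(norm y)\<^sup>2\<close>.\<close>

lemma first_order_invariant:
  assumes x: "x \<in> U" and G: "bilinear G" and hor: "\<And>y w. y \<noteq> 0 \<Longrightarrow> D (x, y) (w, G w y) = 0" and \<eta>: "\<eta> > 0"
  shows "\<exists>r>0. \<forall>v y. norm v < r \<longrightarrow> \<bar>L (x + v) (y + G v y) - L x y\<bar> \<le> \<eta> * norm v * (norm y)\<^sup>2"
proof -
  obtain K where K: "K > 0" "\<And>v y. norm (G v y) \<le> K * norm v * norm y"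
    using bilinear_bounded_pos[OF G] by blast
  \<comment> \<open>At a unit vector \<open>e\<close>, the increment \<open>(v, G v e)\<close> is
    longer than \<open>v\<close> by a factor of at most \<open>1 + K\<close>.\<close>
  define \<eta>' where "\<eta>' = \<eta> / (1 + K)"
  have \<eta>': "\<eta>' > 0" using \<eta> K(1) by (simp add: \<eta>'_def)
  have "Ck_on 1 (U \<times> - {0}) (case_prod L)" using smooth_L by (simp add: smooth_on_def)
  moreover have "compact ({x} \<times> sphere (0::'e) 1)" by (intro compact_Times) auto
  moreover have "{x} \<times> sphere (0::'e) 1 \<subseteq> U \<times> - {0}" using x by auto
  ultimately obtain r where r: "r > 0" "\<And>z h. z \<in> {x} \<times> sphere 0 1 \<Longrightarrow> norm h < r \<Longrightarrow>
      z + h \<in> U \<times> - {0} \<and> norm (case_prod L (z + h) - case_prod L z - D z h) \<le> \<eta>' * norm h"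
    using uniformly_differentiable_on_compact[OF open_\<Omega> _ _ _ \<eta>'] unfolding D_def by metis
  have "\<bar>L (x + v) (y + G v y) - L x y\<bar> \<le> \<eta> * norm v * (norm y)\<^sup>2" if v: "norm v < r / (1 + K)" for v y
  proof -
    have small: "norm (v, G v e) \<le> (1 + K) * norm v" "norm (v, G v e) < r" if "norm e = 1" for e
    proof -
      have "norm (v, G v e) \<le> norm v + norm (G v e)" by (rule norm_Pair_le)
      also have "\<dots> \<le> (1 + K) * norm v" using K(2)[of v e] that by (simp add: algebra_simps)
      finally show *: "norm (v, G v e) \<le> (1 + K) * norm v" .
      also have "\<dots> < r" using v K(1) by (simp add: field_simps)
      finally show "norm (v, G v e) < r" .
    qed
    have unit: "x + v \<in> U \<and> \<bar>L (x + v) (e + G v e) - L x e\<bar> \<le> \<eta> * norm v" if e: "norm e = 1" for e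
    proof -
      have "x + v \<in> U" "\<bar>L (x + v) (e + G v e) - L x e - D (x, e) (v, G v e)\<bar> \<le> \<eta>' * norm (v, G v e)"
        using r(2)[of "(x, e)" "(v, G v e)"] small(2)[OF e] e by auto
      moreover have "D (x, e) (v, G v e) = 0" using e by (intro hor) auto
      moreover have "\<eta>' * norm (v, G v e) \<le> \<eta>' * ((1 + K) * norm v)" using small(1)[OF e] \<eta>' by (intro mult_left_mono) auto
      moreover have "\<eta>' * ((1 + K) * norm v) = \<eta> * norm v" using K(1) by (simp add: \<eta>'_def)
      ultimately show ?thesis by simp
    qed
    obtain e0 :: 'e where "norm e0 = 1" using vector_choose_size[of 1] by auto
    then have xv: "x + v \<in> U" using unit by blast
    have G0: "G v 0 = 0" using G bilinear_rzero by blast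
    show ?thesis
    proof (cases "y = 0")
      case True
      then show ?thesis by (simp add: G0 L_0[OF x] L_0[OF xv])
    next
      case False
      define e where "e = y /\<^sub>R norm y"
      have e: "norm e = 1" "y = norm y *\<^sub>R e" using False by (auto simp: e_def)
      have "y + G v y = norm y *\<^sub>R (e + G v e)"
        by (subst (1 2) e(2)) (simp only: scaleR_add_right bilinear_rmul[OF G])
      then have 1: "L (x + v) (y + G v y) = (norm y)\<^sup>2 * L (x + v) (e + G v e)" using homogeneous[OF xv] False by simp
      have 2: "L x y = (norm y)\<^sup>2 * L x e" using homogeneous[OF x, of "norm y" e] e False by simp
      have "\<bar>L (x + v) (y + G v y) - L x y\<bar> = (norm y)\<^sup>2 * \<bar>L (x + v) (e + G v e) - L x e\<bar>"
        unfolding 1 2 by (simp add: right_diff_distrib[symmetric] abs_mult)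
      also have "\<dots> \<le> (norm y)\<^sup>2 * (\<eta> * norm v)" using unit[OF e(1)] by (intro mult_left_mono) auto
      finally show ?thesis by (simp add: mult.commute)
    qed
  qed
  then show ?thesis using r(1) K(1) by (intro exI[of _ "r / (1 + K)"]) auto
qed

end

text \<open>\<open>G\<close> stands for the Christoffel symbols with opposite sign, as geodesics
  will read \<open>x'' = G x x' x'\<close>. Symmetry means absence of torsion, and
  \<open>horizontal\<close> is infinitesimal invariance of \<open>L\<close> under parallel
  transport. Smoothness at basis vectors extends to all arguments by bilinearity.\<close>

locale horizontal_finsler_chart = finsler_chart U L for U :: "'e::euclidean_space set" and L +
  fixes G :: "'e \<Rightarrow> 'e \<Rightarrow> 'e \<Rightarrow> 'e"
  assumes bilinear_G: "\<And>x. x \<in> U \<Longrightarrow> bilinear (G x)"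
    and G_symmetric: "\<And>x a b. x \<in> U \<Longrightarrow> G x a b = G x b a"
    and smooth_G: "\<And>a b. a \<in> Basis \<Longrightarrow> b \<in> Basis \<Longrightarrow> smooth_on U (\<lambda>x. G x a b)"
    and horizontal: "\<And>x y w. x \<in> U \<Longrightarrow> y \<noteq> 0 \<Longrightarrow> D (x, y) (w, G x w y) = 0"
begin

definition g :: "'e \<Rightarrow> 'e \<Rightarrow> 'e \<Rightarrow> real" where
  "g x = legendre_form (L x)"

section \<open>The averaged inner product is parallel and smooth\<close>

lemma bilinear_g: "x \<in> U \<Longrightarrow> bilinear (g x)"
  unfolding g_def by (intro bilinear_legendre_form quadratic_gauge_L)

lemma g_symmetric: "x \<in> U \<Longrightarrow> g x a b = g x b a"
  unfolding g_def by (intro legendre_form_symmetric quadratic_gauge_L)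

lemma g_pos: "x \<in> U \<Longrightarrow> a \<noteq> 0 \<Longrightarrow> g x a a > 0"
  unfolding g_def by (intro legendre_form_pos quadratic_gauge_L)

text \<open>The vanishing of the covariant derivative of \<open>g\<close>, written as a linear
  first-order system with coefficients from \<open>G\<close>.\<close>

lemma g_has_derivative:
  assumes x: "x \<in> U"
  shows "((\<lambda>z. g z a b) has_derivative (\<lambda>w. - g x (G x w a) b - g x a (G x w b))) (at x)"
  unfolding g_def
  by (rule legendre_form_has_derivative[OF open_U x quadratic_gauge_L bilinear_G[OF x]
        first_order_invariant[OF x bilinear_G[OF x] horizontal[OF x]]])

lemma g_expand_left: "x \<in> U \<Longrightarrow> g x a b = (\<Sum>i\<in>Basis. (a \<bullet> i) * g x i b)"
  using linear_basis_expansion[of "\<lambda>a. g x a b" a] bilinear_g[of x] by (simp add: bilinear_def)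

lemma g_expand_right: "x \<in> U \<Longrightarrow> g x a b = (\<Sum>i\<in>Basis. (b \<bullet> i) * g x a i)"
  using linear_basis_expansion[of "\<lambda>b. g x a b" b] bilinear_g[of x] by (simp add: bilinear_def)

lemma G_expand: "x \<in> U \<Longrightarrow> G x a b = (\<Sum>i\<in>Basis. \<Sum>j\<in>Basis. (a \<bullet> i) *\<^sub>R (b \<bullet> j) *\<^sub>R G x i j)"
proof -
  assume x: "x \<in> U"
  have "G x a b = (\<Sum>i\<in>Basis. (a \<bullet> i) *\<^sub>R G x i b)"
    using linear_basis_expansion[of "\<lambda>a. G x a b" a] bilinear_G[OF x] by (simp add: bilinear_def)
  moreover have "G x i b = (\<Sum>j\<in>Basis. (b \<bullet> j) *\<^sub>R G x i j)" for i
    using linear_basis_expansion[of "\<lambda>b. G x i b" b] bilinear_G[OF x] by (simp add: bilinear_def)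
  ultimately show ?thesis by (simp add: scaleR_sum_right)
qed

lemma smooth_G': "smooth_on U (\<lambda>x. G x a b)"
  by (rule smooth_on_cong[OF open_U G_expand])
    (auto intro!: smooth_on_sum open_U smooth_on_linear[OF open_U bounded_linear_scaleR_right] smooth_G)

text \<open>Bootstrap on \<open>g_has_derivative\<close>: the derivative is a polynomial in the
  components of \<open>g\<close> and of the smooth \<open>G\<close>, so C^k for all components
  yields C^(k+1). The induction treats all \<open>a\<close>, \<open>b\<close> at once because the
  derivative mixes components.\<close>

lemma smooth_g: "smooth_on U (\<lambda>x. g x a b)"
proof -
  have "Ck_on k U (\<lambda>x. g x a b)" for k
  proof (induction k arbitrary: a b)
    case 0
    show ?case unfolding Ck_on.simps
      by (intro continuous_at_imp_continuous_on ballI has_derivative_continuous[OF g_has_derivative])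
  next
    case (Suc k)
    show ?case
    proof (rule Ck_on_SucI[OF open_U g_has_derivative])
      fix w
      have Gk: "Ck_on k U (\<lambda>x. G x w c \<bullet> i)" for c i
        by (rule Ck_on_linear[OF open_U bounded_linear_inner_left]) (use smooth_G' in \<open>simp add: smooth_on_def\<close>)
      have "Ck_on k U (\<lambda>x. \<Sum>i\<in>Basis. (G x w c \<bullet> i) * g x i d)" for c d
        by (intro Ck_on_sum[OF open_U] Ck_on_bilinear[OF open_U bounded_bilinear_mult Gk Suc])
      then have 1: "Ck_on k U (\<lambda>x. g x (G x w c) d)" for c d
        by (rule Ck_on_cong[OF open_U, rotated]) (rule g_expand_left)
      have 2: "Ck_on k U (\<lambda>x. g x c (G x w d))" for c d
        by (rule Ck_on_cong[OF open_U _ 1]) (rule g_symmetric)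
      have "Ck_on k U (\<lambda>x. (- 1) *\<^sub>R (g x (G x w a) b + g x a (G x w b)))"
        by (intro Ck_on_linear[OF open_U bounded_linear_scaleR_right] Ck_on_add[OF open_U] 1 2)
      then show "Ck_on k U (\<lambda>x. - g x (G x w a) b - g x a (G x w b))" by simp
    qed
  qed
  then show ?thesis by (simp add: smooth_on_def)
qed

lemma smooth_quadratic_form: "smooth_on (U \<times> UNIV) (\<lambda>(x, y). g x y y)"
proof -
  have o: "open (U \<times> (UNIV :: 'e set))" by (intro open_Times open_U open_UNIV)
  have fs: "smooth_on (U \<times> (UNIV :: 'e set)) fst" "smooth_on (U \<times> (UNIV :: 'e set)) snd"
    by (intro smooth_on_bounded_linear o bounded_linear_fst bounded_linear_snd)+
  have gi: "smooth_on (U \<times> (UNIV :: 'e set)) (\<lambda>z. g (fst z) i j)" for i j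
    by (rule smooth_on_compose[OF o _ fs(1) smooth_g]) auto
  have yi: "smooth_on (U \<times> (UNIV :: 'e set)) (\<lambda>z. snd z \<bullet> i)" for i
    by (intro smooth_on_linear[OF o bounded_linear_inner_left] fs)
  have S: "smooth_on (U \<times> UNIV) (\<lambda>z. \<Sum>i\<in>Basis. (snd z \<bullet> i) * (\<Sum>j\<in>Basis. (snd z \<bullet> j) * g (fst z) i j))"
    by (intro smooth_on_sum[OF o] smooth_on_bilinear[OF o bounded_bilinear_mult] yi gi)
  have eq: "g x y y = (\<Sum>i\<in>Basis. (y \<bullet> i) * (\<Sum>j\<in>Basis. (y \<bullet> j) * g x i j))" if "x \<in> U" for x y
    by (subst g_expand_left[OF that]) (rule sum.cong[OF refl], subst g_expand_right[OF that], rule refl)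
  show ?thesis by (rule smooth_on_cong[OF o _ S]) (auto simp: eq)
qed

section \<open>Euler-Lagrange equations of a parallel quadratic energy\<close>

lemma quadratic_form_derivatives:
  assumes x: "x \<in> U"
  shows "((\<lambda>y. g x y y) has_derivative (\<lambda>w. 2 * g x y w)) (at y)"
    and "((\<lambda>y. 2 * g x y v) has_derivative (\<lambda>w. 2 * g x w v)) (at y)"
    and "((\<lambda>x. g x y y) has_derivative (\<lambda>w. - 2 * g x (G x w y) y)) (at x)"
proof -
  have bb: "bounded_bilinear (g x)" using bilinear_g[OF x] by (simp add: bilinear_conv_bounded_bilinear)
  have "((\<lambda>y. g x y y) has_derivative (\<lambda>w. g x y w + g x w y)) (at y)"
    by (rule bounded_bilinear.FDERIV[OF bb]) (rule has_derivative_ident)+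
  then show "((\<lambda>y. g x y y) has_derivative (\<lambda>w. 2 * g x y w)) (at y)"
    by (simp add: g_symmetric[OF x, of _ y])
  have "((\<lambda>y. g x y v) has_derivative (\<lambda>w. g x w v)) (at y)"
    by (rule bounded_linear.has_derivative[OF bounded_bilinear.bounded_linear_left[OF bb]]) (rule has_derivative_ident)
  from has_derivative_mult_right[OF this, of 2]
  show "((\<lambda>y. 2 * g x y v) has_derivative (\<lambda>w. 2 * g x w v)) (at y)" by simp
  show "((\<lambda>x. g x y y) has_derivative (\<lambda>w. - 2 * g x (G x w y) y)) (at x)"
    using g_has_derivative[OF x, of y y] by (simp add: g_symmetric[OF x, of y])
qed

lemma vertical_hessian_quadratic_form:
  assumes x: "x \<in> U" shows "vertical_hessian (\<lambda>x y. g x y y) x y v w = 2 * g x v w"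
proof -
  have "frechet_derivative (\<lambda>y. g x y y) (at y) = (\<lambda>w. 2 * g x y w)" for y
    using frechet_derivative_at[OF quadratic_form_derivatives(1)[OF x]] by metis
  then have "vertical_hessian (\<lambda>x y. g x y y) x y v w = frechet_derivative (\<lambda>y. 2 * g x y v) (at y) w"
    by (simp add: vertical_hessian_def)
  also have "frechet_derivative (\<lambda>y. 2 * g x y v) (at y) = (\<lambda>w. 2 * g x w v)"
    using frechet_derivative_at[OF quadratic_form_derivatives(2)[OF x]] by metis
  finally show ?thesis by (simp add: g_symmetric[OF x, of w])
qed

text \<open>As \<open>g\<close> is parallel, the Euler-Lagrange equation tested with
  \<open>w\<close> becomes \<open>g (u' - G u u) w = 0\<close>: the term \<open>g u (G u w)\<close>,
  which comes from the variation of \<open>g\<close> along the curve, cancels against the horizontal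
  derivative of the energy by symmetry of \<open>G\<close>. Definiteness of \<open>g\<close> then
  removes \<open>w\<close>.\<close>

lemma euler_lagrange_quadratic_form_iff:
  assumes x: "\<forall>\<^sub>F s in nhds t. x s \<in> U" "(x has_vector_derivative u t) (at t)" "(u has_vector_derivative u') (at t)"
  shows "(\<forall>w. ((\<lambda>s. frechet_derivative (\<lambda>y. g (x s) y y) (at (u s)) w) has_real_derivative
             frechet_derivative (\<lambda>z. g z (u t) (u t)) (at (x t)) w) (at t)) \<longleftrightarrow> u' = G (x t) (u t) (u t)"
proof -
  have xt: "x t \<in> U" using eventually_nhds_x_imp_x[OF x(1)] .
  obtain N where N: "open N" "t \<in> N" "\<And>s. s \<in> N \<Longrightarrow> x s \<in> U" using x(1) unfolding eventually_nhds by blast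
  let ?y = "u t" and ?g = "g (x t)" and ?G = "G (x t)"
  have bil: "bilinear ?g" by (rule bilinear_g[OF xt])
  have vert: "frechet_derivative (\<lambda>y. g z y y) (at y) w = 2 * g z y w" if "z \<in> U" for z y w
    using frechet_derivative_at[OF quadratic_form_derivatives(1)[OF that]] by metis
  have hor: "frechet_derivative (\<lambda>z. g z ?y ?y) (at (x t)) w = - 2 * ?g (?G w ?y) ?y" for w
    using frechet_derivative_at[OF quadratic_form_derivatives(3)[OF xt]] by metis
  have deriv: "((\<lambda>s. frechet_derivative (\<lambda>y. g (x s) y y) (at (u s)) w) has_real_derivative
      2 * (?g u' w - ?g (?G ?y ?y) w - ?g ?y (?G ?y w))) (at t)" for w
  proof -
    \<comment> \<open>A fixed first slot isolates the dependence on the foot point; \<open>u\<close>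
      enters afterwards through the product rule over a basis.\<close>
    have gi: "((\<lambda>s. g (x s) i w) has_real_derivative - ?g (?G ?y i) w - ?g i (?G ?y w)) (at t)" for i
    proof -
      have "((\<lambda>s. g (x s) i w) has_derivative (\<lambda>h. - ?g (?G (h *\<^sub>R ?y) i) w - ?g i (?G (h *\<^sub>R ?y) w))) (at t)"
        by (rule has_derivative_compose[where f=x and g="\<lambda>z. g z i w", OF x(2)[unfolded has_vector_derivative_def] g_has_derivative[OF xt]])
      also have "(\<lambda>h. - ?g (?G (h *\<^sub>R ?y) i) w - ?g i (?G (h *\<^sub>R ?y) w))
          = (*) (- ?g (?G ?y i) w - ?g i (?G ?y w))"
        by (rule ext) (simp add: bilinear_lmul[OF bilinear_G[OF xt]] bilinear_lmul[OF bil] bilinear_rmul[OF bil] algebra_simps)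
      finally show ?thesis by (simp add: has_field_derivative_def)
    qed
    have "((\<lambda>s. \<Sum>i\<in>Basis. (u s \<bullet> i) * g (x s) i w) has_real_derivative
        (\<Sum>i\<in>Basis. (u' \<bullet> i) * ?g i w + (- ?g (?G ?y i) w - ?g i (?G ?y w)) * (?y \<bullet> i))) (at t)"
    proof (intro DERIV_sum DERIV_mult gi)
      fix i show "((\<lambda>s. u s \<bullet> i) has_real_derivative u' \<bullet> i) (at t)"
        using bounded_linear.has_vector_derivative[OF bounded_linear_inner_left x(3), of i]
        by (simp add: has_real_derivative_iff_has_vector_derivative)
    qed
    also have "(\<Sum>i\<in>Basis. (u' \<bullet> i) * ?g i w + (- ?g (?G ?y i) w - ?g i (?G ?y w)) * (?y \<bullet> i))
        = ?g u' w - ?g (?G ?y ?y) w - ?g ?y (?G ?y w)"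
    proof -
      have "linear (\<lambda>i. ?g (?G ?y i) w)"
        using bil bilinear_G[OF xt] linear_compose[of "?G ?y" "\<lambda>a. ?g a w"] by (simp add: bilinear_def o_def)
      from linear_basis_expansion[OF this, of ?y]
      have "?g (?G ?y ?y) w = (\<Sum>i\<in>Basis. (?y \<bullet> i) * ?g (?G ?y i) w)" by simp
      then show ?thesis using g_expand_left[OF xt, of u' w] g_expand_left[OF xt, of ?y "?G ?y w"]
        by (simp add: sum.distrib sum_subtractf sum_negf algebra_simps)
    qed
    finally have "((\<lambda>s. \<Sum>i\<in>Basis. (u s \<bullet> i) * g (x s) i w) has_real_derivative
        ?g u' w - ?g (?G ?y ?y) w - ?g ?y (?G ?y w)) (at t)" .
    from DERIV_cmult[OF this, of 2] show ?thesis
      by (rule has_field_derivative_transform_within_open[OF _ N(1,2)]) (simp add: vert N(3) g_expand_left[OF N(3), symmetric])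
  qed
  have "((\<lambda>s. frechet_derivative (\<lambda>y. g (x s) y y) (at (u s)) w) has_real_derivative
             frechet_derivative (\<lambda>z. g z (u t) (u t)) (at (x t)) w) (at t) \<longleftrightarrow> ?g (u' - ?G ?y ?y) w = 0" for w
  proof -
    have "?g ?y (?G ?y w) = ?g (?G w ?y) ?y" by (simp add: g_symmetric[OF xt, of ?y] G_symmetric[OF xt, of ?y w])
    moreover have "((\<lambda>s. frechet_derivative (\<lambda>y. g (x s) y y) (at (u s)) w) has_real_derivative E) (at t)
        \<longleftrightarrow> E = 2 * (?g u' w - ?g (?G ?y ?y) w - ?g ?y (?G ?y w))" for E
      by (rule iffI, erule DERIV_unique[OF _ deriv], simp only: deriv)
    ultimately show ?thesis
      using bilinear_lsub[OF bil, of u' "?G ?y ?y" w] unfolding hor by (auto simp: algebra_simps)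
  qed
  moreover have "(\<forall>w. ?g (u' - ?G ?y ?y) w = 0) \<longleftrightarrow> u' = ?G ?y ?y"
    using g_pos[OF xt, of "u' - ?G ?y ?y"] bilinear_lzero[OF bil] by (metis less_irrefl right_minus_eq)
  ultimately show ?thesis by simp
qed

end

section \<open>Charts and tangent vectors\<close>

lemma smooth_atlasD:
  assumes "smooth_atlas A" "c \<in> A"
  shows "inj_on (snd c) (fst c)" "open (chart_range c)"
  using assms by (auto simp: smooth_atlas_def)

lemma smooth_atlas_transition:
  assumes "smooth_atlas A" "c \<in> A" "d \<in> A"
  shows "open (snd c ` (fst c \<inter> fst d))" "smooth_on (snd c ` (fst c \<inter> fst d)) (snd d \<circ> chart_inv c)"
  using assms by (auto simp: smooth_atlas_def)

lemma chart_inv_left: "smooth_atlas A \<Longrightarrow> c \<in> A \<Longrightarrow> p \<in> fst c \<Longrightarrow> chart_inv c (snd c p) = p"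
  by (simp add: chart_inv_def smooth_atlasD(1))

lemma chart_inv_right:
  "x \<in> chart_range c \<Longrightarrow> chart_inv c x \<in> fst c" "x \<in> chart_range c \<Longrightarrow> snd c (chart_inv c x) = x"
  by (auto simp: chart_inv_def chart_range_def inv_into_into f_inv_into_f)

lemma openin_mcarrier:
  assumes "smooth_atlas A" shows "openin (mtopology A) (mcarrier A)"
proof -
  have "mcarrier A \<inter> fst c = fst c" if "c \<in> A" for c using that by (auto simp: mcarrier_def)
  then show ?thesis
    using smooth_atlasD(2)[OF assms] by (auto simp: openin_mtopology[OF assms] chart_range_def)
qed

lemma topspace_mtopology:
  assumes "smooth_atlas A" shows "topspace (mtopology A) = mcarrier A"
  using openin_mcarrier[OF assms] openin_mtopology[OF assms]
  by (metis openin_subset openin_topspace subset_antisym)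

lemma openin_chart_domain:
  assumes "smooth_atlas A" "c \<in> A" shows "openin (mtopology A) (fst c)"
  using smooth_atlas_transition(1)[OF assms(1) _ assms(2)] assms
  by (auto simp: openin_mtopology mcarrier_def Int_commute)

lemma open_chart_image:
  "smooth_atlas A \<Longrightarrow> c \<in> A \<Longrightarrow> openin (mtopology A) W \<Longrightarrow> open (snd c ` (W \<inter> fst c))"
  by (simp add: openin_mtopology)

lemma smooth_map_on_subset_mcarrier:
  "smooth_atlas A \<Longrightarrow> smooth_map_on A W B f \<Longrightarrow> W \<subseteq> mcarrier A"
  unfolding smooth_map_on_def using openin_subset topspace_mtopology by metis

lemma smooth_map_on_image:
  assumes "smooth_atlas A" "smooth_atlas B" "smooth_map_on A W B f" "p \<in> W"
  shows "f p \<in> mcarrier B"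
  using assms smooth_map_on_subset_mcarrier[OF assms(1,3)] unfolding smooth_map_on_def continuous_map_def
  by (auto simp: topspace_mtopology)

lemma smooth_map_on_preimage_open:
  assumes "smooth_map_on A W B f" "openin (mtopology B) Q"
  shows "openin (mtopology A) {p \<in> W. f p \<in> Q}"
proof -
  have W: "openin (mtopology A) W" and f: "continuous_map (subtopology (mtopology A) W) (mtopology B) f"
    using assms(1) by (auto simp: smooth_map_on_def)
  have "topspace (subtopology (mtopology A) W) = W" using openin_subset[OF W] by (auto simp: topspace_subtopology)
  then have "openin (subtopology (mtopology A) W) {p \<in> W. f p \<in> Q}"
    using openin_continuous_map_preimage[OF f assms(2)] by simp
  then show ?thesis using openin_open_subtopology[OF W] by simp
qed

lemma smooth_map_on_open_image:
  assumes "smooth_atlas A" "smooth_map_on A W B f" "openin (mtopology B) Q" "c \<in> A"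
  shows "open (snd c ` (W \<inter> fst c \<inter> f -` Q))"
proof -
  have "{p \<in> W. f p \<in> Q} \<inter> fst c = W \<inter> fst c \<inter> f -` Q" by auto
  then show ?thesis
    using open_chart_image[OF assms(1,4) smooth_map_on_preimage_open[OF assms(2,3)]] by simp
qed

text \<open>Replaces topological continuity by openness of the coordinate domains: continuity of the
  representations then makes preimages of open sets open, chart by chart. Most smoothness claims
  below are checked in this form.\<close>

lemma smooth_map_on_iff:
  assumes A: "smooth_atlas A" and B: "smooth_atlas B"
  shows "smooth_map_on A W B f \<longleftrightarrow> W \<subseteq> mcarrier A \<and> f ` W \<subseteq> mcarrier B \<and>
    (\<forall>c\<in>A. \<forall>d\<in>B. open (snd c ` (W \<inter> fst c \<inter> f -` fst d)) \<and>
      smooth_on (snd c ` (W \<inter> fst c \<inter> f -` fst d)) (snd d \<circ> f \<circ> chart_inv c))"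
    (is "_ \<longleftrightarrow> ?R")
proof
  assume f: "smooth_map_on A W B f"
  then show ?R
    using smooth_map_on_subset_mcarrier[OF A f] smooth_map_on_image[OF A B f]
      smooth_map_on_open_image[OF A f openin_chart_domain[OF B]]
    by (auto simp: smooth_map_on_def)
next
  assume R: ?R
  \<comment> \<open>Seen in chart \<open>c\<close>, a preimage is a union over target charts
    \<open>d\<close>, and each piece is the preimage of an open set under a continuous
    representation.\<close>
  have cov: "snd c ` ({p \<in> W. f p \<in> Q} \<inter> fst c) = (\<Union>d\<in>B. snd c ` (W \<inter> fst c \<inter> f -` (fst d \<inter> Q)))"
    if "c \<in> A" for c Q using R that by (fastforce simp: mcarrier_def)
  have pre: "openin (mtopology A) {p \<in> W. f p \<in> Q}" if Q: "openin (mtopology B) Q" for Q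
    unfolding openin_mtopology[OF A]
  proof (intro conjI ballI)
    fix c assume c: "c \<in> A"
    have "open (snd c ` (W \<inter> fst c \<inter> f -` (fst d \<inter> Q)))" if d: "d \<in> B" for d
    proof -
      let ?N = "snd c ` (W \<inter> fst c \<inter> f -` fst d)" and ?h = "snd d \<circ> f \<circ> chart_inv c"
      have N: "open ?N" "smooth_on ?N ?h" using R c d by auto
      have "open (?h -` (snd d ` (Q \<inter> fst d)) \<inter> ?N)"
        using continuous_on_open_vimage[OF N(1)] smooth_on_continuous_on[OF N(2)] open_chart_image[OF B d Q] by blast
      also have "?h -` (snd d ` (Q \<inter> fst d)) \<inter> ?N = snd c ` (W \<inter> fst c \<inter> f -` (fst d \<inter> Q))"
      proof (intro equalityI subsetI)
        fix x assume "x \<in> ?h -` (snd d ` (Q \<inter> fst d)) \<inter> ?N"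
        then obtain p q where p: "p \<in> W" "p \<in> fst c" "f p \<in> fst d" "x = snd c p" and q: "q \<in> Q" "q \<in> fst d" "?h x = snd d q" by auto
        have "snd d (f p) = snd d q" using p q chart_inv_left[OF A c p(2)] by simp
        then have "f p = q" using smooth_atlasD(1)[OF B d] p(3) q(2) by (meson inj_onD)
        then show "x \<in> snd c ` (W \<inter> fst c \<inter> f -` (fst d \<inter> Q))" using p q by auto
      next
        fix x assume "x \<in> snd c ` (W \<inter> fst c \<inter> f -` (fst d \<inter> Q))"
        then show "x \<in> ?h -` (snd d ` (Q \<inter> fst d)) \<inter> ?N" by (auto simp: chart_inv_left[OF A c])
      qed
      finally show ?thesis .
    qed
    then show "open (snd c ` ({p \<in> W. f p \<in> Q} \<inter> fst c))" unfolding cov[OF c] by blast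
  qed (use R in auto)
  have "{p \<in> W. f p \<in> mcarrier B} = W" using R by auto
  then have W: "openin (mtopology A) W" using pre[OF openin_mcarrier[OF B]] by simp
  have tW: "topspace (subtopology (mtopology A) W) = W" using openin_subset[OF W] by (auto simp: topspace_subtopology)
  have "continuous_map (subtopology (mtopology A) W) (mtopology B) f"
    unfolding continuous_map_def tW
    using R pre openin_open_subtopology[OF W] by (auto simp: topspace_mtopology[OF B])
  then show "smooth_map_on A W B f" using R W by (simp add: smooth_map_on_def)
qed

text \<open>One chart \<open>d\<close> of \<open>B\<close> need not contain the whole image, so
  smoothness is shown near each point, on a set \<open>T\<close> that \<open>f\<close> maps into a
  single chart domain.\<close>

lemma smooth_map_on_compose:
  fixes B :: "('n, 'f::euclidean_space) atlas"
  assumes A: "smooth_atlas A" and B: "smooth_atlas B" and C: "smooth_atlas C"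
    and f: "smooth_map_on A W B f" and g: "smooth_map_on B V C g" and sub: "f ` W \<subseteq> V"
  shows "smooth_map_on A W C (g \<circ> f)"
  unfolding smooth_map_on_def
proof (intro conjI ballI)
  show "openin (mtopology A) W" using f by (simp add: smooth_map_on_def)
  have f': "continuous_map (subtopology (mtopology A) W) (subtopology (mtopology B) V) f"
    using f sub by (auto simp: smooth_map_on_def continuous_map_in_subtopology topspace_subtopology)
  then show "continuous_map (subtopology (mtopology A) W) (mtopology C) (g \<circ> f)"
    using g continuous_map_compose unfolding smooth_map_on_def by blast
  fix c e assume c: "c \<in> A" and e: "e \<in> C"
  show "smooth_on (snd c ` (W \<inter> fst c \<inter> (g \<circ> f) -` fst e)) (snd e \<circ> (g \<circ> f) \<circ> chart_inv c)"
  proof (rule smooth_on_local)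
    fix x assume "x \<in> snd c ` (W \<inter> fst c \<inter> (g \<circ> f) -` fst e)"
    then obtain p where p: "p \<in> W" "p \<in> fst c" "g (f p) \<in> fst e" "x = snd c p" by auto
    obtain d where d: "d \<in> B" "f p \<in> fst d"
      using smooth_map_on_image[OF A B f p(1)] by (auto simp: mcarrier_def)
    let ?M = "snd d ` (V \<inter> fst d \<inter> g -` fst e)" and ?g = "snd e \<circ> g \<circ> chart_inv d"
    let ?N = "snd c ` (W \<inter> fst c \<inter> f -` fst d)" and ?f = "snd d \<circ> f \<circ> chart_inv c"
    have gs: "smooth_on ?M ?g" and fs: "smooth_on ?N ?f"
      using f g c d e by (auto simp: smooth_map_on_def)
    have No: "open ?N" by (rule smooth_map_on_open_image[OF A f openin_chart_domain[OF B d(1)] c])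
    define Q where "Q = fst d \<inter> {q \<in> V. g q \<in> fst e}"
    have Q: "openin (mtopology B) Q" unfolding Q_def
      by (intro openin_Int openin_chart_domain[OF B d(1)] smooth_map_on_preimage_open[OF g] openin_chart_domain[OF C e])
    define T where "T = snd c ` (W \<inter> fst c \<inter> f -` Q)"
    have T: "open T" unfolding T_def by (rule smooth_map_on_open_image[OF A f Q c])
    have TM: "?f ` T \<subseteq> ?M" by (auto simp: T_def Q_def chart_inv_left[OF A c])
    have TN: "T \<subseteq> ?N" by (auto simp: T_def Q_def)
    have "smooth_on T (\<lambda>z. ?g (?f z))"
      by (rule smooth_on_compose[OF T TM smooth_on_subset[OF fs TN] gs])
    then have "smooth_on T (snd e \<circ> (g \<circ> f) \<circ> chart_inv c)"
      by (rule smooth_on_cong[OF T, rotated])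
        (auto simp: T_def Q_def chart_inv_left[OF A c] chart_inv_left[OF B d(1)])
    moreover have "x \<in> T" using p d sub by (auto simp: T_def Q_def)
    ultimately show "\<exists>V. open V \<and> x \<in> V \<and> smooth_on V (snd e \<circ> (g \<circ> f) \<circ> chart_inv c)"
      using T by blast
  qed
qed

lemma smooth_on_has_derivative_rep:
  assumes "smooth_atlas A" "smooth_atlas B" "smooth_map_on A W B f"
    "c \<in> A" "d \<in> B" "p \<in> W" "p \<in> fst c" "f p \<in> fst d"
  shows "(snd d \<circ> f \<circ> chart_inv c has_derivative frechet_derivative (snd d \<circ> f \<circ> chart_inv c) (at (snd c p))) (at (snd c p))"
proof -
  have "smooth_on (snd c ` (W \<inter> fst c \<inter> f -` fst d)) (snd d \<circ> f \<circ> chart_inv c)"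
    using assms by (auto simp: smooth_map_on_def)
  then show ?thesis by (rule smooth_on_has_derivative) (use assms in auto)
qed

section \<open>Derivatives of coordinate changes\<close>

abbreviation chart_change :: "('m, 'e) chart \<Rightarrow> ('m, 'e) chart \<Rightarrow> 'm \<Rightarrow> 'e::real_normed_vector \<Rightarrow> 'e" where
  "chart_change c d p \<equiv> frechet_derivative (snd d \<circ> chart_inv c) (at (snd c p))"

lemma chart_change_has_derivative:
  assumes "smooth_atlas A" "c \<in> A" "d \<in> A" "p \<in> fst c" "p \<in> fst d"
  shows "(snd d \<circ> chart_inv c has_derivative chart_change c d p) (at (snd c p))"
  by (rule smooth_on_has_derivative[OF smooth_atlas_transition(2)[OF assms(1-3)]]) (use assms in auto)

text \<open>Makes coordinate changes the representations of the identity map, so that their cocycle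
  rule and the chart independence of tangent maps become instances of
  \<open>rep_derivative_compose\<close>.\<close>

lemma smooth_map_on_id_chart:
  fixes A :: "('m, 'e::real_normed_vector) atlas"
  assumes A: "smooth_atlas A" shows "smooth_map_on A (mcarrier A) A (\<lambda>p. p)"
proof -
  have "mcarrier A \<inter> fst c \<inter> (\<lambda>p. p) -` fst d = fst c \<inter> fst d" if "c \<in> A" for c d :: "('m, 'e) chart"
    using that by (auto simp: mcarrier_def)
  then show ?thesis unfolding smooth_map_on_iff[OF A A]
    using smooth_atlas_transition[OF A] by (auto simp: o_def)
qed

lemma rep_derivative_compose:
  assumes A: "smooth_atlas A" and B: "smooth_atlas B" and C: "smooth_atlas C"
    and f: "smooth_map_on A W B f" and g: "smooth_map_on B V C g"
    and p: "p \<in> W" "p \<in> fst c" "c \<in> A" and q: "f p \<in> V" "f p \<in> fst d" "d \<in> B"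
    and r: "g (f p) \<in> fst e" "e \<in> C"
  shows "frechet_derivative (snd e \<circ> (\<lambda>p. g (f p)) \<circ> chart_inv c) (at (snd c p)) y
    = frechet_derivative (snd e \<circ> g \<circ> chart_inv d) (at (snd d (f p)))
        (frechet_derivative (snd d \<circ> f \<circ> chart_inv c) (at (snd c p)) y)"
proof -
  let ?f = "snd d \<circ> f \<circ> chart_inv c" and ?g = "snd e \<circ> g \<circ> chart_inv d"
  have fp: "?f (snd c p) = snd d (f p)" using chart_inv_left[OF A p(3,2)] by simp
  have 1: "(?f has_derivative frechet_derivative ?f (at (snd c p))) (at (snd c p))"
    by (rule smooth_on_has_derivative_rep[OF A B f]) (use p q in auto)
  have 2: "(?g has_derivative frechet_derivative ?g (at (snd d (f p)))) (at (?f (snd c p)))"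
    unfolding fp by (rule smooth_on_has_derivative_rep[OF B C g]) (use q r in auto)
  let ?N = "snd c ` (W \<inter> fst c \<inter> f -` fst d)"
  have N: "open ?N" by (rule smooth_map_on_open_image[OF A f openin_chart_domain[OF B q(3)] p(3)])
  have "(snd e \<circ> (\<lambda>p. g (f p)) \<circ> chart_inv c has_derivative
      (\<lambda>y. frechet_derivative ?g (at (snd d (f p))) (frechet_derivative ?f (at (snd c p)) y))) (at (snd c p))"
    by (rule has_derivative_transform_within_open[OF has_derivative_compose[OF 1 2] N])
      (use p q in \<open>auto simp: chart_inv_left[OF A p(3)] chart_inv_left[OF B q(3)]\<close>)
  from frechet_derivative_at[OF this] show ?thesis by metis
qed

lemma chart_change_compose:
  assumes A: "smooth_atlas A" and "c \<in> A" "d \<in> A" "e \<in> A" "p \<in> fst c" "p \<in> fst d" "p \<in> fst e"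
  shows "chart_change d e p (chart_change c d p y) = chart_change c e p y"
proof -
  note i = smooth_map_on_id_chart[OF A]
  have "p \<in> mcarrier A" using assms by (auto simp: mcarrier_def)
  then show ?thesis using rep_derivative_compose[OF A A A i i, of p c d e y] assms by (simp add: o_def)
qed

lemma chart_change_same:
  assumes A: "smooth_atlas A" and "c \<in> A" "p \<in> fst c"
  shows "chart_change c c p y = y"
proof -
  have "(snd c \<circ> chart_inv c has_derivative (\<lambda>y. y)) (at (snd c p))"
    by (rule has_derivative_transform_within_open[OF has_derivative_ident smooth_atlasD(2)[OF assms(1,2)]])
      (use assms in \<open>auto simp: chart_range_def chart_inv_left[OF A]\<close>)
  from frechet_derivative_at[OF this] show ?thesis by metis
qed

lemma linear_chart_change:
  assumes "smooth_atlas A" "c \<in> A" "d \<in> A" "p \<in> fst c" "p \<in> fst d"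
  shows "linear (chart_change c d p)" "inj (chart_change c d p)"
proof -
  show "linear (chart_change c d p)" using chart_change_has_derivative[OF assms] has_derivative_linear by blast
  show "inj (chart_change c d p)"
    by (rule inj_on_inverseI[where g="chart_change d c p"])
      (simp only: chart_change_compose[OF assms(1-3,2,4,5,4)] chart_change_same[OF assms(1,2,4)])
qed

section \<open>Tangent vectors and the tangent bundle as a manifold\<close>

definition tangent_vector :: "('m, 'e::real_normed_vector) atlas \<Rightarrow> ('m, 'e) chart \<Rightarrow> 'm \<Rightarrow> 'e \<Rightarrow> ('m, 'e) tangent" where
  "tangent_vector A c p y = (p, \<lambda>d. if d \<in> A \<and> p \<in> fst d then chart_change c d p y else 0)"

lemma tangent_vector:
  assumes "smooth_atlas A" "c \<in> A" "p \<in> fst c"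
  shows "tangent_vector A c p y \<in> tangent_bundle A" "fst (tangent_vector A c p y) = p"
    "snd (tangent_vector A c p y) c = y"
proof -
  have "chart_change d e p (chart_change c d p y) = chart_change c e p y"
    if "d \<in> A" "e \<in> A" "p \<in> fst d" "p \<in> fst e" for d e
    using chart_change_compose[OF assms(1,2) that(1,2) assms(3) that(3,4)] .
  moreover have "p \<in> mcarrier A" using assms by (auto simp: mcarrier_def)
  ultimately show "tangent_vector A c p y \<in> tangent_bundle A"
    by (simp add: tangent_vector_def tangent_bundle_def)
qed (use assms chart_change_same[OF assms] in \<open>simp_all add: tangent_vector_def\<close>)

lemma tangent_bundle_component:
  assumes "u \<in> tangent_bundle A" "c \<in> A" "d \<in> A" "fst u \<in> fst c" "fst u \<in> fst d"
  shows "snd u d = chart_change c d (fst u) (snd u c)"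
  using assms unfolding tangent_bundle_def case_prod_unfold by blast

lemma tangent_bundle_outside: "u \<in> tangent_bundle A \<Longrightarrow> \<not> (c \<in> A \<and> fst u \<in> fst c) \<Longrightarrow> snd u c = 0"
  unfolding tangent_bundle_def case_prod_unfold by blast

lemma tangent_bundle_eq_tangent_vector:
  assumes "u \<in> tangent_bundle A" "c \<in> A" "fst u \<in> fst c"
  shows "tangent_vector A c (fst u) (snd u c) = u"
proof (rule prod_eqI)
  show "snd (tangent_vector A c (fst u) (snd u c)) = snd u"
  proof
    fix d show "snd (tangent_vector A c (fst u) (snd u c)) d = snd u d"
      using tangent_bundle_component[OF assms(1,2) _ assms(3), of d] tangent_bundle_outside[OF assms(1), of d]
      by (simp add: tangent_vector_def)
  qed
qed (simp add: tangent_vector_def)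

lemma tangent_bundle_eqI:
  assumes "u \<in> tangent_bundle A" "v \<in> tangent_bundle A" "fst u = fst v" "c \<in> A" "fst u \<in> fst c" "snd u c = snd v c"
  shows "u = v"
proof -
  have "u = tangent_vector A c (fst u) (snd u c)"
    using assms by (intro tangent_bundle_eq_tangent_vector[symmetric])
  also have "\<dots> = tangent_vector A c (fst v) (snd v c)" by (simp only: assms(3,6))
  also have "\<dots> = v" using assms by (intro tangent_bundle_eq_tangent_vector) auto
  finally show ?thesis .
qed

lemma fst_tangent_bundle: "u \<in> tangent_bundle A \<Longrightarrow> fst u \<in> mcarrier A"
  by (auto simp: tangent_bundle_def)

text \<open>Coordinate changes act linearly, so one vanishing component forces all others to
  vanish.\<close>

lemma slit_iff_component:
  assumes A: "smooth_atlas A" and u: "u \<in> tangent_bundle A" "c \<in> A" "fst u \<in> fst c"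
  shows "u \<in> slit_tangent_bundle A \<longleftrightarrow> snd u c \<noteq> 0"
proof -
  have "snd u = (\<lambda>_. 0) \<longleftrightarrow> snd u c = 0"
  proof
    assume 0: "snd u c = 0"
    have "snd u d = 0" for d
    proof (cases "d \<in> A \<and> fst u \<in> fst d")
      case True
      then show ?thesis
        using tangent_bundle_component[OF u(1,2) _ u(3), of d] 0 linear_0[OF linear_chart_change(1)[OF A u(2) _ u(3)]]
        by auto
    next
      case False
      then show ?thesis by (rule tangent_bundle_outside[OF u(1)])
    qed
    then show "snd u = (\<lambda>_. 0)" by auto
  qed simp
  then show ?thesis using u(1) by (cases u) (auto simp: slit_tangent_bundle_def)
qed

lemma tangent_chart:
  fixes A :: "('m, 'e::real_normed_vector) atlas"
  assumes A: "smooth_atlas A" and c: "c \<in> A"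
  shows "inj_on (snd (tangent_chart A c)) (fst (tangent_chart A c))"
    "chart_range (tangent_chart A c) = chart_range c \<times> UNIV"
    "x \<in> chart_range c \<Longrightarrow> chart_inv (tangent_chart A c) (x, y) = tangent_vector A c (chart_inv c x) y"
proof -
  show i: "inj_on (snd (tangent_chart A c)) (fst (tangent_chart A c))"
  proof (rule inj_onI)
    fix u v assume "u \<in> fst (tangent_chart A c)" "v \<in> fst (tangent_chart A c)"
      "snd (tangent_chart A c) u = snd (tangent_chart A c) v"
    then have uv: "u \<in> tangent_bundle A" "v \<in> tangent_bundle A" "fst u \<in> fst c" "fst v \<in> fst c"
      "snd c (fst u) = snd c (fst v)" "snd u c = snd v c" by (auto simp: tangent_chart_def)
    then have "fst u = fst v" using smooth_atlasD(1)[OF A c] by (meson inj_onD)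
    then show "u = v" using uv c by (intro tangent_bundle_eqI) auto
  qed
  have *: "tangent_vector A c (chart_inv c x) y \<in> fst (tangent_chart A c)"
    "snd (tangent_chart A c) (tangent_vector A c (chart_inv c x) y) = (x, y)" if "x \<in> chart_range c" for x y
    using tangent_vector[OF A c, of "chart_inv c x" y] chart_inv_right[OF that] by (auto simp: tangent_chart_def)
  show "chart_range (tangent_chart A c) = chart_range c \<times> UNIV"
  proof (intro equalityI subsetI)
    fix z assume "z \<in> chart_range c \<times> (UNIV :: 'e set)"
    then show "z \<in> chart_range (tangent_chart A c)"
      using *[of "fst z" "snd z"] unfolding chart_range_def[of "tangent_chart A c"]
      by (metis image_eqI mem_Times_iff prod.collapse)
  next
    fix z assume "z \<in> chart_range (tangent_chart A c)"
    then obtain u where "z = snd (tangent_chart A c) u" "u \<in> fst (tangent_chart A c)"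
      unfolding chart_range_def by blast
    then show "z \<in> chart_range c \<times> UNIV" by (simp add: tangent_chart_def chart_range_def)
  qed
  show "chart_inv (tangent_chart A c) (x, y) = tangent_vector A c (chart_inv c x) y" if "x \<in> chart_range c"
    using i *[OF that, of y] unfolding chart_inv_def by (metis inv_into_f_f)
qed

lemma mcarrier_tangent_atlas: "mcarrier (tangent_atlas A) = tangent_bundle A"
proof (intro equalityI subsetI)
  fix u assume u: "u \<in> tangent_bundle A"
  then obtain c where "c \<in> A" "fst u \<in> fst c" using fst_tangent_bundle[OF u] by (auto simp: mcarrier_def)
  then show "u \<in> mcarrier (tangent_atlas A)" using u by (auto simp: mcarrier_def tangent_atlas_def tangent_chart_def)
qed (auto simp: mcarrier_def tangent_atlas_def tangent_chart_def)

text \<open>In induced charts a coordinate change is a smooth map paired with its derivative applied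
  to the fibre coordinate. Smoothness therefore passes up, and by iteration to the double tangent
  bundle.\<close>

lemma smooth_atlas_tangent_atlas:
  fixes A :: "('m, 'e::euclidean_space) atlas"
  assumes A: "smooth_atlas A" shows "smooth_atlas (tangent_atlas A)"
proof -
  have "open (snd c' ` (fst c' \<inter> fst d')) \<and> smooth_on (snd c' ` (fst c' \<inter> fst d')) (snd d' \<circ> chart_inv c')"
    if c: "c \<in> A" and d: "d \<in> A" and cd: "c' = tangent_chart A c" "d' = tangent_chart A d" for c d c' d'
  proof -
    let ?N = "snd c ` (fst c \<inter> fst d)" and ?\<psi> = "snd d \<circ> chart_inv c"
    have N: "open ?N" and \<psi>: "smooth_on ?N ?\<psi>" using smooth_atlas_transition[OF A c d] by auto
    have dom: "snd c' ` (fst c' \<inter> fst d') = ?N \<times> UNIV"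
    proof (intro equalityI subsetI)
      fix z assume "z \<in> snd c' ` (fst c' \<inter> fst d')"
      then show "z \<in> ?N \<times> UNIV" by (auto simp: cd tangent_chart_def)
    next
      fix z assume "z \<in> ?N \<times> (UNIV :: 'e set)"
      then obtain p y where p: "p \<in> fst c" "p \<in> fst d" "z = (snd c p, y)" by auto
      then have "tangent_vector A c p y \<in> fst c' \<inter> fst d'" "snd c' (tangent_vector A c p y) = z"
        using tangent_vector[OF A c p(1)] by (auto simp: cd tangent_chart_def)
      then show "z \<in> snd c' ` (fst c' \<inter> fst d')" by (metis imageI)
    qed
    have o: "open (?N \<times> (UNIV :: 'e set))" using N by (intro open_Times) auto
    have f: "smooth_on (?N \<times> (UNIV :: 'e set)) fst" and s: "smooth_on (?N \<times> (UNIV :: 'e set)) snd"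
      by (intro smooth_on_bounded_linear o bounded_linear_fst bounded_linear_snd)+
    have "smooth_on (?N \<times> UNIV) (\<lambda>z. (?\<psi> (fst z), frechet_derivative ?\<psi> (at (fst z)) (snd z)))"
      by (intro smooth_on_Pair[OF o] smooth_on_compose[OF o _ f \<psi>] smooth_on_derivative_along[OF o _ f \<psi> s]) auto
    then have "smooth_on (?N \<times> UNIV) (snd d' \<circ> chart_inv c')"
    proof (rule smooth_on_cong[OF o, rotated])
      fix z assume "z \<in> ?N \<times> (UNIV :: 'e set)"
      then obtain p y where p: "p \<in> fst c" "p \<in> fst d" "z = (snd c p, y)" by auto
      then have "chart_inv c' z = tangent_vector A c p y"
        using tangent_chart(3)[OF A c, of "snd c p" y] chart_inv_left[OF A c p(1)] by (simp add: cd chart_range_def)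
      then show "(snd d' \<circ> chart_inv c') z = (?\<psi> (fst z), frechet_derivative ?\<psi> (at (fst z)) (snd z))"
        using p d chart_inv_left[OF A c p(1)] by (simp add: cd tangent_chart_def tangent_vector_def)
    qed
    then show ?thesis using o dom by simp
  qed
  moreover have "open (chart_range c \<times> (UNIV :: 'e set))" if "c \<in> A" for c
    using smooth_atlasD(2)[OF A that] by (intro open_Times) auto
  ultimately show ?thesis
    unfolding smooth_atlas_def tangent_atlas_def using tangent_chart[OF A] by (auto simp: o_def)
qed

section \<open>Tangent maps and velocities\<close>

abbreviation rep_derivative ::
  "('m, 'e::real_normed_vector) chart \<Rightarrow> ('n, 'f::real_normed_vector) chart \<Rightarrow> ('m \<Rightarrow> 'n) \<Rightarrow> 'm \<Rightarrow> 'e \<Rightarrow> 'f" where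
  "rep_derivative c d f p \<equiv> frechet_derivative (snd d \<circ> f \<circ> chart_inv c) (at (snd c p))"

lemma rep_derivative_chart_change:
  fixes A :: "('m, 'e::euclidean_space) atlas" and B :: "('n, 'f::euclidean_space) atlas"
  assumes A: "smooth_atlas A" and B: "smooth_atlas B" and f: "smooth_map_on A W B f"
    and p: "p \<in> W" "p \<in> fst c" "p \<in> fst c'" "c \<in> A" "c' \<in> A" and q: "f p \<in> fst d" "f p \<in> fst d'" "d \<in> B" "d' \<in> B"
  shows "rep_derivative c' d f p (chart_change c c' p y) = rep_derivative c d f p y"
    and "chart_change d d' (f p) (rep_derivative c d f p y) = rep_derivative c d' f p y"
proof -
  have "p \<in> mcarrier A" "f p \<in> mcarrier B" using p q by (auto simp: mcarrier_def)
  then show "rep_derivative c' d f p (chart_change c c' p y) = rep_derivative c d f p y"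
    "chart_change d d' (f p) (rep_derivative c d f p y) = rep_derivative c d' f p y"
    using rep_derivative_compose[OF A A B smooth_map_on_id_chart[OF A] f, of p c c' d y]
      rep_derivative_compose[OF A B B f smooth_map_on_id_chart[OF B], of p c d d' y] p q
    by (simp_all add: o_def)
qed

text \<open>\<open>tangent_map\<close> picks some chart by choice; compatibility of components and
  the chain rule allow any chart \<open>c\<close> around the foot point instead.\<close>

lemma tangent_map_component:
  fixes A :: "('m, 'e::euclidean_space) atlas" and B :: "('n, 'f::euclidean_space) atlas"
  assumes A: "smooth_atlas A" and B: "smooth_atlas B" and f: "smooth_map_on A W B f"
    and u: "u \<in> tangent_bundle A" "fst u \<in> W" "c \<in> A" "fst u \<in> fst c" and d: "d \<in> B" "f (fst u) \<in> fst d"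
  shows "snd (tangent_map A B f u) d = rep_derivative c d f (fst u) (snd u c)"
proof -
  define c' where "c' = (SOME c. c \<in> A \<and> fst u \<in> fst c)"
  have c': "c' \<in> A" "fst u \<in> fst c'" using someI[of "\<lambda>c. c \<in> A \<and> fst u \<in> fst c"] u(3,4) by (auto simp: c'_def)
  have "snd (tangent_map A B f u) d = rep_derivative c' d f (fst u) (snd u c')"
    using d by (simp add: tangent_map_def c'_def[symmetric])
  also have "snd u c' = chart_change c c' (fst u) (snd u c)"
    by (rule tangent_bundle_component[OF u(1,3) c'(1) u(4) c'(2)])
  also have "rep_derivative c' d f (fst u) \<dots> = rep_derivative c d f (fst u) (snd u c)"
    by (rule rep_derivative_chart_change(1)[OF A B f u(2,4) c'(2) u(3) c'(1) d(2,2,1,1)])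
  finally show ?thesis .
qed

lemma tangent_bundleI:
  assumes "fst u \<in> mcarrier A"
    "\<And>c d. c \<in> A \<Longrightarrow> d \<in> A \<Longrightarrow> fst u \<in> fst c \<Longrightarrow> fst u \<in> fst d \<Longrightarrow> snd u d = chart_change c d (fst u) (snd u c)"
    "\<And>c. \<not> (c \<in> A \<and> fst u \<in> fst c) \<Longrightarrow> snd u c = 0"
  shows "u \<in> tangent_bundle A"
  using assms unfolding tangent_bundle_def case_prod_unfold by blast

lemma fst_tangent_map [simp]: "fst (tangent_map A B f u) = f (fst u)"
  by (simp add: tangent_map_def)

lemma tangent_map_in_tangent_bundle:
  fixes A :: "('m, 'e::euclidean_space) atlas" and B :: "('n, 'f::euclidean_space) atlas"
  assumes A: "smooth_atlas A" and B: "smooth_atlas B" and f: "smooth_map_on A W B f"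
    and u: "u \<in> tangent_bundle A" "fst u \<in> W"
  shows "tangent_map A B f u \<in> tangent_bundle B"
proof -
  obtain c where c: "c \<in> A" "fst u \<in> fst c" using fst_tangent_bundle[OF u(1)] by (auto simp: mcarrier_def)
  have H1: "snd (tangent_map A B f u) d' = chart_change d d' (f (fst u)) (snd (tangent_map A B f u) d)"
    if "d \<in> B" "d' \<in> B" "f (fst u) \<in> fst d" "f (fst u) \<in> fst d'" for d d'
    unfolding tangent_map_component[OF A B f u c that(1,3)] tangent_map_component[OF A B f u c that(2,4)]
    by (rule rep_derivative_chart_change(2)[OF A B f u(2) c(2,2,1,1) that(3,4,1,2), symmetric])
  have H2: "f (fst u) \<in> mcarrier B" by (rule smooth_map_on_image[OF A B f u(2)])
  have H3: "snd (tangent_map A B f u) d = 0" if "\<not> (d \<in> B \<and> f (fst u) \<in> fst d)" for d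
    using that by (auto simp: tangent_map_def)
  show ?thesis
    by (rule tangent_bundleI, unfold fst_tangent_map, rule H2) ((rule H1; assumption) | (rule H3; assumption))+
qed

lemma tangent_map_tangent_map:
  fixes A :: "('m, 'e::euclidean_space) atlas" and B :: "('n, 'f::euclidean_space) atlas" and C :: "('k, 'l::euclidean_space) atlas"
  assumes A: "smooth_atlas A" and B: "smooth_atlas B" and C: "smooth_atlas C"
    and f: "smooth_map_on A W B f" and g: "smooth_map_on B V C g" and sub: "f ` W \<subseteq> V"
    and u: "u \<in> tangent_bundle A" "fst u \<in> W"
  shows "tangent_map B C g (tangent_map A B f u) = tangent_map A C (g \<circ> f) u"
proof -
  have gf: "smooth_map_on A W C (g \<circ> f)" by (rule smooth_map_on_compose[OF A B C f g sub])
  have fu: "tangent_map A B f u \<in> tangent_bundle B" by (rule tangent_map_in_tangent_bundle[OF A B f u])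
  have fV: "f (fst u) \<in> V" using sub u(2) by auto
  obtain c where c: "c \<in> A" "fst u \<in> fst c" using fst_tangent_bundle[OF u(1)] by (auto simp: mcarrier_def)
  obtain d where d: "d \<in> B" "f (fst u) \<in> fst d" using smooth_map_on_image[OF A B f u(2)] by (auto simp: mcarrier_def)
  obtain e where e: "e \<in> C" "g (f (fst u)) \<in> fst e" using smooth_map_on_image[OF B C g fV] by (auto simp: mcarrier_def)
  show ?thesis
  proof (rule tangent_bundle_eqI[of _ C _ e])
    show "tangent_map B C g (tangent_map A B f u) \<in> tangent_bundle C"
      using fV by (intro tangent_map_in_tangent_bundle[OF B C g fu]) simp
    show "tangent_map A C (g \<circ> f) u \<in> tangent_bundle C" by (rule tangent_map_in_tangent_bundle[OF A C gf u])
    have "snd (tangent_map B C g (tangent_map A B f u)) e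
        = rep_derivative d e g (f (fst u)) (rep_derivative c d f (fst u) (snd u c))"
      using tangent_map_component[OF B C g fu, of d e] tangent_map_component[OF A B f u c d] fV d e by simp
    also have "\<dots> = rep_derivative c e (\<lambda>p. g (f p)) (fst u) (snd u c)"
      by (rule rep_derivative_compose[OF A B C f g u(2) c(2,1) fV d(2,1) e(2,1), symmetric])
    also have "\<dots> = snd (tangent_map A C (g \<circ> f) u) e"
      using tangent_map_component[OF A C gf u c, of e] e by (simp add: o_def)
    finally show "snd (tangent_map B C g (tangent_map A B f u)) e = snd (tangent_map A C (g \<circ> f) u) e" .
  qed (use e in auto)
qed

lemma tangent_map_id:
  fixes A :: "('m, 'e::euclidean_space) atlas"
  assumes A: "smooth_atlas A" and u: "u \<in> tangent_bundle A" and f: "\<And>p. p \<in> mcarrier A \<Longrightarrow> f p = p"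
  shows "tangent_map A A f u = u"
proof -
  note p = fst_tangent_bundle[OF u]
  have *: "mcarrier A \<inter> fst c \<inter> f -` fst d = fst c \<inter> fst d" if "c \<in> A" for c d
  proof -
    have "p \<in> mcarrier A" "f p = p" if "p \<in> fst c" for p
      using that \<open>c \<in> A\<close> f[of p] by (auto simp: mcarrier_def)
    then show ?thesis by auto
  qed
  have fc: "f p = p" if "p \<in> fst c" "c \<in> A" for p c using that f[of p] by (auto simp: mcarrier_def)
  have "smooth_on (snd c ` (fst c \<inter> fst d)) (snd d \<circ> f \<circ> chart_inv c)" if "c \<in> A" "d \<in> A" for c d
    by (rule smooth_on_cong[OF smooth_atlas_transition(1)[OF A that] _ smooth_atlas_transition(2)[OF A that]])
      (use that fc[OF _ that(1)] in \<open>auto simp: chart_inv_left[OF A]\<close>)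
  then have fs: "smooth_map_on A (mcarrier A) A f"
    unfolding smooth_map_on_iff[OF A A] using smooth_atlas_transition[OF A] f by (auto simp: *)
  obtain c where c: "c \<in> A" "fst u \<in> fst c" using p by (auto simp: mcarrier_def)
  have "rep_derivative c c f (fst u) y = chart_change c c (fst u) y" for y
    using smooth_atlasD(2)[OF A c(1)] c f
    by (subst frechet_derivative_cong_open[of "chart_range c" _ _ "snd c \<circ> chart_inv c"])
      (auto simp: chart_range_def chart_inv_left[OF A] fc)
  then have "snd (tangent_map A A f u) c = snd u c"
    using tangent_map_component[OF A A fs u p c c(1)] c f[OF p] chart_change_same[OF A c] by simp
  then show ?thesis
    using tangent_map_in_tangent_bundle[OF A A fs u p] u c f[OF p] by (intro tangent_bundle_eqI[of _ A _ c]) auto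
qed

lemma smooth_map_on_tangent_map:
  fixes A :: "('m, 'e::euclidean_space) atlas" and B :: "('n, 'f::euclidean_space) atlas"
  assumes A: "smooth_atlas A" and B: "smooth_atlas B" and f: "smooth_map_on A (mcarrier A) B f"
  shows "smooth_map_on (tangent_atlas A) (tangent_bundle A) (tangent_atlas B) (tangent_map A B f)"
proof -
  have "open (snd c' ` (tangent_bundle A \<inter> fst c' \<inter> tangent_map A B f -` fst d')) \<and>
      smooth_on (snd c' ` (tangent_bundle A \<inter> fst c' \<inter> tangent_map A B f -` fst d')) (snd d' \<circ> tangent_map A B f \<circ> chart_inv c')"
    if c: "c \<in> A" and d: "d \<in> B" and cd: "c' = tangent_chart A c" "d' = tangent_chart B d" for c d c' d'
  proof -
    let ?N = "snd c ` (mcarrier A \<inter> fst c \<inter> f -` fst d)" and ?F = "snd d \<circ> f \<circ> chart_inv c"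
    have N: "open ?N" and F: "smooth_on ?N ?F" using f c d unfolding smooth_map_on_iff[OF A B] by auto
    have tm: "tangent_map A B f (tangent_vector A c p y) \<in> tangent_bundle B"
      "snd (tangent_map A B f (tangent_vector A c p y)) d = rep_derivative c d f p y"
      if "p \<in> fst c" "f p \<in> fst d" for p y
    proof -
      have "p \<in> mcarrier A" using that c by (auto simp: mcarrier_def)
      note t = tangent_vector[OF A c that(1), of y]
      show "tangent_map A B f (tangent_vector A c p y) \<in> tangent_bundle B"
        by (rule tangent_map_in_tangent_bundle[OF A B f t(1)]) (simp add: t \<open>p \<in> mcarrier A\<close>)
      show "snd (tangent_map A B f (tangent_vector A c p y)) d = rep_derivative c d f p y"
        using tangent_map_component[OF A B f t(1), of c d] by (simp add: t \<open>p \<in> mcarrier A\<close> that c d)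
    qed
    have dom: "snd c' ` (tangent_bundle A \<inter> fst c' \<inter> tangent_map A B f -` fst d') = ?N \<times> UNIV"
    proof (intro equalityI subsetI)
      fix z assume "z \<in> snd c' ` (tangent_bundle A \<inter> fst c' \<inter> tangent_map A B f -` fst d')"
      then show "z \<in> ?N \<times> UNIV" by (auto simp: cd tangent_chart_def dest!: fst_tangent_bundle[of _ A])
    next
      fix z assume "z \<in> ?N \<times> (UNIV :: 'e set)"
      then obtain p y where p: "p \<in> fst c" "f p \<in> fst d" "z = (snd c p, y)" by auto
      then have "tangent_vector A c p y \<in> tangent_bundle A \<inter> fst c' \<inter> tangent_map A B f -` fst d'" "snd c' (tangent_vector A c p y) = z"
        using tangent_vector[OF A c p(1)] tm[OF p(1,2)] by (auto simp: cd tangent_chart_def)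
      then show "z \<in> snd c' ` (tangent_bundle A \<inter> fst c' \<inter> tangent_map A B f -` fst d')" by (metis imageI)
    qed
    have o: "open (?N \<times> (UNIV :: 'e set))" using N by (intro open_Times) auto
    have fs: "smooth_on (?N \<times> (UNIV :: 'e set)) fst" and s: "smooth_on (?N \<times> (UNIV :: 'e set)) snd"
      by (intro smooth_on_bounded_linear o bounded_linear_fst bounded_linear_snd)+
    have "smooth_on (?N \<times> UNIV) (\<lambda>z. (?F (fst z), frechet_derivative ?F (at (fst z)) (snd z)))"
      by (intro smooth_on_Pair[OF o] smooth_on_compose[OF o _ fs F] smooth_on_derivative_along[OF o _ fs F s]) auto
    then have "smooth_on (?N \<times> UNIV) (snd d' \<circ> tangent_map A B f \<circ> chart_inv c')"
    proof (rule smooth_on_cong[OF o, rotated])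
      fix z assume "z \<in> ?N \<times> (UNIV :: 'e set)"
      then obtain p y where p: "p \<in> fst c" "f p \<in> fst d" "z = (snd c p, y)" by auto
      then have "chart_inv c' z = tangent_vector A c p y"
        using tangent_chart(3)[OF A c, of "snd c p" y] chart_inv_left[OF A c p(1)] by (simp add: cd chart_range_def)
      then show "(snd d' \<circ> tangent_map A B f \<circ> chart_inv c') z = (?F (fst z), frechet_derivative ?F (at (fst z)) (snd z))"
        using p tm(2)[OF p(1,2)] tangent_vector(2)[OF A c p(1)] chart_inv_left[OF A c p(1)] by (simp add: cd tangent_chart_def)
    qed
    then show ?thesis using o dom by simp
  qed
  moreover have "tangent_map A B f ` tangent_bundle A \<subseteq> tangent_bundle B"
    using tangent_map_in_tangent_bundle[OF A B f] fst_tangent_bundle by blast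
  ultimately show ?thesis
    unfolding smooth_map_on_iff[OF smooth_atlas_tangent_atlas[OF A] smooth_atlas_tangent_atlas[OF B]]
    by (simp add: mcarrier_tangent_atlas) (simp add: tangent_atlas_def)
qed

section \<open>Curves, their velocities and images of geodesics\<close>

lemma smooth_atlas_euclidean: "smooth_atlas (euclidean_atlas :: ('e::real_normed_vector, 'e) atlas)"
  by (auto simp: smooth_atlas_def euclidean_atlas_def chart_range_def chart_inv_def o_def smooth_on_id inv_into_def intro: smooth_on_cong[OF _ _ smooth_on_id])

lemma smooth_map_on_euclidean_iff:
  fixes f :: "'e::real_normed_vector \<Rightarrow> 'n" and B :: "('n, 'f::real_normed_vector) atlas"
  assumes B: "smooth_atlas B"
  shows "smooth_map_on euclidean_atlas W B f \<longleftrightarrow> f ` W \<subseteq> mcarrier B \<and>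
    (\<forall>d\<in>B. open (W \<inter> f -` fst d) \<and> smooth_on (W \<inter> f -` fst d) (snd d \<circ> f))"
proof -
  have "chart_inv (UNIV, id) = (\<lambda>x::'e. x)" by (auto simp: chart_inv_def inv_into_def)
  then show ?thesis unfolding smooth_map_on_iff[OF smooth_atlas_euclidean B]
    by (simp add: euclidean_atlas_def mcarrier_def o_def)
qed

lemma smooth_map_on_euclidean_codomain_iff:
  fixes f :: "'m \<Rightarrow> 'f::real_normed_vector" and A :: "('m, 'e::real_normed_vector) atlas"
  assumes A: "smooth_atlas A"
  shows "smooth_map_on A W euclidean_atlas f \<longleftrightarrow> W \<subseteq> mcarrier A \<and>
    (\<forall>c\<in>A. open (snd c ` (W \<inter> fst c)) \<and> smooth_on (snd c ` (W \<inter> fst c)) (f \<circ> chart_inv c))"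
  unfolding smooth_map_on_iff[OF A smooth_atlas_euclidean] by (simp add: euclidean_atlas_def mcarrier_def)

lemma smooth_curve_iff:
  assumes A: "smooth_atlas A"
  shows "smooth_curve A I \<gamma> \<longleftrightarrow> is_interval I \<and> open I \<and> I \<noteq> {} \<and> \<gamma> ` I \<subseteq> mcarrier A \<and>
    (\<forall>c\<in>A. open (I \<inter> \<gamma> -` fst c) \<and> smooth_on (I \<inter> \<gamma> -` fst c) (snd c \<circ> \<gamma>))"
  unfolding smooth_curve_def smooth_map_on_euclidean_iff[OF A] by auto

lemma has_vector_derivative_velocity:
  assumes A: "smooth_atlas A" and \<gamma>: "smooth_curve A I \<gamma>" and t: "t \<in> I" "c \<in> A" "\<gamma> t \<in> fst c"
  shows "(snd c \<circ> \<gamma> has_vector_derivative snd (velocity A \<gamma> t) c) (at t)"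
proof -
  have "smooth_on (I \<inter> \<gamma> -` fst c) (snd c \<circ> \<gamma>)" using \<gamma> t unfolding smooth_curve_iff[OF A] by auto
  from smooth_on_has_derivative[OF this, of t]
  have "snd c \<circ> \<gamma> differentiable (at t)" using t by (auto simp: differentiable_def)
  then have "(snd c \<circ> \<gamma> has_vector_derivative vector_derivative (snd c \<circ> \<gamma>) (at t)) (at t)"
    by (simp add: vector_derivative_works)
  then show ?thesis using t by (simp add: velocity_def)
qed

lemma fst_velocity [simp]: "fst (velocity A \<gamma> t) = \<gamma> t"
  by (simp add: velocity_def)

lemma velocity_eqI:
  assumes "c \<in> A" "\<gamma> t \<in> fst c" "(snd c \<circ> \<gamma> has_vector_derivative y) (at t)"
  shows "snd (velocity A \<gamma> t) c = y"
  using assms vector_derivative_at by (simp add: velocity_def) blast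

lemma velocity_compose_component:
  assumes A: "smooth_atlas A" and B: "smooth_atlas B" and f: "smooth_map_on A W B f"
    and \<gamma>: "smooth_curve A I \<gamma>" "\<gamma> t \<in> W" and t: "t \<in> I" and c: "c \<in> A" "\<gamma> t \<in> fst c" and d: "d \<in> B" "f (\<gamma> t) \<in> fst d"
  shows "snd (velocity B (f \<circ> \<gamma>) t) d = rep_derivative c d f (\<gamma> t) (snd (velocity A \<gamma> t) c)"
proof (rule velocity_eqI)
  let ?F = "snd d \<circ> f \<circ> chart_inv c"
  have o: "open (I \<inter> \<gamma> -` fst c)" using \<gamma> c unfolding smooth_curve_iff[OF A] by auto
  have "(?F has_derivative rep_derivative c d f (\<gamma> t)) (at ((snd c \<circ> \<gamma>) t))"
    using smooth_on_has_derivative_rep[OF A B f c(1) d(1) \<gamma>(2) c(2) d(2)] by simp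
  from has_derivative_compose[OF has_vector_derivative_velocity[OF A \<gamma>(1) t c, unfolded has_vector_derivative_def] this]
  have "((\<lambda>s. ?F ((snd c \<circ> \<gamma>) s)) has_vector_derivative rep_derivative c d f (\<gamma> t) (snd (velocity A \<gamma> t) c)) (at t)"
    by (simp only: has_vector_derivative_def linear_scale[OF has_derivative_linear[OF \<open>(?F has_derivative _) _\<close>]])
  then show "(snd d \<circ> (f \<circ> \<gamma>) has_vector_derivative rep_derivative c d f (\<gamma> t) (snd (velocity A \<gamma> t) c)) (at t)"
    by (rule has_vector_derivative_transform_within_open[OF _ o]) (use t c in \<open>auto simp: chart_inv_left[OF A]\<close>)
qed (use d in auto)

lemma velocity_in_tangent_bundle:
  assumes A: "smooth_atlas A" and \<gamma>: "smooth_curve A I \<gamma>" and t: "t \<in> I"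
  shows "velocity A \<gamma> t \<in> tangent_bundle A"
proof -
  have p: "\<gamma> t \<in> mcarrier A" using \<gamma> t unfolding smooth_curve_iff[OF A] by auto
  have H1: "snd (velocity A \<gamma> t) d = chart_change c d (\<gamma> t) (snd (velocity A \<gamma> t) c)"
    if "c \<in> A" "d \<in> A" "\<gamma> t \<in> fst c" "\<gamma> t \<in> fst d" for c d
    using velocity_compose_component[OF A A smooth_map_on_id_chart[OF A] \<gamma> p t that(1,3,2,4)] by (simp add: o_def)
  have H2: "snd (velocity A \<gamma> t) c = 0" if "\<not> (c \<in> A \<and> \<gamma> t \<in> fst c)" for c
    using that by (auto simp: velocity_def)
  show ?thesis
    by (rule tangent_bundleI, unfold fst_velocity, rule p) ((rule H1; assumption) | (rule H2; assumption))+
qed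

lemma velocity_compose:
  fixes A :: "('m, 'e::euclidean_space) atlas" and B :: "('n, 'f::euclidean_space) atlas"
  assumes A: "smooth_atlas A" and B: "smooth_atlas B" and f: "smooth_map_on A W B f"
    and \<gamma>: "smooth_curve A I \<gamma>" "\<gamma> ` I \<subseteq> W" and t: "t \<in> I"
  shows "velocity B (f \<circ> \<gamma>) t = tangent_map A B f (velocity A \<gamma> t)"
proof -
  have W: "\<gamma> t \<in> W" using \<gamma> t by auto
  have p: "\<gamma> t \<in> mcarrier A" using \<gamma> t unfolding smooth_curve_iff[OF A] by auto
  obtain c where c: "c \<in> A" "\<gamma> t \<in> fst c" using p by (auto simp: mcarrier_def)
  have "snd (velocity B (f \<circ> \<gamma>) t) d = snd (tangent_map A B f (velocity A \<gamma> t)) d" for d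
  proof (cases "d \<in> B \<and> f (\<gamma> t) \<in> fst d")
    case True
    then show ?thesis
      using velocity_compose_component[OF A B f \<gamma>(1) W t c, of d]
        tangent_map_component[OF A B f velocity_in_tangent_bundle[OF A \<gamma>(1) t], of c d] W c by simp
  next
    case False
    then show ?thesis by (auto simp: velocity_def tangent_map_def)
  qed
  then show ?thesis by (intro prod_eqI ext) simp_all
qed

lemma smooth_curve_compose:
  fixes A :: "('m, 'e::euclidean_space) atlas"
  assumes "smooth_atlas A" "smooth_atlas B" "smooth_map_on A W B f" "smooth_curve A I \<gamma>" "\<gamma> ` I \<subseteq> W"
  shows "smooth_curve B I (f \<circ> \<gamma>)"
  using assms smooth_map_on_compose[OF smooth_atlas_euclidean assms(1,2) _ assms(3,5)] by (simp add: smooth_curve_def)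

lemma velocity_cong:
  fixes A :: "('m, 'e::real_normed_vector) atlas"
  assumes "open I" "t \<in> I" "\<And>s. s \<in> I \<Longrightarrow> \<gamma> s = \<delta> s"
  shows "velocity A \<gamma> t = velocity A \<delta> t"
proof -
  have "(snd c \<circ> \<gamma> has_vector_derivative y) (at t) \<longleftrightarrow> (snd c \<circ> \<delta> has_vector_derivative y) (at t)"
    for c :: "('m, 'e) chart" and y
    using has_vector_derivative_transform_within_open[of "snd c \<circ> \<gamma>" y t I "snd c \<circ> \<delta>"]
      has_vector_derivative_transform_within_open[of "snd c \<circ> \<delta>" y t I "snd c \<circ> \<gamma>"] assms by auto
  then have "vector_derivative (snd c \<circ> \<gamma>) (at t) = vector_derivative (snd c \<circ> \<delta>) (at t)"
    for c :: "('m, 'e) chart"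
    unfolding vector_derivative_def by simp
  then show ?thesis using assms(2,3) by (intro prod_eqI ext) (simp_all add: velocity_def)
qed

lemma smooth_curve_velocity:
  fixes A :: "('m, 'e::euclidean_space) atlas"
  assumes A: "smooth_atlas A" and \<gamma>: "smooth_curve A I \<gamma>"
  shows "smooth_curve (tangent_atlas A) I (velocity A \<gamma>)"
proof -
  have "open (I \<inter> velocity A \<gamma> -` fst (tangent_chart A c)) \<and>
      smooth_on (I \<inter> velocity A \<gamma> -` fst (tangent_chart A c)) (snd (tangent_chart A c) \<circ> velocity A \<gamma>)" if c: "c \<in> A" for c
  proof -
    let ?N = "I \<inter> \<gamma> -` fst c"
    have N: "open ?N" "smooth_on ?N (snd c \<circ> \<gamma>)" using \<gamma> c unfolding smooth_curve_iff[OF A] by auto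
    have eq: "I \<inter> velocity A \<gamma> -` fst (tangent_chart A c) = ?N"
      using velocity_in_tangent_bundle[OF A \<gamma>] by (auto simp: tangent_chart_def)
    have "smooth_on ?N (\<lambda>t. ((snd c \<circ> \<gamma>) t, frechet_derivative (snd c \<circ> \<gamma>) (at t) 1))"
      by (intro smooth_on_Pair N smooth_on_derivative)
    then have "smooth_on ?N (snd (tangent_chart A c) \<circ> velocity A \<gamma>)"
    proof (rule smooth_on_cong[OF N(1), rotated])
      fix t assume "t \<in> ?N"
      then have t: "t \<in> I" "\<gamma> t \<in> fst c" by auto
      from frechet_derivative_at[OF has_vector_derivative_velocity[OF A \<gamma> t(1) c t(2), unfolded has_vector_derivative_def]]
      have "frechet_derivative (snd c \<circ> \<gamma>) (at t) 1 = snd (velocity A \<gamma> t) c" by (metis scaleR_one)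
      then show "(snd (tangent_chart A c) \<circ> velocity A \<gamma>) t = ((snd c \<circ> \<gamma>) t, frechet_derivative (snd c \<circ> \<gamma>) (at t) 1)"
        by (simp add: tangent_chart_def)
    qed
    then show ?thesis using N eq by simp
  qed
  moreover have "is_interval I" "open I" "I \<noteq> {}" using \<gamma> unfolding smooth_curve_iff[OF A] by auto
  moreover have "velocity A \<gamma> ` I \<subseteq> tangent_bundle A" using velocity_in_tangent_bundle[OF A \<gamma>] by auto
  ultimately show ?thesis
    unfolding smooth_curve_iff[OF smooth_atlas_tangent_atlas[OF A]]
    by (simp add: mcarrier_tangent_atlas) (simp add: tangent_atlas_def)
qed

text \<open>The left inverse \<open>h\<close> recovers \<open>u\<close> from its image by
  functoriality; were the image zero, linearity would make \<open>u\<close> zero as well.\<close>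

lemma tangent_map_slit:
  fixes A :: "('m, 'e::euclidean_space) atlas"
  assumes A: "smooth_atlas A" and f: "smooth_map_on A (mcarrier A) A f" and h: "smooth_map_on A (mcarrier A) A h"
    and hf: "\<And>p. p \<in> mcarrier A \<Longrightarrow> h (f p) = p" and u: "u \<in> slit_tangent_bundle A"
  shows "tangent_map A A f u \<in> slit_tangent_bundle A"
proof (rule ccontr)
  assume n: "tangent_map A A f u \<notin> slit_tangent_bundle A"
  have ub: "u \<in> tangent_bundle A" using u by (auto simp: slit_tangent_bundle_def)
  note p = fst_tangent_bundle[OF ub]
  have fu: "tangent_map A A f u \<in> tangent_bundle A" by (rule tangent_map_in_tangent_bundle[OF A A f ub p])
  then have 0: "snd (tangent_map A A f u) = (\<lambda>_. 0)" using n by (auto simp: slit_tangent_bundle_def case_prod_unfold)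
  have fim: "f ` mcarrier A \<subseteq> mcarrier A" using smooth_map_on_image[OF A A f] by auto
  have "u = tangent_map A A h (tangent_map A A f u)"
    using tangent_map_tangent_map[OF A A A f h fim ub p] tangent_map_id[OF A ub, of "h \<circ> f"] hf by simp
  obtain c where c: "c \<in> A" "fst u \<in> fst c" using p by (auto simp: mcarrier_def)
  have fp: "f (fst u) \<in> mcarrier A" using fim p by auto
  then obtain d where d: "d \<in> A" "f (fst u) \<in> fst d" by (auto simp: mcarrier_def)
  have "snd u c = snd (tangent_map A A h (tangent_map A A f u)) c"
    using \<open>u = _\<close> by simp
  also have "\<dots> = rep_derivative d c h (f (fst u)) 0"
    using tangent_map_component[OF A A h fu, of d c] fp d c hf[OF p] 0 by simp
  also have "\<dots> = 0"
    using smooth_on_has_derivative_rep[OF A A h d(1) c(1) fp d(2)] c hf[OF p] has_derivative_linear linear_0 by metis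
  finally show False using slit_iff_component[OF A ub c] u by simp
qed

text \<open>The velocity of the velocity is transported by the second tangent map of
  \<open>f\<close>, exactly as \<open>S\<close> transforms. The left inverse \<open>h\<close> keeps
  velocities nonzero.\<close>

lemma spray_geodesic_image:
  fixes A :: "('m, 'e::euclidean_space) atlas"
  assumes A: "smooth_atlas A" and f: "smooth_map_on A (mcarrier A) A f" and h: "smooth_map_on A (mcarrier A) A h"
    and hf: "\<And>p. p \<in> mcarrier A \<Longrightarrow> h (f p) = p"
    and S: "\<And>u. u \<in> slit_tangent_bundle A \<Longrightarrow> S (tangent_map A A f u) =
      tangent_map (tangent_atlas A) (tangent_atlas A) (tangent_map A A f) (S u)"
    and \<gamma>: "spray_geodesic A S I \<gamma>"
  shows "spray_geodesic A S I (f \<circ> \<gamma>)"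
proof -
  have sm: "smooth_curve A I \<gamma>" and slit: "\<And>t. t \<in> I \<Longrightarrow> velocity A \<gamma> t \<in> slit_tangent_bundle A"
    and geo: "\<And>t. t \<in> I \<Longrightarrow> velocity (tangent_atlas A) (velocity A \<gamma>) t = S (velocity A \<gamma> t)"
    using \<gamma> by (auto simp: spray_geodesic_def regular_curve_def)
  have I: "open I" and im: "\<gamma> ` I \<subseteq> mcarrier A" using sm unfolding smooth_curve_iff[OF A] by auto
  note vel = velocity_compose[OF A A f sm im]
  note TA = smooth_atlas_tangent_atlas[OF A]
  have "velocity (tangent_atlas A) (velocity A (f \<circ> \<gamma>)) t = S (velocity A (f \<circ> \<gamma>) t)" if t: "t \<in> I" for t
  proof -
    have "velocity (tangent_atlas A) (velocity A (f \<circ> \<gamma>)) t = velocity (tangent_atlas A) (tangent_map A A f \<circ> velocity A \<gamma>) t"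
      by (rule velocity_cong[OF I t]) (simp add: vel)
    also have "\<dots> = tangent_map (tangent_atlas A) (tangent_atlas A) (tangent_map A A f) (velocity (tangent_atlas A) (velocity A \<gamma>) t)"
      by (rule velocity_compose[OF TA TA smooth_map_on_tangent_map[OF A A f] smooth_curve_velocity[OF A sm] _ t])
        (use velocity_in_tangent_bundle[OF A sm] in auto)
    also have "\<dots> = S (tangent_map A A f (velocity A \<gamma> t))" by (simp add: geo[OF t] S[OF slit[OF t]])
    finally show ?thesis by (simp add: vel[OF t])
  qed
  moreover have "velocity A (f \<circ> \<gamma>) t \<in> slit_tangent_bundle A" if t: "t \<in> I" for t
    unfolding vel[OF t] by (rule tangent_map_slit[OF A f h hf slit[OF t]])
  ultimately show ?thesis
    using smooth_curve_compose[OF A A f sm im] by (simp add: spray_geodesic_def regular_curve_def)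
qed

section \<open>Products and one-parameter subgroups\<close>

lemma product_atlas_chart:
  assumes B: "smooth_atlas B" and C: "smooth_atlas C" and b: "b \<in> B" and c: "c \<in> C"
  shows "inj_on (map_prod (snd b) (snd c)) (fst b \<times> fst c)"
    "chart_range (fst b \<times> fst c, map_prod (snd b) (snd c)) = chart_range b \<times> chart_range c"
    "z \<in> chart_range b \<times> chart_range c \<Longrightarrow>
      chart_inv (fst b \<times> fst c, map_prod (snd b) (snd c)) z = (chart_inv b (fst z), chart_inv c (snd z))"
proof -
  show i: "inj_on (map_prod (snd b) (snd c)) (fst b \<times> fst c)"
    using smooth_atlasD(1)[OF B b] smooth_atlasD(1)[OF C c] by (rule map_prod_inj_on)
  show "chart_range (fst b \<times> fst c, map_prod (snd b) (snd c)) = chart_range b \<times> chart_range c"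
    by (auto simp: chart_range_def)
  assume z: "z \<in> chart_range b \<times> chart_range c"
  then have "map_prod (snd b) (snd c) (chart_inv b (fst z), chart_inv c (snd z)) = z"
    "(chart_inv b (fst z), chart_inv c (snd z)) \<in> fst b \<times> fst c"
    using chart_inv_right[of "fst z" b] chart_inv_right[of "snd z" c] by (auto simp: mem_Times_iff prod_eq_iff)
  then show "chart_inv (fst b \<times> fst c, map_prod (snd b) (snd c)) z = (chart_inv b (fst z), chart_inv c (snd z))"
    unfolding chart_inv_def[of "(fst b \<times> fst c, map_prod (snd b) (snd c))"] using i by (metis fst_conv inv_into_f_f snd_conv)
qed

lemma mcarrier_product_atlas: "mcarrier (product_atlas B C) = mcarrier B \<times> mcarrier C"
  by (auto simp: mcarrier_def product_atlas_def)

lemma smooth_atlas_product: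
  fixes B :: "('m, 'e::euclidean_space) atlas" and C :: "('n, 'f::euclidean_space) atlas"
  assumes B: "smooth_atlas B" and C: "smooth_atlas C"
  shows "smooth_atlas (product_atlas B C)"
proof -
  have 1: "inj_on (snd k) (fst k) \<and> open (chart_range k)" if k: "k \<in> product_atlas B C" for k
  proof -
    obtain b c where bc: "b \<in> B" "c \<in> C" "k = (fst b \<times> fst c, map_prod (snd b) (snd c))"
      using k by (auto simp: product_atlas_def)
    then show ?thesis
      using product_atlas_chart[OF B C bc(1,2)] smooth_atlasD(2)[OF B bc(1)] smooth_atlasD(2)[OF C bc(2)]
      by (simp add: open_Times)
  qed
  have 2: "open (snd k ` (fst k \<inter> fst l)) \<and> smooth_on (snd k ` (fst k \<inter> fst l)) (snd l \<circ> chart_inv k)"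
    if k: "k \<in> product_atlas B C" and l: "l \<in> product_atlas B C" for k l
  proof -
    obtain b c where bc: "b \<in> B" "c \<in> C" "k = (fst b \<times> fst c, map_prod (snd b) (snd c))"
      using k by (auto simp: product_atlas_def)
    obtain b' c' where bc': "b' \<in> B" "c' \<in> C" "l = (fst b' \<times> fst c', map_prod (snd b') (snd c'))"
      using l by (auto simp: product_atlas_def)
    let ?M = "snd b ` (fst b \<inter> fst b')" and ?N = "snd c ` (fst c \<inter> fst c')"
    have M: "open ?M" "smooth_on ?M (snd b' \<circ> chart_inv b)" and N: "open ?N" "smooth_on ?N (snd c' \<circ> chart_inv c)"
      using smooth_atlas_transition[OF B bc(1) bc'(1)] smooth_atlas_transition[OF C bc(2) bc'(2)] by auto
    have dom: "snd k ` (fst k \<inter> fst l) = ?M \<times> ?N"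
      unfolding bc bc' by (auto simp: image_iff)
    have o: "open (?M \<times> ?N)" using M N by (intro open_Times) auto
    have f: "smooth_on (?M \<times> ?N) fst" and s: "smooth_on (?M \<times> ?N) snd"
      by (intro smooth_on_bounded_linear o bounded_linear_fst bounded_linear_snd)+
    have "smooth_on (?M \<times> ?N) (\<lambda>z. ((snd b' \<circ> chart_inv b) (fst z), (snd c' \<circ> chart_inv c) (snd z)))"
      by (intro smooth_on_Pair[OF o] smooth_on_compose[OF o _ f M(2)] smooth_on_compose[OF o _ s N(2)]) auto
    then have "smooth_on (?M \<times> ?N) (snd l \<circ> chart_inv k)"
    proof (rule smooth_on_cong[OF o, rotated])
      fix z assume "z \<in> ?M \<times> ?N"
      then have "z \<in> chart_range b \<times> chart_range c" by (auto simp: chart_range_def)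
      then show "(snd l \<circ> chart_inv k) z = ((snd b' \<circ> chart_inv b) (fst z), (snd c' \<circ> chart_inv c) (snd z))"
        using product_atlas_chart(3)[OF B C bc(1,2)] by (simp add: bc bc')
    qed
    then show ?thesis using o dom by simp
  qed
  show ?thesis unfolding smooth_atlas_def using 1 2 by blast
qed

lemma smooth_map_on_Pair:
  fixes A :: "('k, 'l::euclidean_space) atlas" and B :: "('m, 'e::euclidean_space) atlas" and C :: "('n, 'f::euclidean_space) atlas"
  assumes A: "smooth_atlas A" and B: "smooth_atlas B" and C: "smooth_atlas C"
    and f: "smooth_map_on A W B f" and g: "smooth_map_on A W C g"
  shows "smooth_map_on A W (product_atlas B C) (\<lambda>p. (f p, g p))"
proof -
  have "open (snd a ` (W \<inter> fst a \<inter> (\<lambda>p. (f p, g p)) -` fst k)) \<and>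
      smooth_on (snd a ` (W \<inter> fst a \<inter> (\<lambda>p. (f p, g p)) -` fst k)) (snd k \<circ> (\<lambda>p. (f p, g p)) \<circ> chart_inv a)"
    if a: "a \<in> A" and k: "k \<in> product_atlas B C" for a k
  proof -
    obtain b c where bc: "b \<in> B" "c \<in> C" "k = (fst b \<times> fst c, map_prod (snd b) (snd c))"
      using k by (auto simp: product_atlas_def)
    let ?M = "snd a ` (W \<inter> fst a \<inter> f -` fst b)" and ?N = "snd a ` (W \<inter> fst a \<inter> g -` fst c)"
    have M: "open ?M" "smooth_on ?M (snd b \<circ> f \<circ> chart_inv a)" and N: "open ?N" "smooth_on ?N (snd c \<circ> g \<circ> chart_inv a)"
      using f g a bc unfolding smooth_map_on_iff[OF A B] smooth_map_on_iff[OF A C] by auto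
    have dom: "snd a ` (W \<inter> fst a \<inter> (\<lambda>p. (f p, g p)) -` fst k) = ?M \<inter> ?N"
      using smooth_atlasD(1)[OF A a]
      by (subst inj_on_image_Int[symmetric, where C="fst a"]) (auto simp: bc intro!: arg_cong[where f="image (snd a)"])
    have o: "open (?M \<inter> ?N)" using M N by auto
    have "smooth_on (?M \<inter> ?N) (\<lambda>z. ((snd b \<circ> f \<circ> chart_inv a) z, (snd c \<circ> g \<circ> chart_inv a) z))"
      by (intro smooth_on_Pair[OF o] smooth_on_subset[OF M(2)] smooth_on_subset[OF N(2)]) auto
    then show ?thesis using o dom by (simp add: bc o_def)
  qed
  then show ?thesis
    using f g unfolding smooth_map_on_iff[OF A B] smooth_map_on_iff[OF A C] smooth_map_on_iff[OF A smooth_atlas_product[OF B C]]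
    by (auto simp: mcarrier_product_atlas)
qed

lemma smooth_map_on_const:
  fixes A :: "('k, 'l::real_normed_vector) atlas"
  assumes A: "smooth_atlas A" and B: "smooth_atlas B" and q: "q \<in> mcarrier B"
  shows "smooth_map_on A (mcarrier A) B (\<lambda>_. q)"
proof -
  have "open (snd a ` (mcarrier A \<inter> fst a \<inter> (\<lambda>_. q) -` fst b)) \<and>
      smooth_on (snd a ` (mcarrier A \<inter> fst a \<inter> (\<lambda>_. q) -` fst b)) (snd b \<circ> (\<lambda>_. q) \<circ> chart_inv a)"
    if a: "a \<in> A" and b: "b \<in> B" for a b
  proof -
    have "open (snd a ` (mcarrier A \<inter> fst a \<inter> (\<lambda>_. q) -` fst b))"
      using open_chart_image[OF A a openin_mcarrier[OF A]] by (cases "q \<in> fst b") auto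
    then show ?thesis using smooth_on_const by (auto simp: o_def)
  qed
  then show ?thesis unfolding smooth_map_on_iff[OF A B] using q by auto
qed

lemma smooth_map_on_comp_Pair:
  fixes A :: "('k, 'l::euclidean_space) atlas" and B :: "('m, 'e::euclidean_space) atlas"
    and C :: "('n, 'f::euclidean_space) atlas" and D :: "('o, 'd::euclidean_space) atlas"
  assumes A: "smooth_atlas A" and B: "smooth_atlas B" and C: "smooth_atlas C" and D: "smooth_atlas D"
    and f: "smooth_map_on A W B f" and g: "smooth_map_on A W C g"
    and h: "smooth_map_on (product_atlas B C) (mcarrier B \<times> mcarrier C) D (\<lambda>(x, y). h x y)"
  shows "smooth_map_on A W D (\<lambda>p. h (f p) (g p))"
proof -
  have "(\<lambda>p. (f p, g p)) ` W \<subseteq> mcarrier B \<times> mcarrier C"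
    using smooth_map_on_image[OF A B f] smooth_map_on_image[OF A C g] by auto
  from smooth_map_on_compose[OF A smooth_atlas_product[OF B C] D smooth_map_on_Pair[OF A B C f g] h this]
  show ?thesis by (simp add: o_def)
qed

text \<open>In a chart, a curve with zero velocity is constant on a small interval; connectedness of
  the real line makes this global.\<close>

lemma curve_zero_velocity_constant:
  assumes A: "smooth_atlas A" and \<gamma>: "smooth_curve A UNIV \<gamma>"
    and 0: "\<And>t. snd (velocity A \<gamma> t) = (\<lambda>_. 0)"
  shows "\<gamma> s = \<gamma> t"
proof -
  have "\<exists>T. openin (top_of_set UNIV) T \<and> a \<in> T \<and> (\<forall>x\<in>T. \<gamma> x = \<gamma> a)" for a :: real
  proof -
    have "\<gamma> a \<in> mcarrier A" using \<gamma> unfolding smooth_curve_iff[OF A] by auto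
    then obtain c where c: "c \<in> A" "\<gamma> a \<in> fst c" by (auto simp: mcarrier_def)
    have "open (\<gamma> -` fst c)" using \<gamma> c unfolding smooth_curve_iff[OF A] by auto
    then obtain e where e: "e > 0" "ball a e \<subseteq> \<gamma> -` fst c" using c openE by (metis vimageI)
    have "\<gamma> x = \<gamma> a" if x: "x \<in> ball a e" for x
    proof -
      have d0: "((snd c \<circ> \<gamma>) has_derivative (\<lambda>h. 0)) (at y within ball a e)" if "y \<in> ball a e" for y
      proof -
        have "\<gamma> y \<in> fst c" using that e(2) by auto
        from has_vector_derivative_velocity[OF A \<gamma> UNIV_I c(1) this] show ?thesis
          by (simp add: has_vector_derivative_def 0 has_derivative_at_withinI)
      qed
      have "(snd c \<circ> \<gamma>) x = (snd c \<circ> \<gamma>) a"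
        by (rule has_derivative_zero_unique[OF convex_ball d0 x]) (use e in auto)
      then show ?thesis using smooth_atlasD(1)[OF A c(1)] e(2) x c(2) by (auto dest: inj_onD)
    qed
    moreover have "openin (top_of_set UNIV) (ball a e)" "a \<in> ball a e" using e(1) by simp_all
    ultimately show ?thesis by blast
  qed
  then have "\<gamma> constant_on UNIV" by (rule locally_constant_imp_constant[OF connected_UNIV])
  then obtain y where "\<And>x. \<gamma> x = y" unfolding constant_on_def by blast
  then show ?thesis by simp
qed

section \<open>One-parameter subgroups and the exponential map\<close>

lemma lie_groupD:
  assumes "lie_group G B"
  shows "group G" "smooth_atlas B" "carrier G = mcarrier B"
    "smooth_map_on (product_atlas B B) (mcarrier B \<times> mcarrier B) B (\<lambda>(g, h). g \<otimes>\<^bsub>G\<^esub> h)"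
    "smooth_map_on B (mcarrier B) B (\<lambda>g. inv\<^bsub>G\<^esub> g)"
  using assms by (auto simp: lie_group_def smooth_manifold_def)

lemma smooth_map_on_linear_time:
  "smooth_map_on euclidean_atlas UNIV euclidean_atlas (\<lambda>t::real. a * t + b)"
proof -
  have "smooth_on UNIV (\<lambda>t::real. a * t + b)"
    by (intro smooth_on_add smooth_on_const smooth_on_bounded_linear bounded_linear_mult_right) auto
  then show ?thesis unfolding smooth_map_on_euclidean_iff[OF smooth_atlas_euclidean]
    by (simp add: euclidean_atlas_def o_def mcarrier_def)
qed

lemma velocity_linear_time:
  assumes B: "smooth_atlas B" and \<sigma>: "smooth_curve B UNIV \<sigma>"
  shows "velocity B (\<lambda>t. \<sigma> (a * t + b)) t = tangent_scale a (velocity B \<sigma> (a * t + b))"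
proof -
  have "snd (velocity B (\<lambda>t. \<sigma> (a * t + b)) t) c = a *\<^sub>R snd (velocity B \<sigma> (a * t + b)) c" for c
  proof (cases "c \<in> B \<and> \<sigma> (a * t + b) \<in> fst c")
    case True
    have "((\<lambda>t. a * t + b) has_vector_derivative a) (at t)" by (auto intro!: derivative_eq_intros simp: has_vector_derivative_def)
    from vector_diff_chain_at[OF this has_vector_derivative_velocity[OF B \<sigma> UNIV_I]] True
    show ?thesis by (intro velocity_eqI) (auto simp: o_def)
  qed (auto simp: velocity_def)
  then show ?thesis by (simp add: tangent_scale_def velocity_def fun_eq_iff)
qed

locale lie_group_atlas =
  fixes G :: "('g, 'b) monoid_scheme" (structure) and B :: "('g, 'h::euclidean_space) atlas"
  assumes lie: "lie_group G B"
begin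

sublocale group G using lie_groupD[OF lie] by simp

lemmas atlas_B = lie_groupD(2)[OF lie] and carrier_eq = lie_groupD(3)[OF lie]

lemma smooth_mult:
  fixes A :: "('k, 'l::euclidean_space) atlas"
  assumes "smooth_atlas A" "smooth_map_on A W B f" "smooth_map_on A W B g"
  shows "smooth_map_on A W B (\<lambda>p. f p \<otimes> g p)"
  using smooth_map_on_comp_Pair[OF assms(1) atlas_B atlas_B atlas_B assms(2,3), of "\<lambda>x y. x \<otimes> y"] lie_groupD(4)[OF lie] by simp

lemma smooth_translation:
  assumes "a \<in> carrier G" "b \<in> carrier G"
  shows "smooth_map_on B (mcarrier B) B (\<lambda>x. a \<otimes> x \<otimes> b)"
  using assms
  by (intro smooth_mult atlas_B smooth_map_on_const smooth_map_on_id_chart) (auto simp: carrier_eq)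

lemma one_parameter_subgroup_facts:
  assumes "one_parameter_subgroup G B \<sigma>"
  shows "smooth_curve B UNIV \<sigma>" "\<sigma> t \<in> carrier G" "\<sigma> (s + t) = \<sigma> s \<otimes> \<sigma> t" "\<sigma> 0 = \<one>"
proof -
  show *: "smooth_curve B UNIV \<sigma>" using assms by (simp add: one_parameter_subgroup_def smooth_curve_def)
  then show c: "\<sigma> t \<in> carrier G" for t unfolding smooth_curve_iff[OF atlas_B] carrier_eq by auto
  show add: "\<sigma> (s + t) = \<sigma> s \<otimes> \<sigma> t" for s t using assms by (simp add: one_parameter_subgroup_def)
  show "\<sigma> 0 = \<one>" using add[of 0 0] c[of 0] by (simp add: l_cancel_one')
qed

lemma one_parameter_subgroup_scale:
  assumes "one_parameter_subgroup G B \<sigma>"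
  shows "one_parameter_subgroup G B (\<lambda>t. \<sigma> (a * t))"
    "velocity B (\<lambda>t. \<sigma> (a * t)) 0 = tangent_scale a (velocity B \<sigma> 0)"
proof -
  have "smooth_map_on euclidean_atlas UNIV B (\<sigma> \<circ> (\<lambda>t. a * t + 0))"
    using assms by (intro smooth_map_on_compose[OF smooth_atlas_euclidean smooth_atlas_euclidean atlas_B smooth_map_on_linear_time])
      (auto simp: one_parameter_subgroup_def)
  then show "one_parameter_subgroup G B (\<lambda>t. \<sigma> (a * t))"
    using assms by (simp add: one_parameter_subgroup_def o_def distrib_left)
  show "velocity B (\<lambda>t. \<sigma> (a * t)) 0 = tangent_scale a (velocity B \<sigma> 0)"
    using velocity_linear_time[OF atlas_B one_parameter_subgroup_facts(1)[OF assms], of a 0 0] by simp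
qed

text \<open>The derivative of multiplication at the identity is addition, so \<open>\<sigma> h \<otimes> \<tau> (- h)\<close> has
  velocity \<open>X - X\<close> at \<open>0\<close>.\<close>

lemma velocity_product_at_one:
  assumes \<sigma>: "one_parameter_subgroup G B \<sigma>" and \<tau>: "one_parameter_subgroup G B \<tau>"
    and eq: "velocity B \<sigma> 0 = velocity B \<tau> 0"
  shows "snd (velocity B (\<lambda>h. \<sigma> h \<otimes> \<tau> (- h)) 0) = (\<lambda>_. 0)"
proof -
  have "snd (velocity B (\<lambda>h. \<sigma> h \<otimes> \<tau> (- h)) 0) c = 0" if c: "c \<in> B" "\<one> \<in> fst c" for c
  proof (rule velocity_eqI)
    let ?X = "snd (velocity B \<sigma> 0) c" and ?e = "snd c \<one>"
    let ?cc = "(fst c \<times> fst c, map_prod (snd c) (snd c))"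
    let ?m = "\<lambda>(g, h). g \<otimes> h"
    let ?M = "snd c \<circ> ?m \<circ> chart_inv ?cc"
    let ?D = "frechet_derivative ?M (at (?e, ?e))"
    have cc: "?cc \<in> product_atlas B B" using c by (force simp: product_atlas_def)
    have one: "\<one> \<in> mcarrier B" using carrier_eq by auto
    have M: "(?M has_derivative ?D) (at (?e, ?e))"
      using smooth_on_has_derivative_rep[OF smooth_atlas_product[OF atlas_B atlas_B] atlas_B lie_groupD(4)[OF lie] cc c(1), of "(\<one>, \<one>)"] c one
      by simp
    have lin: "linear ?D" using M has_derivative_linear by blast
    have inv: "chart_inv ?cc (x, y) = (chart_inv c x, chart_inv c y)" if "x \<in> chart_range c" "y \<in> chart_range c" for x y
      using product_atlas_chart(3)[OF atlas_B atlas_B c(1) c(1), of "(x, y)"] that by simp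
    have er: "?e \<in> chart_range c" "chart_inv c ?e = \<one>" using c chart_inv_left[OF atlas_B] by (auto simp: chart_range_def)
    have ro: "open (chart_range c)" by (rule smooth_atlasD(2)[OF atlas_B c(1)])
    have sr: "snd c (chart_inv c x) = x" if "x \<in> chart_range c" for x by (rule chart_inv_right(2)[OF that])
    have carr: "chart_inv c x \<in> carrier G" if "x \<in> chart_range c" for x
      using chart_inv_right(1)[OF that] c by (auto simp: carrier_eq mcarrier_def)
    have "((\<lambda>x. ?M (x, ?e)) has_derivative (\<lambda>w. ?D (w, 0))) (at ?e)"
      by (rule has_derivative_compose[where f="\<lambda>x. (x, ?e)" and g="?M", OF _ M]) (auto intro!: derivative_eq_intros)
    moreover have "((\<lambda>x. ?M (x, ?e)) has_derivative (\<lambda>w. w)) (at ?e)"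
      by (rule has_derivative_transform_within_open[OF has_derivative_ident ro er(1)])
        (use er carr sr in \<open>auto simp: inv\<close>)
    \<comment> \<open>As \<open>\<one>\<close> is neutral, multiplication restricted to its first
      factor is the identity map, and so is its derivative; \<open>D2\<close> is the same for the
      second factor.\<close>
    ultimately have D1: "?D (w, 0) = w" for w using has_derivative_unique by metis
    have "((\<lambda>y. ?M (?e, y)) has_derivative (\<lambda>w. ?D (0, w))) (at ?e)"
      by (rule has_derivative_compose[where f="\<lambda>y. (?e, y)" and g="?M", OF _ M]) (auto intro!: derivative_eq_intros)
    moreover have "((\<lambda>y. ?M (?e, y)) has_derivative (\<lambda>w. w)) (at ?e)"
      by (rule has_derivative_transform_within_open[OF has_derivative_ident ro er(1)])
        (use er carr sr in \<open>auto simp: inv\<close>)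
    ultimately have D2: "?D (0, w) = w" for w using has_derivative_unique by metis
    note \<sigma>s = one_parameter_subgroup_facts[OF \<sigma>] and \<tau>s = one_parameter_subgroup_facts[OF \<tau>]
    have s: "(snd c \<circ> \<sigma> has_derivative (\<lambda>h. h *\<^sub>R ?X)) (at 0)"
      using has_vector_derivative_velocity[OF atlas_B \<sigma>s(1), of 0 c] c \<sigma>s(4) by (simp add: has_vector_derivative_def)
    have t: "(snd c \<circ> \<tau> has_derivative (\<lambda>h. h *\<^sub>R ?X)) (at 0)"
      using has_vector_derivative_velocity[OF atlas_B \<tau>s(1), of 0 c] c \<tau>s(4) eq by (simp add: has_vector_derivative_def)
    have t': "((\<lambda>h. (snd c \<circ> \<tau>) (- h)) has_derivative (\<lambda>h. (- h) *\<^sub>R ?X)) (at 0)"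
      by (rule has_derivative_compose[where f=uminus and g="snd c \<circ> \<tau>"]) (use t in \<open>auto intro!: derivative_eq_intros\<close>)
    have st: "((\<lambda>h. ((snd c \<circ> \<sigma>) h, (snd c \<circ> \<tau>) (- h))) has_derivative (\<lambda>h. (h *\<^sub>R ?X, (- h) *\<^sub>R ?X))) (at 0)"
      by (rule has_derivative_Pair[OF s t'])
    have "((\<lambda>h. ?M ((snd c \<circ> \<sigma>) h, (snd c \<circ> \<tau>) (- h))) has_derivative (\<lambda>h. ?D (h *\<^sub>R ?X, (- h) *\<^sub>R ?X))) (at 0)"
    proof (rule has_derivative_compose[OF st])
      have "(snd c \<circ> \<sigma>) 0 = ?e" "(snd c \<circ> \<tau>) (- 0) = ?e" using \<sigma>s(4) \<tau>s(4) by simp_all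
      then show "(?M has_derivative ?D) (at ((snd c \<circ> \<sigma>) 0, (snd c \<circ> \<tau>) (- 0)))" using M by (simp only:)
    qed
    moreover have "?D (h *\<^sub>R ?X, (- h) *\<^sub>R ?X) = 0" for h
      using linear_add[OF lin, of "(h *\<^sub>R ?X, 0)" "(0, (- h) *\<^sub>R ?X)"] D1 D2 by simp
    ultimately have z: "((\<lambda>h. ?M ((snd c \<circ> \<sigma>) h, (snd c \<circ> \<tau>) (- h))) has_derivative (\<lambda>h. h *\<^sub>R 0)) (at 0)" by simp
    have o: "open (\<sigma> -` fst c \<inter> uminus -` (\<tau> -` fst c))"
    proof (intro open_Int)
      show "open (\<sigma> -` fst c)" using \<sigma>s(1) c unfolding smooth_curve_iff[OF atlas_B] by auto
      have "open (\<tau> -` fst c)" using \<tau>s(1) c unfolding smooth_curve_iff[OF atlas_B] by auto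
      then show "open (uminus -` (\<tau> -` fst c))" by (rule open_vimage) (intro continuous_intros)
    qed
    show "(snd c \<circ> (\<lambda>h. \<sigma> h \<otimes> \<tau> (- h)) has_vector_derivative 0) (at 0)"
      unfolding has_vector_derivative_def
      by (rule has_derivative_transform_within_open[OF z o])
        (use c \<sigma>s(4) \<tau>s(4) in \<open>auto simp: inv chart_range_def chart_inv_left[OF atlas_B]\<close>)
  qed (use c one_parameter_subgroup_facts(4)[OF \<sigma>] one_parameter_subgroup_facts(4)[OF \<tau>] in auto)
  moreover have "\<sigma> 0 \<otimes> \<tau> (- 0) = \<one>"
    using one_parameter_subgroup_facts(4)[OF \<sigma>] one_parameter_subgroup_facts(4)[OF \<tau>] by simp
  ultimately show ?thesis by (auto simp: velocity_def fun_eq_iff)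
qed

text \<open>With \<open>w h = \<sigma> h \<otimes> \<tau> (- h)\<close> one has
  \<open>w (t + h) = \<sigma> t \<otimes> w h \<otimes> \<tau> (- t)\<close>. The velocity of
  \<open>w\<close> at \<open>t\<close> is thus the image of its velocity at 0, which vanishes, so
  \<open>w\<close> is constantly \<open>\<one>\<close>. This takes the place of uniqueness for
  integral curves of left-invariant fields.\<close>

lemma one_parameter_subgroup_unique:
  assumes \<sigma>: "one_parameter_subgroup G B \<sigma>" and \<tau>: "one_parameter_subgroup G B \<tau>"
    and eq: "velocity B \<sigma> 0 = velocity B \<tau> 0"
  shows "\<sigma> t = \<tau> t"
proof -
  note \<sigma>s = one_parameter_subgroup_facts[OF \<sigma>] and \<tau>s = one_parameter_subgroup_facts[OF \<tau>]
  have \<tau>m: "one_parameter_subgroup G B (\<lambda>t. \<tau> (- t))" using one_parameter_subgroup_scale(1)[OF \<tau>, of "- 1"] by simp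
  define w where "w h = \<sigma> h \<otimes> \<tau> (- h)" for h
  have w: "smooth_curve B UNIV w"
    unfolding w_def smooth_curve_def using \<sigma> \<tau>m
    by (auto intro!: smooth_mult smooth_atlas_euclidean simp: one_parameter_subgroup_def)
  have "snd (velocity B w t) = (\<lambda>_. 0)" for t
  proof -
    let ?F = "\<lambda>x. \<sigma> t \<otimes> x \<otimes> \<tau> (- t)"
    have F: "smooth_map_on B (mcarrier B) B ?F" by (intro smooth_translation \<sigma>s \<tau>s)
    have shift: "w (1 * h + t) = (?F \<circ> w) h" for h
    proof -
      have "\<sigma> (h + t) = \<sigma> t \<otimes> \<sigma> h" "\<tau> (- (h + t)) = \<tau> (- h) \<otimes> \<tau> (- t)"
        using \<sigma>s(3)[of t h] \<tau>s(3)[of "- h" "- t"] by (simp_all add: add.commute)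
      then show ?thesis using \<sigma>s(2) \<tau>s(2) by (simp add: w_def m_assoc)
    qed
    have "velocity B (\<lambda>h. w (1 * h + t)) 0 = velocity B (?F \<circ> w) 0"
      by (simp only: shift o_def)
    also have "\<dots> = tangent_map B B ?F (velocity B w 0)"
      using w unfolding smooth_curve_iff[OF atlas_B]
      by (intro velocity_compose[OF atlas_B atlas_B F w]) auto
    also have "velocity B (\<lambda>h. w (1 * h + t)) 0 = velocity B w t"
      using velocity_linear_time[OF atlas_B w, of 1 t 0] by (simp add: tangent_scale_def velocity_def)
    finally have "velocity B w t = tangent_map B B ?F (velocity B w 0)" .
    moreover have "snd (tangent_map B B ?F (velocity B w 0)) d = 0" for d
    proof (cases "d \<in> B \<and> ?F (w 0) \<in> fst d")
      case True
      have w0: "w 0 \<in> mcarrier B" using w unfolding smooth_curve_iff[OF atlas_B] by auto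
      then obtain c where c: "c \<in> B" "w 0 \<in> fst c" by (auto simp: mcarrier_def)
      have "snd (tangent_map B B ?F (velocity B w 0)) d = rep_derivative c d ?F (w 0) (snd (velocity B w 0) c)"
        using tangent_map_component[OF atlas_B atlas_B F velocity_in_tangent_bundle[OF atlas_B w], of 0 c d] w0 c True by simp
      also have "\<dots> = rep_derivative c d ?F (w 0) 0"
        using velocity_product_at_one[OF \<sigma> \<tau> eq] by (simp add: w_def[abs_def])
      also have "\<dots> = 0"
        using smooth_on_has_derivative_rep[OF atlas_B atlas_B F c(1) _ w0 c(2), of d] True has_derivative_linear linear_0 by metis
      finally show ?thesis .
    qed (auto simp: tangent_map_def)
    ultimately show ?thesis by auto
  qed
  then have "w t = w 0" by (rule curve_zero_velocity_constant[OF atlas_B w])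
  then have "\<sigma> t \<otimes> \<tau> (- t) = \<one>" using \<sigma>s(4) \<tau>s(4) by (simp add: w_def)
  moreover have "\<tau> t \<otimes> \<tau> (- t) = \<one>" using \<tau>s(3)[of t "- t"] \<tau>s(4) by simp
  ultimately show ?thesis using \<sigma>s(2) \<tau>s(2) right_cancel by metis
qed

text \<open>Existence for the description in \<open>lie_exp\<close> comes from rescaling time in
  \<open>\<sigma>\<close>, uniqueness from \<open>one_parameter_subgroup_unique\<close>.\<close>

lemma lie_exp_scale:
  assumes \<sigma>: "one_parameter_subgroup G B \<sigma>" "velocity B \<sigma> 0 = X"
  shows "lie_exp G B (tangent_scale t X) = \<sigma> t"
  unfolding lie_exp_def
proof (rule the_equality)
  show "\<exists>\<rho>. one_parameter_subgroup G B \<rho> \<and> velocity B \<rho> 0 = tangent_scale t X \<and> \<sigma> t = \<rho> 1"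
    using one_parameter_subgroup_scale[OF \<sigma>(1), of t] \<sigma>(2) by (intro exI[of _ "\<lambda>s. \<sigma> (t * s)"]) simp
  fix g assume "\<exists>\<rho>. one_parameter_subgroup G B \<rho> \<and> velocity B \<rho> 0 = tangent_scale t X \<and> g = \<rho> 1"
  then obtain \<rho> where \<rho>: "one_parameter_subgroup G B \<rho>" "velocity B \<rho> 0 = tangent_scale t X" "g = \<rho> 1" by blast
  have "\<rho> 1 = \<sigma> (t * 1)"
    using one_parameter_subgroup_unique[OF \<rho>(1) one_parameter_subgroup_scale(1)[OF \<sigma>(1), of t]]
      one_parameter_subgroup_scale(2)[OF \<sigma>(1), of t] \<sigma>(2) \<rho>(2) by simp
  then show "g = \<sigma> t" by (simp add: \<rho>(3))
qed

text \<open>Without a one-parameter subgroup in direction \<open>X\<close>, the description in \<open>lie_exp\<close> is unsatisfiable for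
  every \<open>t \<noteq> 0\<close>, so \<open>lie_exp\<close> takes one and the same junk value there.\<close>

lemma lie_exp_no_subgroup:
  assumes none: "\<nexists>\<sigma>. one_parameter_subgroup G B \<sigma> \<and> velocity B \<sigma> 0 = X" and t: "t \<noteq> 0"
  shows "lie_exp G B (tangent_scale t X) = (THE g. False)"
proof -
  have "\<not> (one_parameter_subgroup G B \<rho> \<and> velocity B \<rho> 0 = tangent_scale t X)" for \<rho>
  proof
    assume \<rho>: "one_parameter_subgroup G B \<rho> \<and> velocity B \<rho> 0 = tangent_scale t X"
    then have "velocity B (\<lambda>s. \<rho> (1 / t * s)) 0 = X"
      using one_parameter_subgroup_scale(2)[of \<rho> "1 / t"] t by (simp add: tangent_scale_def)
    then show False using none one_parameter_subgroup_scale(1)[of \<rho> "1 / t"] \<rho> by blast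
  qed
  then show ?thesis unfolding lie_exp_def by (intro arg_cong[where f=The]) blast
qed

end

lemma velocity_shift:
  assumes A: "smooth_atlas A" and \<gamma>: "smooth_curve A I \<gamma>" and t: "t \<in> I"
  shows "velocity A (\<lambda>s. \<gamma> (t + s)) 0 = velocity A \<gamma> t"
proof (rule prod_eqI)
  show "snd (velocity A (\<lambda>s. \<gamma> (t + s)) 0) = snd (velocity A \<gamma> t)"
  proof
    fix c show "snd (velocity A (\<lambda>s. \<gamma> (t + s)) 0) c = snd (velocity A \<gamma> t) c"
    proof (cases "c \<in> A \<and> \<gamma> t \<in> fst c")
      case True
      have "((\<lambda>s. t + s) has_vector_derivative 1) (at 0)"
        by (auto intro!: derivative_eq_intros simp: has_vector_derivative_def)
      moreover have "(snd c \<circ> \<gamma> has_vector_derivative snd (velocity A \<gamma> t) c) (at (t + 0))"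
        using has_vector_derivative_velocity[OF A \<gamma> t] True by simp
      ultimately have "((snd c \<circ> \<gamma>) \<circ> (\<lambda>s. t + s) has_vector_derivative 1 *\<^sub>R snd (velocity A \<gamma> t) c) (at 0)"
        by (rule vector_diff_chain_at)
      then show ?thesis using True by (intro velocity_eqI) (auto simp: o_def)
    qed (auto simp: velocity_def)
  qed
qed simp

section \<open>Sprays in charts\<close>

text \<open>The functions \<open>f^i\<close> of the local expression of a spray, collected in one
  vector.\<close>

definition spray_coefficient ::
  "('m, 'e::real_normed_vector) atlas \<Rightarrow> (('m, 'e) tangent \<Rightarrow> (('m, 'e) tangent, 'e \<times> 'e) tangent)
    \<Rightarrow> ('m, 'e) chart \<Rightarrow> 'e \<Rightarrow> 'e \<Rightarrow> 'e" where
  "spray_coefficient A S c x y = snd (vf_rep (tangent_chart A c) S (x, y))"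

locale spray_atlas =
  fixes A :: "('m, 'e::euclidean_space) atlas"
    and S :: "('m, 'e) tangent \<Rightarrow> (('m, 'e) tangent, 'e \<times> 'e) tangent"
  assumes atlas_A: "smooth_atlas A" and spray: "spray A S"
begin

abbreviation "f \<equiv> spray_coefficient A S"

lemmas atlas_TA = smooth_atlas_tangent_atlas[OF atlas_A]
lemmas atlas_TTA = smooth_atlas_tangent_atlas[OF atlas_TA]

lemma chart_mcarrier: "c \<in> A \<Longrightarrow> p \<in> fst c \<Longrightarrow> p \<in> mcarrier A"
  by (auto simp: mcarrier_def)

lemma slit_tangent_vector:
  assumes "c \<in> A" "p \<in> fst c" shows "tangent_vector A c p y \<in> slit_tangent_bundle A \<longleftrightarrow> y \<noteq> 0"
  using slit_iff_component[OF atlas_A, of "tangent_vector A c p y" c] tangent_vector[OF atlas_A assms, of y] assms by simp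

lemma slit_subset: "u \<in> slit_tangent_bundle A \<Longrightarrow> u \<in> tangent_bundle A"
  by (auto simp: slit_tangent_bundle_def)

lemma smooth_S: "smooth_map_on (tangent_atlas A) (slit_tangent_bundle A) (tangent_atlas (tangent_atlas A)) S"
  using spray by (simp add: spray_def smooth_vector_field_def)

lemma fst_S: "u \<in> slit_tangent_bundle A \<Longrightarrow> fst (S u) = u"
  using spray by (simp add: spray_def smooth_vector_field_def)

lemma S_in_tangent_bundle: "u \<in> slit_tangent_bundle A \<Longrightarrow> S u \<in> tangent_bundle (tangent_atlas A)"
  using smooth_map_on_image[OF atlas_TA atlas_TTA smooth_S] by (simp add: mcarrier_tangent_atlas)

text \<open>The condition \<open>J S = C\<close> makes the horizontal component of
  \<open>S u\<close> equal to the fibre coordinate, which leaves the coefficient \<open>f\<close> as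
  the only unknown in a chart.\<close>

lemma S_component:
  assumes u: "u \<in> slit_tangent_bundle A" and c: "c \<in> A" "fst u \<in> fst c"
  shows "snd (S u) (tangent_chart A c) = (snd u c, f c (snd c (fst u)) (snd u c))"
proof (rule prod_eqI)
  let ?tc = "tangent_chart A c"
  have tc: "?tc \<in> tangent_atlas A" "u \<in> fst ?tc"
    using u c slit_subset by (auto simp: tangent_atlas_def tangent_chart_def)
  have "vertical_endomorphism (S u) = liouville_field A u" using spray u by (simp add: spray_def)
  then have "snd (vertical_endomorphism (S u)) ?tc = snd (liouville_field A u) ?tc" by simp
  then show "fst (snd (S u) ?tc) = fst (snd u c, f c (snd c (fst u)) (snd u c))"
    using tc by (simp add: vertical_endomorphism_def liouville_field_def) (simp add: tangent_chart_def)
  have "chart_inv ?tc (snd c (fst u), snd u c) = u"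
    using tangent_chart(3)[OF atlas_A c(1), of "snd c (fst u)" "snd u c"] c chart_inv_left[OF atlas_A c]
      tangent_bundle_eq_tangent_vector[OF slit_subset[OF u] c] by (simp add: chart_range_def)
  then show "snd (snd (S u) ?tc) = snd (snd u c, f c (snd c (fst u)) (snd u c))"
    by (simp add: spray_coefficient_def vf_rep_def)
qed

lemma slit_chart_image:
  assumes c: "c \<in> A"
  shows "snd (tangent_chart A c) ` (slit_tangent_bundle A \<inter> fst (tangent_chart A c)) = chart_range c \<times> - {0}"
proof (intro equalityI subsetI)
  fix z assume "z \<in> chart_range c \<times> - {0::'e}"
  then obtain p y where p: "p \<in> fst c" "y \<noteq> 0" "z = (snd c p, y)" by (auto simp: chart_range_def)
  then have "tangent_vector A c p y \<in> slit_tangent_bundle A \<inter> fst (tangent_chart A c)"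
    "snd (tangent_chart A c) (tangent_vector A c p y) = z"
    using tangent_vector[OF atlas_A c p(1), of y] slit_tangent_vector[OF c p(1), of y] by (auto simp: tangent_chart_def)
  then show "z \<in> snd (tangent_chart A c) ` (slit_tangent_bundle A \<inter> fst (tangent_chart A c))" by (metis imageI)
next
  fix z assume "z \<in> snd (tangent_chart A c) ` (slit_tangent_bundle A \<inter> fst (tangent_chart A c))"
  then obtain u where u: "u \<in> slit_tangent_bundle A" "fst u \<in> fst c" "z = (snd c (fst u), snd u c)"
    by (auto simp: tangent_chart_def)
  then show "z \<in> chart_range c \<times> - {0}"
    using slit_iff_component[OF atlas_A slit_subset[OF u(1)] c u(2)] by (auto simp: chart_range_def)
qed

lemma open_slit_chart: "c \<in> A \<Longrightarrow> open (chart_range c \<times> - {0::'e})"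
  using smooth_atlasD(2)[OF atlas_A] by (intro open_Times) (auto simp: open_Compl)

lemma smooth_f:
  assumes c: "c \<in> A" shows "smooth_on (chart_range c \<times> - {0}) (case_prod (f c))"
proof -
  let ?tc = "tangent_chart A c" let ?ttc = "tangent_chart (tangent_atlas A) ?tc"
  have tc: "?tc \<in> tangent_atlas A" and ttc: "?ttc \<in> tangent_atlas (tangent_atlas A)"
    using c by (auto simp: tangent_atlas_def)
  \<comment> \<open>Since \<open>S\<close> is a section, its value lies in the double tangent chart
    as soon as its foot point lies in the tangent chart; smoothness thus holds on the full slit
    chart.\<close>
  have "slit_tangent_bundle A \<inter> fst ?tc \<inter> S -` fst ?ttc = slit_tangent_bundle A \<inter> fst ?tc"
    using S_in_tangent_bundle fst_S by (auto simp: tangent_chart_def[of "tangent_atlas A"])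
  then have s: "smooth_on (chart_range c \<times> - {0}) (snd ?ttc \<circ> S \<circ> chart_inv ?tc)"
    using smooth_S tc ttc slit_chart_image[OF c] unfolding smooth_map_on_def by metis
  have "smooth_on (chart_range c \<times> - {0}) (\<lambda>z. snd (snd ((snd ?ttc \<circ> S \<circ> chart_inv ?tc) z)))"
    by (intro smooth_on_linear[OF open_slit_chart[OF c] bounded_linear_snd] s)
  then show ?thesis
    by (rule smooth_on_cong[OF open_slit_chart[OF c], rotated])
      (auto simp: tangent_chart_def[of "tangent_atlas A"] spray_coefficient_def vf_rep_def)
qed

lemma velocity_velocity_component:
  assumes \<gamma>: "smooth_curve A I \<gamma>" and t: "t \<in> I" and c: "c \<in> A" "\<gamma> t \<in> fst c"
  shows "((\<lambda>s. (snd c (\<gamma> s), snd (velocity A \<gamma> s) c)) has_vector_derivative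
    snd (velocity (tangent_atlas A) (velocity A \<gamma>) t) (tangent_chart A c)) (at t)"
  using has_vector_derivative_velocity[OF atlas_TA smooth_curve_velocity[OF atlas_A \<gamma>] t, of "tangent_chart A c"]
    velocity_in_tangent_bundle[OF atlas_A \<gamma> t] c
  by (auto simp: tangent_atlas_def tangent_chart_def o_def)

lemma has_derivative_velocity_component:
  assumes \<gamma>: "smooth_curve A I \<gamma>" and t: "t \<in> I" and c: "c \<in> A" "\<gamma> t \<in> fst c"
  shows "((\<lambda>s. snd (velocity A \<gamma> s) c) has_vector_derivative
    snd (snd (velocity (tangent_atlas A) (velocity A \<gamma>) t) (tangent_chart A c))) (at t)"
    and "fst (snd (velocity (tangent_atlas A) (velocity A \<gamma>) t) (tangent_chart A c)) = snd (velocity A \<gamma> t) c"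
proof -
  note v = velocity_velocity_component[OF assms]
  from bounded_linear.has_vector_derivative[OF bounded_linear_snd v]
  show "((\<lambda>s. snd (velocity A \<gamma> s) c) has_vector_derivative
    snd (snd (velocity (tangent_atlas A) (velocity A \<gamma>) t) (tangent_chart A c))) (at t)" by simp
  from bounded_linear.has_vector_derivative[OF bounded_linear_fst v]
  have "(snd c \<circ> \<gamma> has_vector_derivative fst (snd (velocity (tangent_atlas A) (velocity A \<gamma>) t) (tangent_chart A c))) (at t)"
    by (simp add: o_def)
  then show "fst (snd (velocity (tangent_atlas A) (velocity A \<gamma>) t) (tangent_chart A c)) = snd (velocity A \<gamma> t) c"
    using has_vector_derivative_velocity[OF atlas_A \<gamma> t c] vector_derivative_unique_at by blast
qed

text \<open>The horizontal components of both sides equal the velocity automatically, so the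
  vertical one carries all the information; and a tangent vector is determined by its component in a
  single chart.\<close>

lemma geodesic_equation_iff:
  assumes \<gamma>: "smooth_curve A I \<gamma>" and t: "t \<in> I" and c: "c \<in> A" "\<gamma> t \<in> fst c"
    and slit: "velocity A \<gamma> t \<in> slit_tangent_bundle A"
  shows "velocity (tangent_atlas A) (velocity A \<gamma>) t = S (velocity A \<gamma> t) \<longleftrightarrow>
    ((\<lambda>s. snd (velocity A \<gamma> s) c) has_vector_derivative f c (snd c (\<gamma> t)) (snd (velocity A \<gamma> t) c)) (at t)"
proof
  assume "velocity (tangent_atlas A) (velocity A \<gamma>) t = S (velocity A \<gamma> t)"
  then show "((\<lambda>s. snd (velocity A \<gamma> s) c) has_vector_derivative f c (snd c (\<gamma> t)) (snd (velocity A \<gamma> t) c)) (at t)"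
    using has_derivative_velocity_component(1)[OF \<gamma> t c] S_component[OF slit c(1)] c(2) by simp
next
  assume h: "((\<lambda>s. snd (velocity A \<gamma> s) c) has_vector_derivative f c (snd c (\<gamma> t)) (snd (velocity A \<gamma> t) c)) (at t)"
  let ?v = "velocity (tangent_atlas A) (velocity A \<gamma>) t" and ?tc = "tangent_chart A c"
  have "snd (snd ?v ?tc) = f c (snd c (\<gamma> t)) (snd (velocity A \<gamma> t) c)"
    using vector_derivative_unique_at[OF h has_derivative_velocity_component(1)[OF \<gamma> t c]] by simp
  then have "snd ?v ?tc = snd (S (velocity A \<gamma> t)) ?tc"
    using has_derivative_velocity_component(2)[OF \<gamma> t c] S_component[OF slit c(1)] c(2) by (simp add: prod_eq_iff)
  moreover have "?v \<in> tangent_bundle (tangent_atlas A)"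
    by (rule velocity_in_tangent_bundle[OF atlas_TA smooth_curve_velocity[OF atlas_A \<gamma>] t])
  ultimately show "?v = S (velocity A \<gamma> t)"
    using S_in_tangent_bundle[OF slit] fst_S[OF slit] c slit_subset[OF slit]
    by (intro tangent_bundle_eqI[of _ "tangent_atlas A" _ ?tc]) (auto simp: tangent_atlas_def tangent_chart_def)
qed

text \<open>Solves the first-order system \<open>(x, y)' = (y, f x y)\<close> in the slit chart.
  Every nonzero vector is thus an initial velocity, which lets statements about geodesics be read as
  identities at each point of the slit tangent bundle.\<close>

lemma geodesic_exists:
  assumes c: "c \<in> A" and p: "p \<in> fst c" and y: "y \<noteq> 0"
  shows "\<exists>\<epsilon>>0. \<exists>\<gamma>. spray_geodesic A S {- \<epsilon><..<\<epsilon>} \<gamma> \<and> \<gamma> 0 = p \<and> snd (velocity A \<gamma> 0) c = y"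
proof -
  define F where "F z = (snd z, f c (fst z) (snd z))" for z
  let ?\<Omega> = "chart_range c \<times> - {0::'e}"
  note o = open_slit_chart[OF c]
  have F: "smooth_on ?\<Omega> F"
    unfolding F_def using smooth_f[OF c]
    by (intro smooth_on_Pair[OF o] smooth_on_bounded_linear[OF o bounded_linear_snd]) (simp add: case_prod_unfold)
  have "(snd c p, y) \<in> ?\<Omega>" using p y by (auto simp: chart_range_def)
  moreover have "Ck_on 1 ?\<Omega> F" using F by (simp add: smooth_on_def)
  ultimately obtain \<epsilon> z where \<epsilon>: "\<epsilon> > 0" and z0: "z 0 = (snd c p, y)"
    and z: "\<And>t. \<bar>t\<bar> < \<epsilon> \<Longrightarrow> z t \<in> ?\<Omega>" "\<And>t. \<bar>t\<bar> < \<epsilon> \<Longrightarrow> (z has_vector_derivative F (z t)) (at t)"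
    using ode_local_solution[OF o] by metis
  define I where "I = {- \<epsilon><..<\<epsilon>}"
  have I: "open I" "is_interval I" "I \<noteq> {}" "0 \<in> I" and inI: "t \<in> I \<longleftrightarrow> \<bar>t\<bar> < \<epsilon>" for t
    using \<epsilon> by (auto simp: I_def is_interval_oo)
  define \<gamma> where "\<gamma> t = chart_inv c (fst (z t))" for t
  have \<gamma>c: "\<gamma> t \<in> fst c" "snd c (\<gamma> t) = fst (z t)" if "t \<in> I" for t
    using chart_inv_right[of "fst (z t)" c] z(1)[of t] that by (auto simp: \<gamma>_def inI mem_Times_iff)
  have zs: "smooth_on I z" 
  proof (rule smooth_on_integral_curve[OF I(1) _ _ F])
    show "(z has_vector_derivative F (z t)) (at t)" if "t \<in> I" for t using z(2) that inI by blast
    show "z ` I \<subseteq> ?\<Omega>" using z(1) inI by blast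
  qed
  have xs: "smooth_on I (\<lambda>t. fst (z t))" by (rule smooth_on_linear[OF I(1) bounded_linear_fst zs])
  have sm: "smooth_curve A I \<gamma>"
    unfolding smooth_curve_iff[OF atlas_A]
  proof (intro conjI I ballI)
    show "\<gamma> ` I \<subseteq> mcarrier A" using chart_mcarrier[OF c \<gamma>c(1)] by blast
    fix d assume d: "d \<in> A"
    let ?N = "snd c ` (fst c \<inter> fst d)"
    \<comment> \<open>The curve is built inside chart \<open>c\<close>; visits to another chart
      \<open>d\<close> are detected through the overlap \<open>?N\<close>, by injectivity of the
      coordinate map of \<open>c\<close>.\<close>
    have eq: "I \<inter> \<gamma> -` fst d = (\<lambda>t. fst (z t)) -` ?N \<inter> I"
    proof -
      have "\<gamma> t \<in> fst d \<longleftrightarrow> fst (z t) \<in> ?N" if tI: "t \<in> I" for t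
      proof
        assume "fst (z t) \<in> ?N"
        then obtain q where "q \<in> fst c" "q \<in> fst d" "snd c (\<gamma> t) = snd c q" using \<gamma>c(2)[OF tI] by auto
        then show "\<gamma> t \<in> fst d" using \<gamma>c(1)[OF tI] smooth_atlasD(1)[OF atlas_A c] by (metis inj_onD)
      qed (use \<gamma>c[OF tI] in \<open>metis IntI imageI\<close>)
      then show ?thesis by auto
    qed
    show o': "open (I \<inter> \<gamma> -` fst d)" unfolding eq
      using continuous_on_open_vimage[OF I(1)] smooth_on_continuous_on[OF xs] smooth_atlas_transition(1)[OF atlas_A c d] by blast
    have "smooth_on (I \<inter> \<gamma> -` fst d) (\<lambda>t. (snd d \<circ> chart_inv c) (fst (z t)))"
      by (rule smooth_on_compose[OF o' _ smooth_on_subset[OF xs] smooth_atlas_transition(2)[OF atlas_A c d]]) (auto simp: eq)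
    then show "smooth_on (I \<inter> \<gamma> -` fst d) (snd d \<circ> \<gamma>)" by (simp add: \<gamma>_def[abs_def] o_def)
  qed
  have vel: "snd (velocity A \<gamma> t) c = snd (z t)" if t: "t \<in> I" for t
  proof (rule velocity_eqI[where \<gamma>=\<gamma>, OF c \<gamma>c(1)[OF t]])
    have "(z has_vector_derivative F (z t)) (at t)" using z(2) t inI by blast
    from bounded_linear.has_vector_derivative[OF bounded_linear_fst this]
    have "((\<lambda>t. fst (z t)) has_vector_derivative snd (z t)) (at t)" by (simp add: F_def)
    then show "(snd c \<circ> \<gamma> has_vector_derivative snd (z t)) (at t)"
      by (rule has_vector_derivative_transform_within_open[OF _ I(1) t]) (simp add: \<gamma>c)
  qed
  have slit: "velocity A \<gamma> t \<in> slit_tangent_bundle A" if t: "t \<in> I" for t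
    using slit_iff_component[OF atlas_A velocity_in_tangent_bundle[OF atlas_A sm t] c] \<gamma>c(1)[OF t] vel[OF t] z(1)[of t] t
    by (auto simp: inI mem_Times_iff)
  have "velocity (tangent_atlas A) (velocity A \<gamma>) t = S (velocity A \<gamma> t)" if t: "t \<in> I" for t
    unfolding geodesic_equation_iff[OF sm t c \<gamma>c(1)[OF t] slit[OF t]]
  proof -
    have "(z has_vector_derivative F (z t)) (at t)" using z(2) t inI by blast
    from bounded_linear.has_vector_derivative[OF bounded_linear_snd this]
    have "((\<lambda>t. snd (z t)) has_vector_derivative f c (snd c (\<gamma> t)) (snd (velocity A \<gamma> t) c)) (at t)"
      by (simp add: F_def \<gamma>c[OF t] vel[OF t])
    then show "((\<lambda>s. snd (velocity A \<gamma> s) c) has_vector_derivative f c (snd c (\<gamma> t)) (snd (velocity A \<gamma> t) c)) (at t)"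
      by (rule has_vector_derivative_transform_within_open[OF _ I(1) t]) (simp add: vel)
  qed
  then have "spray_geodesic A S I \<gamma>" using sm slit by (simp add: spray_geodesic_def regular_curve_def)
  moreover have "\<gamma> 0 = p" using z0 p chart_inv_left[OF atlas_A c] by (simp add: \<gamma>_def)
  moreover have "snd (velocity A \<gamma> 0) c = y" using vel[OF I(4)] z0 by simp
  ultimately show ?thesis using \<epsilon> I_def by blast
qed

end

section \<open>Finsler metrics in charts\<close>

lemma energy_rep_eq:
  assumes "smooth_atlas A" "c \<in> A" "p \<in> fst c"
  shows "energy_rep A c E (snd c p) y = E (tangent_vector A c p y)"
  using assms tangent_chart(3)[OF assms(1,2), of "snd c p" y] chart_inv_left[OF assms]
  by (simp add: energy_rep_def chart_range_def)

lemma energy_rep_tangent: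
  assumes "smooth_atlas A" "c \<in> A" "u \<in> tangent_bundle A" "fst u \<in> fst c"
  shows "energy_rep A c E (snd c (fst u)) (snd u c) = E u"
  using energy_rep_eq[OF assms(1,2,4)] tangent_bundle_eq_tangent_vector[OF assms(3,2,4)] by simp

lemma finsler_chart_energy_rep:
  fixes A :: "('m, 'e::euclidean_space) atlas"
  assumes sp: "spray_atlas A S" and E: "finsler_metric A E" and c: "c \<in> A"
  shows "finsler_chart (chart_range c) (energy_rep A c E)"
proof -
  interpret spray_atlas A S by fact
  note TA = smooth_atlas_tangent_atlas[OF atlas_A]
  show ?thesis
  proof
    show "open (chart_range c)" by (rule smooth_atlasD(2)[OF atlas_A c])
    have "smooth_on (snd (tangent_chart A c) ` (slit_tangent_bundle A \<inter> fst (tangent_chart A c))) (E \<circ> chart_inv (tangent_chart A c))"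
      using E c unfolding finsler_metric_def smooth_map_on_euclidean_codomain_iff[OF TA] by (auto simp: tangent_atlas_def)
    then show "smooth_on (chart_range c \<times> - {0}) (case_prod (energy_rep A c E))"
      unfolding slit_chart_image[OF c] by (simp add: energy_rep_def[abs_def] o_def case_prod_unfold)
    fix x assume x: "x \<in> chart_range c"
    then obtain p where p: "p \<in> fst c" "x = snd c p" by (auto simp: chart_range_def)
    show "energy_rep A c E x (r *\<^sub>R y) = r\<^sup>2 * energy_rep A c E x y" if "r > 0" for r y
    proof -
      have "tangent_scale r (tangent_vector A c p y) = tangent_vector A c p (r *\<^sub>R y)"
        by (intro prod_eqI ext)
          (auto simp: tangent_scale_def tangent_vector_def linear_scale[OF linear_chart_change(1)[OF atlas_A c _ p(1)]])
      then show ?thesis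
        using E that tangent_vector(1)[OF atlas_A c p(1), of y] unfolding finsler_metric_def p(2) energy_rep_eq[OF atlas_A c p(1)] by metis
    qed
    show "0 < vertical_hessian (energy_rep A c E) x y w w" if "y \<noteq> 0" "w \<noteq> 0" for y w
      using E c x that unfolding finsler_metric_def by blast
  qed
qed

section \<open>Geodesic orbit sprays\<close>

locale go_spray_space = lie_group_atlas G B
  for G :: "('g, 'b) monoid_scheme" (structure) and B :: "('g, 'h::euclidean_space) atlas" +
  fixes A :: "('m, 'e::euclidean_space) atlas" and act :: "'g \<Rightarrow> 'm \<Rightarrow> 'm" and orig :: 'm
    and S :: "('m, 'e) tangent \<Rightarrow> (('m, 'e) tangent, 'e \<times> 'e) tangent"
  assumes manifold: "smooth_manifold A" and action: "smooth_transitive_action G B A act"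
    and orig: "orig \<in> mcarrier A" and quadratic: "quadratic_spray A S" and go: "go_spray G B A act orig S"
begin

sublocale spray_atlas A S
  using manifold quadratic by unfold_locales (auto simp: smooth_manifold_def quadratic_spray_def)

sublocale action: transitive_action G "mcarrier A" act
  using action by (simp add: smooth_transitive_action_def)

section \<open>The energy is constant along geodesics\<close>

lemma smooth_act:
  assumes g: "g \<in> carrier G" shows "smooth_map_on A (mcarrier A) A (act g)"
proof -
  have "smooth_map_on (product_atlas B A) (mcarrier B \<times> mcarrier A) A (\<lambda>(g, p). act g p)"
    using action by (simp add: smooth_transitive_action_def carrier_eq)
  from smooth_map_on_comp_Pair[OF atlas_A atlas_B atlas_A atlas_A smooth_map_on_const[OF atlas_A atlas_B] smooth_map_on_id_chart[OF atlas_A] this]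
  show ?thesis using g by (simp add: carrier_eq)
qed

lemma act_inv: "g \<in> carrier G \<Longrightarrow> p \<in> mcarrier A \<Longrightarrow> act (inv g) (act g p) = p"
  using action.orbit_sym_aux[of g p] by simp

lemma act_mcarrier: "g \<in> carrier G \<Longrightarrow> p \<in> mcarrier A \<Longrightarrow> act g p \<in> mcarrier A"
  using action.element_image by blast

lemma curve_in_mcarrier: "smooth_curve A I \<gamma> \<Longrightarrow> t \<in> I \<Longrightarrow> \<gamma> t \<in> mcarrier A"
  unfolding smooth_curve_iff[OF atlas_A] by blast

text \<open>\<open>go_spray\<close> provides only values of \<open>lie_exp\<close>. If
  \<open>X\<close> generated no one-parameter subgroup, these would be one and the same default
  value for all \<open>t \<noteq> 0\<close>, and a curve that is constant away from 0 contradicts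
  the nonvanishing velocity.\<close>

lemma geodesic_one_parameter_subgroup:
  assumes \<gamma>: "spray_geodesic A S I \<gamma>" "0 \<in> I" "\<gamma> 0 = orig"
  shows "\<exists>\<sigma>. one_parameter_subgroup G B \<sigma> \<and> (\<forall>t\<in>I. \<gamma> t = act (\<sigma> t) orig)"
proof -
  obtain X where X: "\<And>t. t \<in> I \<Longrightarrow> \<gamma> t = act (lie_exp G B (tangent_scale t X)) orig"
    using go \<gamma> unfolding go_spray_def by blast
  have sm: "smooth_curve A I \<gamma>" and slit: "\<And>t. t \<in> I \<Longrightarrow> velocity A \<gamma> t \<in> slit_tangent_bundle A"
    using \<gamma>(1) by (auto simp: spray_geodesic_def regular_curve_def)
  have I: "open I" using sm unfolding smooth_curve_iff[OF atlas_A] by blast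
  have "\<exists>\<sigma>. one_parameter_subgroup G B \<sigma> \<and> velocity B \<sigma> 0 = X"
  proof (rule ccontr)
    assume none: "\<nexists>\<sigma>. one_parameter_subgroup G B \<sigma> \<and> velocity B \<sigma> 0 = X"
    define q where "q = act (THE g. False) orig"
    have q: "\<gamma> t = q" if "t \<in> I - {0}" for t
      using that X[of t] lie_exp_no_subgroup[OF none, of t] by (simp add: q_def)
    have I0: "open (I - {0})" using I by (rule open_delete)
    obtain e where e: "e > 0" "ball 0 e \<subseteq> I" using I \<gamma>(2) openE by blast
    \<comment> \<open>A time other than 0 inside the interval, near which \<open>\<gamma>\<close>
      would be constant.\<close>
    have t: "e / 2 \<in> I - {0}" using e by (auto simp: subset_iff)
    obtain c where c: "c \<in> A" "\<gamma> (e / 2) \<in> fst c"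
      using curve_in_mcarrier[OF sm, of "e / 2"] t unfolding mcarrier_def by blast
    have "(snd c \<circ> \<gamma> has_vector_derivative 0) (at (e / 2))"
      by (rule has_vector_derivative_transform_within_open[OF has_vector_derivative_const[of "snd c q"] I0 t]) (simp add: q)
    then have "snd (velocity A \<gamma> (e / 2)) c = 0" by (rule velocity_eqI[where \<gamma>=\<gamma>, OF c])
    then show False
      using slit_iff_component[OF atlas_A velocity_in_tangent_bundle[OF atlas_A sm] c(1)] slit c(2) t by auto
  qed
  then show ?thesis using X lie_exp_scale by metis
qed

text \<open>Acting with \<open>\<sigma> t\<close> shifts time along the orbit:
  \<open>\<gamma> (t + s) = act (\<sigma> t) (\<gamma> s)\<close>. Hence the velocity at
  \<open>t\<close> is the image of the velocity at 0 under a group element, and \<open>E\<close>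
  does not see the difference.\<close>

lemma energy_constant_from_orig:
  assumes E: "invariant_function G A act E" and \<gamma>: "spray_geodesic A S I \<gamma>" "0 \<in> I" "\<gamma> 0 = orig" and t: "t \<in> I"
  shows "E (velocity A \<gamma> t) = E (velocity A \<gamma> 0)"
proof -
  obtain \<sigma> where \<sigma>: "one_parameter_subgroup G B \<sigma>" and \<gamma>\<sigma>: "\<And>t. t \<in> I \<Longrightarrow> \<gamma> t = act (\<sigma> t) orig"
    using geodesic_one_parameter_subgroup[OF \<gamma>] by blast
  note \<sigma>s = one_parameter_subgroup_facts[OF \<sigma>]
  have sm: "smooth_curve A I \<gamma>" using \<gamma>(1) by (auto simp: spray_geodesic_def regular_curve_def)
  have I: "open I" using sm unfolding smooth_curve_iff[OF atlas_A] by blast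
  \<comment> \<open>Times \<open>s\<close> for which both \<open>s\<close> and \<open>t + s\<close>
    lie in \<open>I\<close>, so that the shift identity makes sense.\<close>
  define N where "N = I \<inter> (\<lambda>s. t + s) -` I"
  have N: "open N" "0 \<in> N"
    using I \<gamma>(2) t by (auto simp: N_def intro!: open_Int open_vimage continuous_intros)
  have "velocity A \<gamma> t = velocity A (\<lambda>s. \<gamma> (t + s)) 0" by (rule velocity_shift[OF atlas_A sm t, symmetric])
  also have "\<dots> = velocity A (act (\<sigma> t) \<circ> \<gamma>) 0"
  proof (rule velocity_cong[OF N])
    fix s assume "s \<in> N"
    then have "t + s \<in> I" "s \<in> I" by (auto simp: N_def)
    then show "\<gamma> (t + s) = (act (\<sigma> t) \<circ> \<gamma>) s"
      using \<gamma>\<sigma> \<sigma>s(3)[of t s] action.composition_rule[OF orig \<sigma>s(2) \<sigma>s(2), of t s] by simp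
  qed
  also have "\<dots> = tangent_map A A (act (\<sigma> t)) (velocity A \<gamma> 0)"
    using curve_in_mcarrier[OF sm] by (intro velocity_compose[OF atlas_A atlas_A smooth_act[OF \<sigma>s(2)] sm _ \<gamma>(2)]) auto
  finally show ?thesis
    using E \<sigma>s(2) velocity_in_tangent_bundle[OF atlas_A sm \<gamma>(2)] by (simp add: invariant_function_def)
qed

text \<open>Homogeneity is assumed only at \<open>orig\<close>; transitivity moves the starting
  point there, and invariance of \<open>S\<close> and \<open>E\<close> carries the geodesic and its
  energy along.\<close>

lemma energy_constant:
  assumes E: "invariant_function G A act E" and \<gamma>: "spray_geodesic A S I \<gamma>" "0 \<in> I" and t: "t \<in> I"
  shows "E (velocity A \<gamma> t) = E (velocity A \<gamma> 0)"
proof -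
  have sm: "smooth_curve A I \<gamma>" using \<gamma>(1) by (auto simp: spray_geodesic_def regular_curve_def)
  obtain g where g: "g \<in> carrier G" "act g (\<gamma> 0) = orig"
    using action.unique_orbit[OF curve_in_mcarrier[OF sm \<gamma>(2)] orig] by blast
  have "spray_geodesic A S I (act g \<circ> \<gamma>)"
    using go g(1) by (intro spray_geodesic_image[OF atlas_A smooth_act smooth_act[of "inv g"] act_inv _ \<gamma>(1)])
      (auto simp: go_spray_def invariant_spray_def)
  then have "E (velocity A (act g \<circ> \<gamma>) t) = E (velocity A (act g \<circ> \<gamma>) 0)"
    using energy_constant_from_orig[OF E _ \<gamma>(2) _ t] g(2) by simp
  moreover have "E (velocity A (act g \<circ> \<gamma>) s) = E (velocity A \<gamma> s)" if s: "s \<in> I" for s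
  proof -
    have "velocity A (act g \<circ> \<gamma>) s = tangent_map A A (act g) (velocity A \<gamma> s)"
      using curve_in_mcarrier[OF sm] by (intro velocity_compose[OF atlas_A atlas_A smooth_act[OF g(1)] sm _ s]) auto
    then show ?thesis using E g(1) velocity_in_tangent_bundle[OF atlas_A sm s] by (simp add: invariant_function_def)
  qed
  ultimately show ?thesis using t \<gamma>(2) by simp
qed

end

section \<open>Pointwise identities for an invariant, projectively compatible energy\<close>

locale invariant_finsler_go_space = go_spray_space G B A act orig S
  for G :: "('g, 'b) monoid_scheme" (structure) and B :: "('g, 'h::euclidean_space) atlas"
    and A :: "('m, 'e::euclidean_space) atlas" and act :: "'g \<Rightarrow> 'm \<Rightarrow> 'm" and orig :: 'm
    and S :: "('m, 'e) tangent \<Rightarrow> (('m, 'e) tangent, 'e \<times> 'e) tangent" +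
  fixes E :: "('m, 'e) tangent \<Rightarrow> real"
  assumes finsler: "finsler_metric A E" and invariant: "invariant_function G A act E"
    and projective: "projectively_equivalent (metric_geodesic A E) (spray_geodesic A S)"
begin

abbreviation "L \<equiv> \<lambda>c. energy_rep A c E"
abbreviation "D \<equiv> \<lambda>c. finsler_chart.D (L c)"
abbreviation "D2 \<equiv> \<lambda>c. finsler_chart.D2 (L c)"

lemma finsler_chart_L: "c \<in> A \<Longrightarrow> finsler_chart (chart_range c) (L c)"
  by (rule finsler_chart_energy_rep[OF spray_atlas_axioms finsler])

lemma chart_range_I: "p \<in> fst c \<Longrightarrow> snd c p \<in> chart_range c"
  by (simp add: chart_range_def)

text \<open>The equation \<open>S E = 0\<close>, read off at time 0 of the geodesic with initial
  velocity \<open>y\<close>.\<close>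

lemma energy_derivative_along_spray:
  assumes c: "c \<in> A" and p: "p \<in> fst c" and y: "y \<noteq> 0"
  shows "D c (snd c p, y) (y, f c (snd c p) y) = 0"
proof -
  interpret fc: finsler_chart "chart_range c" "L c" by (rule finsler_chart_L[OF c])
  obtain \<epsilon> \<gamma> where \<epsilon>: "\<epsilon> > 0" and \<gamma>: "spray_geodesic A S {- \<epsilon><..<\<epsilon>} \<gamma>" "\<gamma> 0 = p" "snd (velocity A \<gamma> 0) c = y"
    using geodesic_exists[OF c p y] by blast
  let ?I = "{- \<epsilon><..<\<epsilon>}" let ?z = "\<lambda>s. (snd c (\<gamma> s), snd (velocity A \<gamma> s) c)"
  have I: "0 \<in> ?I" using \<epsilon> by simp
  have sm: "smooth_curve A ?I \<gamma>" and slit: "velocity A \<gamma> 0 \<in> slit_tangent_bundle A"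
    and geo: "velocity (tangent_atlas A) (velocity A \<gamma>) 0 = S (velocity A \<gamma> 0)"
    using \<gamma>(1) I by (auto simp: spray_geodesic_def regular_curve_def)
  have "(?z has_vector_derivative (y, f c (snd c p) y)) (at 0)"
    using velocity_velocity_component[OF sm I c] S_component[OF slit c] p \<gamma>(2,3) geo by simp
  then have z: "(?z has_derivative (\<lambda>h. h *\<^sub>R (y, f c (snd c p) y))) (at 0)" by (simp add: has_vector_derivative_def)
  have D0: "(case_prod (L c) has_derivative D c (snd c p, y)) (at (?z 0))"
    using fc.D[OF chart_range_I[OF p] y] \<gamma>(2,3) by simp
  have "((\<lambda>s. case_prod (L c) (?z s)) has_derivative (\<lambda>h. D c (snd c p, y) (h *\<^sub>R (y, f c (snd c p) y)))) (at 0)"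
    by (rule has_derivative_compose[OF z D0])
  moreover have "((\<lambda>s. case_prod (L c) (?z s)) has_derivative (\<lambda>h. 0)) (at 0)"
  proof (rule has_derivative_transform_within_open[OF has_derivative_const[of "E (velocity A \<gamma> 0)"]])
    show "open (?I \<inter> \<gamma> -` fst c)" using sm c unfolding smooth_curve_iff[OF atlas_A] by blast
    fix s assume s: "s \<in> ?I \<inter> \<gamma> -` fst c"
    then have "E (velocity A \<gamma> s) = E (velocity A \<gamma> 0)" by (intro energy_constant[OF invariant \<gamma>(1) I]) auto
    then show "E (velocity A \<gamma> 0) = case_prod (L c) (?z s)"
      using energy_rep_tangent[OF atlas_A c velocity_in_tangent_bundle[OF atlas_A sm, of s]] s by simp
  qed (use I p \<gamma>(2) in simp)
  ultimately have "(\<lambda>h. D c (snd c p, y) (h *\<^sub>R (y, f c (snd c p) y))) = (\<lambda>h. 0)" by (rule has_derivative_unique)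
  from fun_cong[OF this, of 1] show ?thesis by simp
qed

text \<open>Projective equivalence gives the Euler-Lagrange equations only after a reparametrization
  \<open>\<phi>\<close>. At the time \<open>s0\<close> with \<open>\<phi> s0 = 0\<close>, the new
  curve has velocity \<open>\<rho> y\<close> and acceleration \<open>\<rho>^2 f + \<mu> y\<close>;
  \<open>euler_lagrange_reparametrization\<close>, fed with \<open>S E = 0\<close>, eliminates
  \<open>\<rho>\<close> and \<open>\<mu>\<close>.\<close>

lemma euler_lagrange_spray:
  assumes c: "c \<in> A" and p: "p \<in> fst c" and y: "y \<noteq> 0"
  shows "D2 c (snd c p, y) (0, w) (y, f c (snd c p) y) = D c (snd c p, y) (w, 0)"
proof -
  interpret fc: finsler_chart "chart_range c" "L c" by (rule finsler_chart_L[OF c])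
  obtain \<epsilon> \<gamma> where \<epsilon>: "\<epsilon> > 0" and \<gamma>: "spray_geodesic A S {- \<epsilon><..<\<epsilon>} \<gamma>" "\<gamma> 0 = p" "snd (velocity A \<gamma> 0) c = y"
    using geodesic_exists[OF c p y] by blast
  define I where "I = {- \<epsilon><..<\<epsilon>}"
  note \<gamma>I = \<gamma>(1)[folded I_def]
  have I: "0 \<in> I" using \<epsilon> by (simp add: I_def)
  have sm: "smooth_curve A I \<gamma>" and slit: "\<And>t. t \<in> I \<Longrightarrow> velocity A \<gamma> t \<in> slit_tangent_bundle A"
    and geo: "\<And>t. t \<in> I \<Longrightarrow> velocity (tangent_atlas A) (velocity A \<gamma>) t = S (velocity A \<gamma> t)"
    using \<gamma>I by (auto simp: spray_geodesic_def regular_curve_def)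
  obtain J \<phi> where \<phi>: "oriented_reparametrization J I \<phi>" and EL: "metric_geodesic A E J (\<gamma> \<circ> \<phi>)"
    using projective \<gamma>I unfolding projectively_equivalent_def by blast
  have J: "open J" "\<phi> ` J = I" and \<phi>s: "smooth_on J \<phi>" and \<phi>pos: "\<And>s. s \<in> J \<Longrightarrow> deriv \<phi> s > 0"
    using \<phi> by (auto simp: oriented_reparametrization_def)
  obtain s0 where s0: "s0 \<in> J" "\<phi> s0 = 0" using J(2) I by (metis imageE)
  have \<phi>d: "(\<phi> has_real_derivative deriv \<phi> s) (at s)" if "s \<in> J" for s
    using smooth_on_has_derivative[OF \<phi>s that] DERIV_deriv_iff_real_differentiable[of \<phi> s]
    by (auto simp: differentiable_def)
  have "frechet_derivative \<phi> (at s) 1 = deriv \<phi> s" if "s \<in> J" for s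
    using frechet_derivative_at[OF \<phi>d[OF that, unfolded has_field_derivative_def]] by (metis mult.right_neutral)
  then have \<phi>'s: "smooth_on J (deriv \<phi>)"
    by (intro smooth_on_cong[OF J(1) _ smooth_on_derivative[OF \<phi>s, of 1]]) simp
  then obtain \<mu> where \<mu>: "(deriv \<phi> has_real_derivative \<mu>) (at s0)"
    using smooth_on_has_derivative[OF \<phi>'s s0(1)] DERIV_deriv_iff_real_differentiable[of "deriv \<phi>" s0]
    by (auto simp: differentiable_def)
  define x where "x s = snd c (\<gamma> s)" for s
  define u where "u s = snd (velocity A \<gamma> s) c" for s
  define \<rho> where "\<rho> = deriv \<phi> s0"
  have \<rho>: "\<rho> > 0" using \<phi>pos[OF s0(1)] by (simp add: \<rho>_def)
  have No: "open (I \<inter> \<gamma> -` fst c)" using sm c unfolding smooth_curve_iff[OF atlas_A] by blast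
  define N where "N = \<phi> -` (I \<inter> \<gamma> -` fst c) \<inter> J"
  have N: "open N" "s0 \<in> N"
  proof -
    show "open N" unfolding N_def
      using continuous_on_open_vimage[OF J(1), of \<phi>] smooth_on_continuous_on[OF \<phi>s] No by blast
  qed (use s0 I p \<gamma>(2) in \<open>simp add: N_def\<close>)
  have NI: "s \<in> J" "\<phi> s \<in> I" "\<gamma> (\<phi> s) \<in> fst c" if "s \<in> N" for s using that by (auto simp: N_def)
  have x': "(x has_vector_derivative u t) (at t)" if "t \<in> I" "\<gamma> t \<in> fst c" for t
    using has_vector_derivative_velocity[OF atlas_A sm that(1) c that(2)] by (simp add: x_def[abs_def] u_def o_def)
  have u0: "u 0 = y" "x 0 = snd c p" using \<gamma> by (auto simp: u_def x_def)
  have u_nz: "u t \<noteq> 0" if "t \<in> I" "\<gamma> t \<in> fst c" for t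
    using slit_iff_component[OF atlas_A velocity_in_tangent_bundle[OF atlas_A sm that(1)] c] slit[OF that(1)] that(2) by (simp add: u_def)
  have u': "(u has_vector_derivative f c (snd c p) y) (at 0)"
    using geodesic_equation_iff[OF sm I c _ slit[OF I]] geo[OF I] p \<gamma>(2,3) by (simp add: u_def[abs_def])
  have x\<phi>: "((\<lambda>s. x (\<phi> s)) has_vector_derivative deriv \<phi> s *\<^sub>R u (\<phi> s)) (at s)" if "s \<in> N" for s
    using vector_diff_chain_at[OF \<phi>d[OF NI(1)[OF that], unfolded has_real_derivative_iff_has_vector_derivative] x'[OF NI(2,3)[OF that]]]
    by (simp add: o_def)
  have u\<phi>: "((\<lambda>s. u (\<phi> s)) has_vector_derivative \<rho> *\<^sub>R f c (snd c p) y) (at s0)"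
    using vector_diff_chain_at[OF \<phi>d[OF s0(1), unfolded has_real_derivative_iff_has_vector_derivative], of u "f c (snd c p) y"] u' s0(2)
    by (simp add: o_def \<rho>_def)
  \<comment> \<open>The acceleration of the reparametrized curve: the geodesic equation supplies the
    part along \<open>f\<close>, the second derivative \<open>\<mu>\<close> of \<open>\<phi>\<close>
    the radial part.\<close>
  have v\<phi>: "((\<lambda>s. deriv \<phi> s *\<^sub>R u (\<phi> s)) has_vector_derivative \<rho>\<^sup>2 *\<^sub>R f c (snd c p) y + \<mu> *\<^sub>R y) (at s0)"
    using has_vector_derivative_scaleR[OF \<mu> u\<phi>] by (simp add: \<rho>_def s0(2) u0 power2_eq_square)
  have vd: "vector_derivative (snd c \<circ> (\<gamma> \<circ> \<phi>)) (at s) = deriv \<phi> s *\<^sub>R u (\<phi> s)" if "s \<in> N" for s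
    using vector_derivative_at[OF x\<phi>[OF that]] by (simp add: x_def o_def)
  have "D2 c (snd c p, \<rho> *\<^sub>R y) (0, w) (\<rho> *\<^sub>R y, \<rho>\<^sup>2 *\<^sub>R f c (snd c p) y + \<mu> *\<^sub>R y) = D c (snd c p, \<rho> *\<^sub>R y) (w, 0)" for w
  proof -
    have xp: "snd c p \<in> chart_range c" and \<rho>y: "\<rho> *\<^sub>R y \<noteq> 0" using p y \<rho> by (auto simp: chart_range_def)
    have "euler_lagrange_at A E (\<gamma> \<circ> \<phi>) c s0"
      using EL s0 c p \<gamma>(2) by (simp add: metric_geodesic_def)
    then have "((\<lambda>s. frechet_derivative (L c (x (\<phi> s))) (at (vector_derivative (snd c \<circ> (\<gamma> \<circ> \<phi>)) (at s))) w)
        has_real_derivative frechet_derivative (\<lambda>z. L c z (\<rho> *\<^sub>R y)) (at (snd c p)) w) (at s0)"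
      by (simp add: euler_lagrange_at_def Let_def vd[OF N(2)] s0(2) u0 \<rho>_def \<gamma>(2) x_def)
    then have "((\<lambda>s. D c (x (\<phi> s), deriv \<phi> s *\<^sub>R u (\<phi> s)) (0, w))
        has_real_derivative D c (snd c p, \<rho> *\<^sub>R y) (w, 0)) (at s0)"
      unfolding fc.horizontal_derivative[OF xp \<rho>y]
    proof (rule has_field_derivative_transform_within_open[OF _ N])
      fix s assume s: "s \<in> N"
      have "x (\<phi> s) \<in> chart_range c" "deriv \<phi> s *\<^sub>R u (\<phi> s) \<noteq> 0"
        using NI[OF s] u_nz \<phi>pos[OF NI(1)[OF s]] by (auto simp: x_def chart_range_def)
      then show "frechet_derivative (L c (x (\<phi> s))) (at (vector_derivative (snd c \<circ> (\<gamma> \<circ> \<phi>)) (at s))) w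
          = D c (x (\<phi> s), deriv \<phi> s *\<^sub>R u (\<phi> s)) (0, w)"
        unfolding vd[OF s] by (rule fc.vertical_derivative)
    qed
    moreover have "((\<lambda>s. D c (x (\<phi> s), deriv \<phi> s *\<^sub>R u (\<phi> s)) (0, w)) has_real_derivative
        D2 c (snd c p, \<rho> *\<^sub>R y) (0, w) (\<rho> *\<^sub>R y, \<rho>\<^sup>2 *\<^sub>R f c (snd c p) y + \<mu> *\<^sub>R y)) (at s0)"
    proof -
      let ?z' = "(\<rho> *\<^sub>R y, \<rho>\<^sup>2 *\<^sub>R f c (snd c p) y + \<mu> *\<^sub>R y)"
      have "((\<lambda>s. (x (\<phi> s), deriv \<phi> s *\<^sub>R u (\<phi> s))) has_derivative (\<lambda>h. (h *\<^sub>R \<rho> *\<^sub>R y, h *\<^sub>R (\<rho>\<^sup>2 *\<^sub>R f c (snd c p) y + \<mu> *\<^sub>R y)))) (at s0)"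
        using has_derivative_Pair[OF x\<phi>[OF N(2), unfolded has_vector_derivative_def] v\<phi>[unfolded has_vector_derivative_def]]
        by (simp add: \<rho>_def s0(2) u0)
      then have z: "((\<lambda>s. (x (\<phi> s), deriv \<phi> s *\<^sub>R u (\<phi> s))) has_derivative (\<lambda>h. h *\<^sub>R ?z')) (at s0)"
        by (simp only: scaleR_Pair)
      have D2: "((\<lambda>z. D c z (0, w)) has_derivative D2 c (snd c p, \<rho> *\<^sub>R y) (0, w)) (at (x (\<phi> s0), deriv \<phi> s0 *\<^sub>R u (\<phi> s0)))"
        using fc.D2[OF xp \<rho>y] by (simp add: s0(2) u0 \<rho>_def)
      have "((\<lambda>s. D c (x (\<phi> s), deriv \<phi> s *\<^sub>R u (\<phi> s)) (0, w)) has_derivative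
          (\<lambda>h. D2 c (snd c p, \<rho> *\<^sub>R y) (0, w) (h *\<^sub>R ?z'))) (at s0)"
        by (rule has_derivative_compose[where g="\<lambda>z. D c z (0, w)", OF z D2])
      also have "(\<lambda>h. D2 c (snd c p, \<rho> *\<^sub>R y) (0, w) (h *\<^sub>R ?z')) = (*) (D2 c (snd c p, \<rho> *\<^sub>R y) (0, w) ?z')"
        by (rule ext) (simp only: linear_scale[OF fc.linear_D2[OF xp \<rho>y]] real_scaleR_def mult.commute)
      finally show ?thesis by (simp add: has_field_derivative_def)
    qed
    ultimately show ?thesis using DERIV_unique by blast
  qed
  then show ?thesis
    by (intro fc.euler_lagrange_reparametrization[OF chart_range_I[OF p] y \<rho> energy_derivative_along_spray[OF c p y]])
qed

end

section \<open>The averaged Riemannian metric\<close>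

lemma energy_rep_chart_change:
  assumes A: "smooth_atlas A" and "c \<in> A" "d \<in> A" "p \<in> fst c" "p \<in> fst d"
  shows "energy_rep A c E (snd c p) y = energy_rep A d E (snd d p) (chart_change c d p y)"
proof -
  have "tangent_vector A c p y = tangent_vector A d p (chart_change c d p y)"
    using tangent_bundle_eq_tangent_vector[of "tangent_vector A c p y" A d] tangent_vector[OF A assms(2,4), of y] assms
    by (simp add: tangent_vector_def)
  then show ?thesis using energy_rep_eq[OF A] assms by metis
qed

text \<open>The choice of the chart is immaterial because \<open>legendre_form\<close> is equivariant under linear
  isomorphisms.\<close>

definition legendre_energy ::
  "('m, 'e::euclidean_space) atlas \<Rightarrow> (('m, 'e) tangent \<Rightarrow> real) \<Rightarrow> ('m, 'e) tangent \<Rightarrow> real" where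
  "legendre_energy A E u = (let c = SOME c. c \<in> A \<and> fst u \<in> fst c in
     legendre_form (energy_rep A c E (snd c (fst u))) (snd u c) (snd u c))"

section \<open>The affine connection of the spray and the averaged energy\<close>

context invariant_finsler_go_space
begin

lemma quadratic_gauge_L: "c \<in> A \<Longrightarrow> p \<in> fst c \<Longrightarrow> quadratic_gauge (L c (snd c p))"
  by (rule finsler_chart.quadratic_gauge_L[OF finsler_chart_L chart_range_I])

text \<open>Some bilinear form with the right values on the diagonal. \<open>quadratic_spray\<close>
  grants one separately at each \<open>x\<close>, with neither symmetry nor regularity in
  \<open>x\<close>.\<close>

definition coefficient_form :: "('m, 'e) chart \<Rightarrow> 'e \<Rightarrow> 'e \<Rightarrow> 'e \<Rightarrow> 'e" where
  "coefficient_form c x = (SOME B. bilinear B \<and> (\<forall>y. y \<noteq> 0 \<longrightarrow> f c x y = B y y))"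

text \<open>Symmetrizing removes the ambiguity of the choice: by polarization the result is
  determined by the values of \<open>f\<close>.\<close>

definition \<Gamma> :: "('m, 'e) chart \<Rightarrow> 'e \<Rightarrow> 'e \<Rightarrow> 'e \<Rightarrow> 'e" where
  "\<Gamma> c x a b = (1/2) *\<^sub>R (coefficient_form c x a b + coefficient_form c x b a)"

lemma coefficient_form:
  assumes "c \<in> A" "x \<in> chart_range c"
  shows "bilinear (coefficient_form c x)" "y \<noteq> 0 \<Longrightarrow> f c x y = coefficient_form c x y y"
proof -
  have "quadratic_on (- {0}) (f c x)"
    using quadratic assms by (simp add: quadratic_spray_def spray_coefficient_def[abs_def])
  then obtain B where "bilinear B" "\<forall>y\<in>- {0}. f c x y = B y y" unfolding quadratic_on_def by blast
  then have "\<exists>B. bilinear B \<and> (\<forall>y. y \<noteq> 0 \<longrightarrow> f c x y = B y y)" by (intro exI[of _ B]) simp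
  from someI_ex[OF this] show "bilinear (coefficient_form c x)" "y \<noteq> 0 \<Longrightarrow> f c x y = coefficient_form c x y y"
    by (auto simp: coefficient_form_def)
qed

lemma \<Gamma>_diagonal: "c \<in> A \<Longrightarrow> x \<in> chart_range c \<Longrightarrow> y \<noteq> 0 \<Longrightarrow> \<Gamma> c x y y = f c x y"
  using coefficient_form(2)[of c x y] by (simp add: \<Gamma>_def scaleR_2[symmetric])

lemma bilinear_\<Gamma>:
  assumes "c \<in> A" "x \<in> chart_range c" shows "bilinear (\<Gamma> c x)"
  using coefficient_form(1)[OF assms]
  by (auto simp: bilinear_def \<Gamma>_def linear_iff algebra_simps)

lemma \<Gamma>_symmetric: "\<Gamma> c x a b = \<Gamma> c x b a"
  by (simp add: \<Gamma>_def add.commute)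

text \<open>Polarization expresses \<open>\<Gamma>\<close> through \<open>f\<close> at
  \<open>a\<close>, \<open>b\<close> and \<open>a + b\<close>, although the chosen forms need not
  depend smoothly on \<open>x\<close>. Smoothness of \<open>f\<close> holds off the zero vector
  only, hence the restriction to basis vectors, for which \<open>a + b\<close> is nonzero.\<close>

lemma smooth_\<Gamma>:
  assumes c: "c \<in> A" and ab: "a \<in> Basis" "b \<in> Basis" shows "smooth_on (chart_range c) (\<lambda>x. \<Gamma> c x a b)"
proof -
  let ?U = "chart_range c"
  have U: "open ?U" by (rule smooth_atlasD(2)[OF atlas_A c])
  have nz: "a \<noteq> 0" "b \<noteq> 0" "a + b \<noteq> 0"
  proof -
    show "a \<noteq> 0" "b \<noteq> 0" using ab nonzero_Basis by auto
    have "(a + b) \<bullet> a > 0" using ab by (cases "a = b") (auto simp: inner_add_left inner_Basis)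
    then show "a + b \<noteq> 0" by auto
  qed
  have fs: "smooth_on ?U (\<lambda>x. f c x y)" if "y \<noteq> 0" for y
  proof -
    have "smooth_on ?U (\<lambda>x. case_prod (f c) (x, y))"
      using that by (intro smooth_on_compose[OF U _ smooth_on_Pair[OF U smooth_on_id[OF U] smooth_on_const[OF U]] smooth_f[OF c]]) auto
    then show ?thesis by simp
  qed
  have "smooth_on ?U (\<lambda>x. (1/2) *\<^sub>R (f c x (a + b) + ((- 1) *\<^sub>R f c x a + (- 1) *\<^sub>R f c x b)))"
    by (intro smooth_on_linear[OF U bounded_linear_scaleR_right] smooth_on_add[OF U] fs nz)
  then show ?thesis
  proof (rule smooth_on_cong[OF U, rotated])
    fix x assume x: "x \<in> ?U"
    show "\<Gamma> c x a b = (1/2) *\<^sub>R (f c x (a + b) + ((- 1) *\<^sub>R f c x a + (- 1) *\<^sub>R f c x b))"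
      using coefficient_form[OF c x] nz
      by (simp add: \<Gamma>_def bilinear_ladd[OF coefficient_form(1)[OF c x]] bilinear_radd[OF coefficient_form(1)[OF c x]])
  qed
qed

lemma horizontal_finsler_chart_L:
  assumes c: "c \<in> A" shows "horizontal_finsler_chart (chart_range c) (L c) (\<Gamma> c)"
proof -
  interpret fc: finsler_chart "chart_range c" "L c" by (rule finsler_chart_L[OF c])
  show ?thesis
  proof
    fix x assume x: "x \<in> chart_range c"
    then obtain p where p: "p \<in> fst c" "x = snd c p" by (auto simp: chart_range_def)
    show "bilinear (\<Gamma> c x)" by (rule bilinear_\<Gamma>[OF c x])
    show "fc.D (x, y) (w, \<Gamma> c x w y) = 0" if y: "y \<noteq> 0" for y w
      using energy_derivative_along_spray[OF c p(1)] euler_lagrange_spray[OF c p(1) y]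
      by (intro fc.horizontally_constant[OF x y bilinear_\<Gamma>[OF c x] \<Gamma>_symmetric])
        (simp_all add: \<Gamma>_diagonal[OF c x] y p(2)[symmetric])
  qed (use smooth_\<Gamma>[OF c] \<Gamma>_symmetric in auto)
qed

lemma legendre_energy_chart:
  assumes u: "u \<in> tangent_bundle A" and c: "c \<in> A" "fst u \<in> fst c"
  shows "legendre_energy A E u = legendre_form (L c (snd c (fst u))) (snd u c) (snd u c)"
proof -
  define d where "d = (SOME c. c \<in> A \<and> fst u \<in> fst c)"
  have d: "d \<in> A" "fst u \<in> fst d" using someI[of "\<lambda>c. c \<in> A \<and> fst u \<in> fst c"] c by (auto simp: d_def)
  have "L c (snd c (fst u)) = (\<lambda>y. L d (snd d (fst u)) (chart_change c d (fst u) y))"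
    using energy_rep_chart_change[OF atlas_A c(1) d(1) c(2) d(2)] by blast
  then have "legendre_form (L c (snd c (fst u))) (snd u c) (snd u c)
      = legendre_form (L d (snd d (fst u))) (chart_change c d (fst u) (snd u c)) (chart_change c d (fst u) (snd u c))"
    using legendre_form_linear_change[OF quadratic_gauge_L[OF d] linear_chart_change[OF atlas_A c(1) d(1) c(2) d(2)]] by simp
  then show ?thesis
    using tangent_bundle_component[OF u c(1) d(1) c(2) d(2)] by (simp add: legendre_energy_def d_def[symmetric])
qed

lemma energy_rep_legendre_energy:
  assumes c: "c \<in> A" and x: "x \<in> chart_range c"
  shows "energy_rep A c (legendre_energy A E) x y = legendre_form (L c x) y y"
proof -
  obtain p where p: "p \<in> fst c" "x = snd c p" using x by (auto simp: chart_range_def)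
  have "energy_rep A c (legendre_energy A E) x y = legendre_energy A E (tangent_vector A c p y)"
    unfolding p(2) by (rule energy_rep_eq[OF atlas_A c p(1)])
  then show ?thesis
    using legendre_energy_chart[OF tangent_vector(1)[OF atlas_A c p(1)] c] tangent_vector(2,3)[OF atlas_A c p(1)] p by simp
qed

text \<open>In charts, a group element acts between fibres by a linear isomorphism \<open>?R\<close>
  that pulls \<open>E\<close> back to itself; equivariance of \<open>legendre_form\<close> passes
  this on to the average.\<close>

lemma invariant_legendre_energy: "invariant_function G A act (legendre_energy A E)"
  unfolding invariant_function_def
proof (intro ballI)
  fix g u assume g: "g \<in> carrier G" and u: "u \<in> tangent_bundle A"
  note p = fst_tangent_bundle[OF u]
  let ?T = "tangent_map A A (act g)"
  have gp: "act g (fst u) \<in> mcarrier A" using act_mcarrier[OF g p] .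
  obtain c where c: "c \<in> A" "fst u \<in> fst c" using p unfolding mcarrier_def by blast
  obtain d where d: "d \<in> A" "act g (fst u) \<in> fst d" using gp unfolding mcarrier_def by blast
  let ?R = "rep_derivative c d (act g) (fst u)"
  have R_lin: "linear ?R"
    using smooth_on_has_derivative_rep[OF atlas_A atlas_A smooth_act[OF g] c(1) d(1) p c(2) d(2)] has_derivative_linear by blast
  have comp: "snd (?T v) d = ?R (snd v c)" if "v \<in> tangent_bundle A" "fst v = fst u" for v
    using tangent_map_component[OF atlas_A atlas_A smooth_act[OF g] that(1) _ c(1) _ d(1)] that(2) p c d by simp
  have Tin: "?T v \<in> tangent_bundle A" if "v \<in> tangent_bundle A" for v
    by (rule tangent_map_in_tangent_bundle[OF atlas_A atlas_A smooth_act[OF g] that fst_tangent_bundle[OF that]])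
  \<comment> \<open>The inverse group element prevents a nonzero vector from being mapped to
    zero.\<close>
  have R_inj: "inj ?R"
  proof (subst linear_injective_0[OF R_lin], intro allI impI, rule ccontr)
    fix y assume 0: "?R y = 0" and y: "y \<noteq> 0"
    let ?v = "tangent_vector A c (fst u) y"
    note v = tangent_vector[OF atlas_A c(1,2), of y]
    have "?T ?v \<in> slit_tangent_bundle A"
      using slit_tangent_vector[OF c, of y] y act_inv[OF g] g
      by (intro tangent_map_slit[OF atlas_A smooth_act[OF g] smooth_act[of "inv g"]]) auto
    then show False
      using slit_iff_component[OF atlas_A Tin[OF v(1)] d(1)] comp[OF v(1,2)] v d(2) 0 by simp
  qed
  have "L c (snd c (fst u)) = (\<lambda>y. L d (snd d (act g (fst u))) (?R y))"
  proof
    fix y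
    let ?v = "tangent_vector A c (fst u) y"
    note v = tangent_vector[OF atlas_A c(1,2), of y]
    have "L d (snd d (act g (fst u))) (?R y) = E (?T ?v)"
      using energy_rep_tangent[OF atlas_A d(1) Tin[OF v(1)], of E] comp[OF v(1,2)] v d(2) by simp
    also have "\<dots> = E ?v" using invariant g v(1) by (simp add: invariant_function_def)
    also have "\<dots> = L c (snd c (fst u)) y" using energy_rep_eq[OF atlas_A c] by simp
    finally show "L c (snd c (fst u)) y = L d (snd d (act g (fst u))) (?R y)" by simp
  qed
  then have "legendre_form (L c (snd c (fst u))) (snd u c) (snd u c)
      = legendre_form (L d (snd d (act g (fst u)))) (?R (snd u c)) (?R (snd u c))"
    using legendre_form_linear_change[OF quadratic_gauge_L[OF d] R_lin R_inj] by simp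
  then show "legendre_energy A E (?T u) = legendre_energy A E u"
    using legendre_energy_chart[OF u c] legendre_energy_chart[OF Tin[OF u] d(1)] comp[OF u] d(2) by simp
qed

lemma riemannian_legendre_energy: "riemannian_metric A (legendre_energy A E)"
  unfolding riemannian_metric_def finsler_metric_def
proof (intro conjI ballI allI impI)
  show "smooth_map_on (tangent_atlas A) (slit_tangent_bundle A) euclidean_atlas (legendre_energy A E)"
    unfolding smooth_map_on_euclidean_codomain_iff[OF atlas_TA]
  proof (intro conjI ballI)
    show "slit_tangent_bundle A \<subseteq> mcarrier (tangent_atlas A)" using slit_subset by (auto simp: mcarrier_tangent_atlas)
    fix k assume "k \<in> tangent_atlas A"
    then obtain c where c: "c \<in> A" "k = tangent_chart A c" by (auto simp: tangent_atlas_def)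
    interpret h: horizontal_finsler_chart "chart_range c" "L c" "\<Gamma> c" by (rule horizontal_finsler_chart_L[OF c(1)])
    show "open (snd k ` (slit_tangent_bundle A \<inter> fst k))"
      unfolding c(2) slit_chart_image[OF c(1)] by (rule open_slit_chart[OF c(1)])
    have "smooth_on (chart_range c \<times> - {0}) (\<lambda>(x, y). h.g x y y)"
      by (rule smooth_on_subset[OF h.smooth_quadratic_form]) auto
    then have "smooth_on (chart_range c \<times> - {0}) (legendre_energy A E \<circ> chart_inv k)"
    proof (rule smooth_on_cong[OF open_slit_chart[OF c(1)], rotated])
      fix z assume "z \<in> chart_range c \<times> - {0::'e}"
      then have "fst z \<in> chart_range c" by auto
      from energy_rep_legendre_energy[OF c(1) this, of "snd z"]
      show "(legendre_energy A E \<circ> chart_inv k) z = (case z of (x, y) \<Rightarrow> h.g x y y)"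
        by (simp add: energy_rep_def[of A c "legendre_energy A E"] c(2) h.g_def case_prod_unfold)
    qed
    then show "smooth_on (snd k ` (slit_tangent_bundle A \<inter> fst k)) (legendre_energy A E \<circ> chart_inv k)"
      unfolding c(2) slit_chart_image[OF c(1)] .
  qed
next
  fix u and r :: real assume u: "u \<in> tangent_bundle A" and "0 < r"
  obtain c where c: "c \<in> A" "fst u \<in> fst c" using fst_tangent_bundle[OF u] unfolding mcarrier_def by blast
  have bil: "bilinear (legendre_form (L c (snd c (fst u))))" by (rule bilinear_legendre_form[OF quadratic_gauge_L[OF c]])
  have "tangent_scale r u = tangent_vector A c (fst u) (r *\<^sub>R snd u c)"
  proof (intro prod_eqI ext)
    fix d
    show "snd (tangent_scale r u) d = snd (tangent_vector A c (fst u) (r *\<^sub>R snd u c)) d"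
      using tangent_bundle_component[OF u c(1) _ c(2), of d] tangent_bundle_outside[OF u, of d]
        linear_scale[OF linear_chart_change(1)[OF atlas_A c(1) _ c(2), of d], of r "snd u c"]
      by (simp add: tangent_scale_def tangent_vector_def)
  qed (simp add: tangent_scale_def tangent_vector_def)
  then have "tangent_scale r u \<in> tangent_bundle A" using tangent_vector(1)[OF atlas_A c] by simp
  then show "legendre_energy A E (tangent_scale r u) = r\<^sup>2 * legendre_energy A E u"
    using legendre_energy_chart[OF u c] legendre_energy_chart[of "tangent_scale r u" c] c
    by (simp add: tangent_scale_def bilinear_lmul[OF bil] bilinear_rmul[OF bil] power2_eq_square)
next
  fix c x and y w :: 'e assume c: "c \<in> A" and x: "x \<in> chart_range c" and w: "w \<noteq> 0"
  interpret h: horizontal_finsler_chart "chart_range c" "L c" "\<Gamma> c" by (rule horizontal_finsler_chart_L[OF c])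
  have "energy_rep A c (legendre_energy A E) x = (\<lambda>y. h.g x y y)"
    using energy_rep_legendre_energy[OF c x] by (simp add: h.g_def fun_eq_iff)
  then have "vertical_hessian (energy_rep A c (legendre_energy A E)) x y w w = vertical_hessian (\<lambda>x y. h.g x y y) x y w w"
    by (simp add: vertical_hessian_def)
  then show "0 < vertical_hessian (energy_rep A c (legendre_energy A E)) x y w w"
    using h.vertical_hessian_quadratic_form[OF x] h.g_pos[OF x w] by simp
next
  fix c x assume c: "c \<in> A" and x: "x \<in> chart_range c"
  interpret h: horizontal_finsler_chart "chart_range c" "L c" "\<Gamma> c" by (rule horizontal_finsler_chart_L[OF c])
  show "quadratic_on UNIV (energy_rep A c (legendre_energy A E) x)"
    unfolding quadratic_on_def using h.bilinear_g[OF x] energy_rep_legendre_energy[OF c x]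
    by (intro exI[of _ "h.g x"]) (simp add: h.g_def)
qed

text \<open>Joins \<open>euler_lagrange_quadratic_form_iff\<close> with the geodesic equation in a
  chart. The slit condition enters because \<open>f\<close> and the diagonal of
  \<open>\<Gamma>\<close> agree on nonzero vectors.\<close>

lemma euler_lagrange_legendre_energy_iff:
  assumes \<gamma>: "smooth_curve A I \<gamma>" and t: "t \<in> I" and c: "c \<in> A" "\<gamma> t \<in> fst c"
    and slit: "velocity A \<gamma> t \<in> slit_tangent_bundle A"
  shows "euler_lagrange_at A (legendre_energy A E) \<gamma> c t \<longleftrightarrow>
    velocity (tangent_atlas A) (velocity A \<gamma>) t = S (velocity A \<gamma> t)"
proof -
  interpret h: horizontal_finsler_chart "chart_range c" "L c" "\<Gamma> c" by (rule horizontal_finsler_chart_L[OF c(1)])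
  let ?R = "energy_rep A c (legendre_energy A E)"
  let ?x = "snd c \<circ> \<gamma>" and ?u = "\<lambda>s. snd (velocity A \<gamma> s) c"
  let ?N = "I \<inter> \<gamma> -` fst c"
  have N: "open ?N" "t \<in> ?N" using \<gamma> t c unfolding smooth_curve_iff[OF atlas_A] by auto
  have xr: "?x s \<in> chart_range c" if "s \<in> ?N" for s using that by (simp add: chart_range_def)
  have xd: "(?x has_vector_derivative ?u s) (at s)" if "s \<in> ?N" for s
    using has_vector_derivative_velocity[OF atlas_A \<gamma> _ c(1), of s] that by simp
  have vd: "vector_derivative ?x (at s) = ?u s" if "s \<in> ?N" for s by (rule vector_derivative_at[OF xd[OF that]])
  have Rg: "?R x = (\<lambda>y. h.g x y y)" if "x \<in> chart_range c" for x
    using energy_rep_legendre_energy[OF c(1) that] by (simp add: h.g_def fun_eq_iff)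
  obtain u' where u': "(?u has_vector_derivative u') (at t)"
    using has_derivative_velocity_component(1)[OF \<gamma> t c] by blast
  have u_nz: "?u t \<noteq> 0"
    using slit_iff_component[OF atlas_A velocity_in_tangent_bundle[OF atlas_A \<gamma> t] c(1)] c(2) slit by simp
  have ev: "\<forall>\<^sub>F s in nhds t. ?x s \<in> chart_range c" using N xr unfolding eventually_nhds by blast
  have "frechet_derivative (\<lambda>z. ?R z (?u t)) (at (?x t)) = frechet_derivative (\<lambda>z. h.g z (?u t) (?u t)) (at (?x t))"
    by (rule frechet_derivative_cong_open[OF smooth_atlasD(2)[OF atlas_A c(1)] xr[OF N(2)]]) (simp add: Rg)
  moreover have "((\<lambda>s. frechet_derivative (\<lambda>y. ?R (?x s) y) (at (vector_derivative ?x (at s))) w) has_real_derivative d) (at t)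
    \<longleftrightarrow> ((\<lambda>s. frechet_derivative (\<lambda>y. h.g (?x s) y y) (at (?u s)) w) has_real_derivative d) (at t)" (is "(?p has_real_derivative _) _ \<longleftrightarrow> (?q has_real_derivative _) _") for w d
  proof -
    have "?p s = ?q s" if "s \<in> ?N" for s using Rg[OF xr[OF that]] vd[OF that] by simp
    then show ?thesis
      using has_field_derivative_transform_within_open[of ?p d t ?N ?q] has_field_derivative_transform_within_open[of ?q d t ?N ?p] N
      by auto
  qed
  ultimately have "euler_lagrange_at A (legendre_energy A E) \<gamma> c t \<longleftrightarrow>
      (\<forall>w. ((\<lambda>s. frechet_derivative (\<lambda>y. h.g (?x s) y y) (at (?u s)) w) has_real_derivative
             frechet_derivative (\<lambda>z. h.g z (?u t) (?u t)) (at (?x t)) w) (at t))"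
    unfolding euler_lagrange_at_def Let_def vd[OF N(2)] by simp
  also have "\<dots> \<longleftrightarrow> u' = \<Gamma> c (?x t) (?u t) (?u t)"
    by (rule h.euler_lagrange_quadratic_form_iff[OF ev xd[OF N(2)] u'])
  also have "\<dots> \<longleftrightarrow> u' = f c (snd c (\<gamma> t)) (?u t)" using \<Gamma>_diagonal[OF c(1) xr[OF N(2)] u_nz] by simp
  also have "\<dots> \<longleftrightarrow> (?u has_vector_derivative f c (snd c (\<gamma> t)) (?u t)) (at t)"
    by (rule iffI, use u' in simp, rule vector_derivative_unique_at[OF u'])
  also have "\<dots> \<longleftrightarrow> velocity (tangent_atlas A) (velocity A \<gamma>) t = S (velocity A \<gamma> t)"
    by (rule geodesic_equation_iff[OF \<gamma> t c slit, symmetric])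
  finally show ?thesis .
qed

text \<open>Euler-Lagrange is required in every chart around a point, while the spray equation is
  chart-free; the equivalence in each chart and the existence of at least one reconcile the
  two.\<close>

lemma metric_geodesic_legendre_energy_iff:
  "metric_geodesic A (legendre_energy A E) I \<gamma> \<longleftrightarrow> spray_geodesic A S I \<gamma>"
proof -
  have "(\<forall>t\<in>I. \<forall>c\<in>A. \<gamma> t \<in> fst c \<longrightarrow> euler_lagrange_at A (legendre_energy A E) \<gamma> c t) \<longleftrightarrow>
      (\<forall>t\<in>I. velocity (tangent_atlas A) (velocity A \<gamma>) t = S (velocity A \<gamma> t))" if "regular_curve A I \<gamma>"
  proof -
    have sm: "smooth_curve A I \<gamma>" and slit: "\<And>t. t \<in> I \<Longrightarrow> velocity A \<gamma> t \<in> slit_tangent_bundle A"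
      using that by (auto simp: regular_curve_def)
    have "\<exists>c\<in>A. \<gamma> t \<in> fst c" if "t \<in> I" for t using curve_in_mcarrier[OF sm that] unfolding mcarrier_def by blast
    then show ?thesis using euler_lagrange_legendre_energy_iff[OF sm _ _ _ slit] by metis
  qed
  then show ?thesis unfolding metric_geodesic_def spray_geodesic_def by blast
qed

lemma riemann_metrizable: "invariant_riemann_metrizable G A act S"
  unfolding invariant_riemann_metrizable_def
  using riemannian_legendre_energy invariant_legendre_energy metric_geodesic_legendre_energy_iff by blast

end

text \<open>The identity is an oriented reparametrization of open intervals, hence the restriction
  on the family.\<close>

lemma projectively_equivalent_refl:
  assumes "\<And>I \<gamma>. F I \<gamma> \<Longrightarrow> is_interval I \<and> open I"
  shows "projectively_equivalent F F"
proof -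
  have "oriented_reparametrization I I (\<lambda>t. t)" if "F I \<gamma>" for I \<gamma>
    using assms[OF that] by (auto simp: oriented_reparametrization_def smooth_on_id)
  then show ?thesis unfolding projectively_equivalent_def
    by (metis (no_types, lifting) comp_def ext)
qed

theorem theorem5p6:
  fixes G :: "('g, 'b) monoid_scheme"
    and B :: "('g, 'h::euclidean_space) atlas"
    and A :: "('m, 'e::euclidean_space) atlas"
    and act :: "'g \<Rightarrow> 'm \<Rightarrow> 'm"
    and orig :: 'm
    and S :: "('m, 'e) tangent \<Rightarrow> (('m, 'e) tangent, 'e \<times> 'e) tangent"
  assumes "lie_group G B"
    and "smooth_manifold A"
    and "connected_space (mtopology A)"
    and "smooth_transitive_action G B A act"
    and "orig \<in> mcarrier A"
    and "quadratic_spray A S"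
    and "go_spray G B A act orig S"
  shows "invariant_projectively_finsler_metrizable G A act S \<longleftrightarrow>
         invariant_riemann_metrizable G A act S"
proof
  assume "invariant_projectively_finsler_metrizable G A act S"
  then obtain E where "finsler_metric A E" "invariant_function G A act E"
    "projectively_equivalent (metric_geodesic A E) (spray_geodesic A S)"
    unfolding invariant_projectively_finsler_metrizable_def by blast
  then interpret invariant_finsler_go_space G B A act orig S E
    using assms by unfold_locales
  show "invariant_riemann_metrizable G A act S" by (rule riemann_metrizable)
next
  assume "invariant_riemann_metrizable G A act S"
  then obtain E where E: "riemannian_metric A E" "invariant_function G A act E"
    and geo: "metric_geodesic A E = spray_geodesic A S"
    unfolding invariant_riemann_metrizable_def by blast
  \<comment> \<open>A Riemannian energy is a Finsler energy, and its geodesics are those of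
    \<open>S\<close> including the parameter, so the identity reparametrization suffices.\<close>
  have "projectively_equivalent (spray_geodesic A S) (spray_geodesic A S)"
    by (rule projectively_equivalent_refl) (simp add: spray_geodesic_def regular_curve_def smooth_curve_def)
  then show "invariant_projectively_finsler_metrizable G A act S"
    using E geo unfolding invariant_projectively_finsler_metrizable_def riemannian_metric_def by metis
qed

end
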